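(* Let $u$ be a nonconstant measurable function on $U_1\cup U_2$ such that $$u\in H^s_{\rm loc}(\Omega),\qquad \int_{U_1\cup U_2}\frac{|u(x)|}{1+|x|^{n+2s}}\,dx<\infty,\qquad \mathfrak L^s_Z u\ge 0\ \text{ in }\Omega .$$ Then, up to the choice of a representative of $u$ (i.e. after modifying $u$ on a subset of $\Omega$ of Lebesgue measure zero), $u$ is lower semicontinuous on $\Omega$, locally bounded from below on $\Omega$, and $$u(x)>\inf_{U_1\cup U_2}u\qquad\text{for every }x\in\Omega .$$
   Context: Let $n\ge1$, $s\in(0,1)$, and $C_{n,s}=\frac{s2^{2s}\Gamma(\frac n2+s)}{\pi^{n/2}\Gamma(1-s)}$. Let $\Omega\subseteq\mathbb R^n$ be a domain and $U_1,U_2\subseteq\mathbb R^n$ open sets with $\Omega\subseteq U_1\cap U_2$ (no further assumptions). Put $Z=(U_1\times U_2)\cup(U_2\times U_1)\subseteq\mathbb R^n\times\mathbb R^n$. $H^s(\mathbb R^n)$ is the space of $v\in L^2(\mathbb R^n)$ with $\iint_{\mathbb R^n\times\mathbb R^n}\frac{(v(x)-v(y))^2}{|x-y|^{n+2s}}dxdy<\infty$. One writes $u\in H^s_{\rm loc}(\Omega)$ if for every $G\Subset\Omega$, $u$ coincides on $G$ with some $v\in H^s(\mathbb R^n)$. For measurable $u:U_1\cup U_2\to\mathbb R$ with $u\in H^s_{\rm loc}(\Omega)$ and $\int_{U_1\cup U_2}\frac{|u(x)|}{1+|x|^{n+2s}}dx<\infty$, the distribution $\mathfrak L^s_Zu\in\mathcal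 D'(\Omega)$ is $$\langle \mathfrak L^s_Z u,\varphi\rangle=\frac{C_{n,s}}2\iint_Z\frac{(u(x)-u(y))(\varphi(x)-\varphi(y))}{|x-y|^{n+2s}}\,dxdy,\qquad \varphi\in C^\infty_0(\Omega)$$ (this integral converges absolutely). The inequality $\mathfrak L^s_Zu\ge0$ in $\Omega$ means $\langle\mathfrak L^s_Zu,\varphi\rangle\ge0$ for every $\varphi\in C_0^\infty(\Omega)$ with $\varphi\ge0$. Conventions: $\inf_G u$ denotes the essential infimum of $u$ over $G$ (possibly $-\infty$); "nonconstant" means not almost everywhere equal to a constant; the lower semicontinuous representative takes values in $(-\infty,+\infty]$. *)

theory Defs
  imports "HOL-Probability.Essential_Supremum"
begin

definition frac_const :: "'n::finite itself \<Rightarrow> real \<Rightarrow> real" where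
  "frac_const _ s =
     s * 2 powr (2 * s) * Gamma (real CARD('n) / 2 + s)
       / (pi powr (real CARD('n) / 2) * Gamma (1 - s))"

definition compactly_contained :: "'a::topological_space set \<Rightarrow> 'a set \<Rightarrow> bool"
    (infix \<open>\<Subset>\<close> 50) where
  "G \<Subset> \<Omega> \<longleftrightarrow> compact (closure G) \<and> closure G \<subseteq> \<Omega>"

text \<open>
  Double integrals over pairs \<open>(x, y)\<close> are taken with respect to the product of the Lebesgue
  measures; on the diagonal, a null set, the quotients below have the value \<open>0\<close>.
\<close>

definition Hs :: "real \<Rightarrow> (real ^ 'n \<Rightarrow> real) set" where
  "Hs s = {v. v \<in> borel_measurable lebesgue \<and>
              integrable lebesgue (\<lambda>x. (v x)\<^sup>2) \<and>
              (\<integral>\<^sup>+(x, y). ennreal ((v x - v y)\<^sup>2 / norm (x - y) powr (real CARD('n) + 2 * s))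
                 \<partial>(lebesgue \<Otimes>\<^sub>M lebesgue)) < \<infinity>}"

text \<open>Elements of \<open>Hs s\<close> are \<open>L\<^sup>2\<close> classes, so functions coincide on \<open>G\<close> if they agree almost
  everywhere there.\<close>

definition Hs_loc :: "real \<Rightarrow> (real ^ 'n) set \<Rightarrow> (real ^ 'n \<Rightarrow> real) set" where
  "Hs_loc s \<Omega> = {u. \<forall>G. G \<Subset> \<Omega> \<longrightarrow> (\<exists>v\<in>Hs s. AE x in lebesgue. x \<in> G \<longrightarrow> u x = v x)}"

text \<open>\<open>k\<close> times differentiable with continuous derivatives, by way of iterated directional
  derivatives.\<close>

fun Ck :: "nat \<Rightarrow> ('a::real_normed_vector \<Rightarrow> real) \<Rightarrow> bool" where
  "Ck 0 f \<longleftrightarrow> continuous_on UNIV f"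
| "Ck (Suc k) f \<longleftrightarrow>
     (\<forall>x. f differentiable (at x)) \<and> (\<forall>v. Ck k (\<lambda>x. frechet_derivative f (at x) v))"

definition test_functions :: "'a::real_normed_vector set \<Rightarrow> ('a \<Rightarrow> real) set" where
  "test_functions \<Omega> = {\<phi>. (\<forall>k. Ck k \<phi>) \<and> {x. \<phi> x \<noteq> 0} \<Subset> \<Omega>}"

definition Zset :: "'a set \<Rightarrow> 'a set \<Rightarrow> ('a \<times> 'a) set" where
  "Zset U1 U2 = (U1 \<times> U2) \<union> (U2 \<times> U1)"

definition frac_pairing ::
    "real \<Rightarrow> ((real ^ 'n) \<times> (real ^ 'n)) set \<Rightarrow> (real ^ 'n \<Rightarrow> real) \<Rightarrow> (real ^ 'n \<Rightarrow> real) \<Rightarrow> real" where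
  "frac_pairing s Z u \<phi> = frac_const TYPE('n) s / 2 *
     set_lebesgue_integral (lebesgue \<Otimes>\<^sub>M lebesgue) Z
       (\<lambda>(x, y). (u x - u y) * (\<phi> x - \<phi> y) / norm (x - y) powr (real CARD('n) + 2 * s))"

definition frac_nonneg ::
    "real \<Rightarrow> ((real ^ 'n) \<times> (real ^ 'n)) set \<Rightarrow> (real ^ 'n) set \<Rightarrow> (real ^ 'n \<Rightarrow> real) \<Rightarrow> bool" where
  "frac_nonneg s Z \<Omega> u \<longleftrightarrow>
     (\<forall>\<phi>\<in>test_functions \<Omega>. (\<forall>x. \<phi> x \<ge> 0) \<longrightarrow> frac_pairing s Z u \<phi> \<ge> 0)"

text \<open>Dual to \<^const>\<open>esssup\<close>, which is a \<^const>\<open>Limsup\<close> along the same filter.\<close>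

definition ess_inf :: "'a::euclidean_space set \<Rightarrow> ('a \<Rightarrow> ereal) \<Rightarrow> ereal" where
  "ess_inf G f = Liminf (ae_filter (lebesgue_on G)) f"

definition lsc_on :: "'a::topological_space set \<Rightarrow> ('a \<Rightarrow> ereal) \<Rightarrow> bool" where
  "lsc_on S f \<longleftrightarrow> (\<forall>x\<in>S. f x \<le> Liminf (at x within S) f)"

definition locally_bounded_below_on :: "'a::topological_space set \<Rightarrow> ('a \<Rightarrow> ereal) \<Rightarrow> bool" where
  "locally_bounded_below_on S f \<longleftrightarrow>
     (\<forall>K. compact K \<and> K \<subseteq> S \<longrightarrow> (\<exists>m::real. \<forall>x\<in>K. ereal m \<le> f x))"

end

theory Submission
  imports Defs
begin

text \<open>
  On \<open>\<Omega>\<close> the form over \<open>Zset U1 U2\<close> is the regional form over \<open>U = U1 \<union> U2\<close>, and testing it near a point of \<open>\<Omega>\<close>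
  gives, for the truncation \<open>f\<close> of \<open>u - c\<close> to a small ball, an inequality \<open>L f \<ge> \<kappa> f + g\<close> on a smaller ball, where \<open>L\<close> is the
  fractional Laplacian of the whole space, \<open>0 \<le> \<kappa> \<le> C\<close> comes from the complement of \<open>U\<close> and \<open>g\<close> from the part of \<open>u\<close>
  outside the ball. Mollification turns this into a pointwise inequality for smooth functions, to which touching arguments
  apply: where a smooth barrier touches \<open>f\<^sub>\<epsilon>\<close> from below, \<open>L f\<^sub>\<epsilon>\<close> is at most \<open>L\<close> of the barrier minus the integral of the gap
  against the kernel, and on a small ball of radius \<open>\<eta> r\<close> that integral has order \<open>(\<eta> r)\<^bsup>-2s\<^esup>\<close>, which dominates everything else for small \<open>\<eta>\<close>.

  Local boundedness from below: by convexity (Kato's inequality) \<open>z = \<surd>(1 + f\<^sup>2) - f - 1\<close> satisfies \<open>L z \<le> C z + C'\<close>, and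
  touching at a maximum of \<open>dist(x, \<partial>B)\<^sup>n z\<^sub>\<epsilon>(x)\<close> bounds \<open>z\<close>. Once \<open>u\<close> is bounded below, \<open>f\<close> can be taken nonnegative (choose
  \<open>c\<close> negative) and the zero order term dropped; touching near a density point of \<open>{u \<ge> k}\<close> gives
  \<open>u \<ge> k - \<delta>\<close> in a neighbourhood, so that \<open>u\<close> agrees almost everywhere with its essential lower limit.
  For the strict inequality take \<open>c = inf u\<close>: then \<open>g\<close> is bounded below by a positive constant and a small bump is a barrier.
\<close>

section \<open>The kernel\<close>

text \<open>The mollifier reflected and moved to x is an admissible test function, and the operator
  commutes with convolution, so the weak inequality tested with it is a pointwise inequality for f_e
  at x. All estimates for f_e must then be uniform in e: they see f only through its L^1 norm and
  through measures of sets, which convolution does not increase. The zero order term dictates the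
  order of the steps. It has a good sign only where f >= 0, and c can be chosen to make f
  nonnegative only once u is known to be bounded below. The first step therefore keeps the bad part
  as a multiple of f^-, which z controls. A gap of size m on a ball of radius eta r contributes m
  (eta r)^n times the kernel bound (eta r)^(-n-2s), while a barrier of height m costs m r^(-2s). The
  factor eta^(-2s) is the free parameter of every touching argument. The power n of the distance is
  the one for which a large maximum forces the L^1 norm of z below m r^n at scale r, so that the
  tail and the values of z near the touching point are absorbed together.\<close>

lemma ennreal_le_suminf:
  fixes f :: "nat \<Rightarrow> ennreal"
  shows "f m \<le> suminf f"
  using sum_le_suminf[OF summableI, of "{m}" f] by auto

section \<open>Affine changes of variables and volumes of balls\<close>

lemma nn_integral_lborel_affine:
  fixes f :: "'a::euclidean_space \<Rightarrow> ennreal"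
  assumes [measurable]: "f \<in> borel_measurable borel" and "c \<noteq> 0"
  shows "(\<integral>\<^sup>+x. f (t + c *\<^sub>R x) \<partial>lborel) = ennreal (1 / \<bar>c\<bar> ^ DIM('a)) * (\<integral>\<^sup>+x. f x \<partial>lborel)"
proof -
  have "(\<integral>\<^sup>+x. f x \<partial>lborel) = ennreal (\<bar>c\<bar> ^ DIM('a)) * (\<integral>\<^sup>+x. f (t + c *\<^sub>R x) \<partial>lborel)"
    by (subst lborel_affine[OF assms(2), of t])
       (simp add: nn_integral_density nn_integral_distr nn_integral_cmult ennreal_power)
  then have "ennreal (1 / \<bar>c\<bar> ^ DIM('a)) * (\<integral>\<^sup>+x. f x \<partial>lborel) =
    ennreal (1 / \<bar>c\<bar> ^ DIM('a)) * ennreal (\<bar>c\<bar> ^ DIM('a)) * (\<integral>\<^sup>+x. f (t + c *\<^sub>R x) \<partial>lborel)"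
    by (simp only: mult.assoc)
  also have "ennreal (1 / \<bar>c\<bar> ^ DIM('a)) * ennreal (\<bar>c\<bar> ^ DIM('a)) = 1"
    using assms(2) by (subst ennreal_mult[symmetric]) auto
  finally show ?thesis by simp
qed

lemma integrable_lborel_affine:
  fixes f :: "'a::euclidean_space \<Rightarrow> real"
  assumes f: "integrable lborel f" and c: "c \<noteq> 0"
  shows "integrable lborel (\<lambda>x. f (t + c *\<^sub>R x))"
proof -
  have [measurable]: "f \<in> borel_measurable borel" using f by auto
  have "(\<integral>\<^sup>+x. ennreal (norm (f (t + c *\<^sub>R x))) \<partial>lborel)
      = ennreal (1 / \<bar>c\<bar> ^ DIM('a)) * (\<integral>\<^sup>+x. ennreal (norm (f x)) \<partial>lborel)"
    by (rule nn_integral_lborel_affine) (use c in auto)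
  also have "\<dots> < \<infinity>" using f by (auto simp: integrable_iff_bounded ennreal_mult_less_top)
  finally show ?thesis by (auto simp: integrable_iff_bounded)
qed

lemma integral_lborel_affine:
  fixes f :: "'a::euclidean_space \<Rightarrow> real"
  assumes f: "integrable lborel f" and c: "c \<noteq> 0"
  shows "(\<integral>x. f (t + c *\<^sub>R x) \<partial>lborel) = (\<integral>x. f x \<partial>lborel) / \<bar>c\<bar> ^ DIM('a)"
proof -
  have [measurable]: "f \<in> borel_measurable borel" using f by auto
  have "(\<integral>x. f x \<partial>lborel) = \<bar>c\<bar> ^ DIM('a) * (\<integral>x. f (t + c *\<^sub>R x) \<partial>lborel)"
    by (subst lborel_affine[OF c, of t])
       (simp add: integral_density integral_distr)
  then show ?thesis using c by (simp add: field_simps)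
qed

lemma integrable_lborel_translate:
  fixes f :: "'a::euclidean_space \<Rightarrow> real"
  assumes f: "integrable lborel f"
  shows "integrable lborel (\<lambda>x. f (x + t))" "integrable lborel (\<lambda>x. f (t + x))"
    "integrable lborel (\<lambda>x. f (x - t))" "integrable lborel (\<lambda>x. f (t - x))"
  using integrable_lborel_affine[OF f, of 1 t] integrable_lborel_affine[OF f, of 1 "-t"]
    integrable_lborel_affine[OF f, of "-1" t]
  by (simp_all add: add.commute)

lemma integral_lborel_translate:
  fixes f :: "'a::euclidean_space \<Rightarrow> real"
  assumes f: "integrable lborel f"
  shows "(\<integral>x. f (x + t) \<partial>lborel) = (\<integral>x. f x \<partial>lborel)" "(\<integral>x. f (t + x) \<partial>lborel) = (\<integral>x. f x \<partial>lborel)"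
    "(\<integral>x. f (x - t) \<partial>lborel) = (\<integral>x. f x \<partial>lborel)" "(\<integral>x. f (t - x) \<partial>lborel) = (\<integral>x. f x \<partial>lborel)"
  using integral_lborel_affine[OF f, of 1 t] integral_lborel_affine[OF f, of 1 "-t"]
    integral_lborel_affine[OF f, of "-1" t]
  by (simp_all add: add.commute)

lemma emeasure_lborel_ball:
  fixes x :: "'a::euclidean_space"
  assumes "0 \<le> r"
  shows "emeasure lborel (ball x r) = ennreal (measure lborel (ball (0::'a) 1) * r ^ DIM('a))"
proof -
  have "emeasure lborel (ball x r) = emeasure lborel (ball (0::'a) 1) * ennreal (r ^ DIM('a))"
    using assms by (simp add: emeasure_ball ennreal_mult'' ennreal_power)
  also have "emeasure lborel (ball (0::'a) 1) = ennreal (measure lborel (ball (0::'a) 1))"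
    by (intro emeasure_eq_ennreal_measure) (simp add: emeasure_ball)
  finally show ?thesis using assms by (simp add: ennreal_mult'')
qed

lemma measure_lborel_ball:
  fixes x :: "'a::euclidean_space"
  assumes "0 \<le> r"
  shows "measure lborel (ball x r) = measure lborel (ball (0::'a) 1) * r ^ DIM('a)"
  using emeasure_lborel_ball[OF assms, of x] assms by (simp add: measure_def)

lemma measure_unit_ball_pos: "0 < measure lborel (ball (0::'a::euclidean_space) 1)"
  by (simp add: content_ball)

lemma integrable_indicator_ball:
  "integrable lborel (indicator (ball (x::'a::euclidean_space) r) :: 'a \<Rightarrow> real)"
  using emeasure_bounded_finite[OF bounded_ball, of x r] by (intro integrable_real_indicator) auto

text \<open>Division by zero makes \<open>kern s 0 = 0\<close>.\<close>

definition kern :: "real \<Rightarrow> 'a::euclidean_space \<Rightarrow> real" where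
  "kern s h = 1 / norm h powr (real DIM('a) + 2 * s)"

lemma kern_nonneg [simp]: "0 \<le> kern s h"
  by (simp add: kern_def)

lemma kern_minus [simp]: "kern s (- h) = kern s h"
  by (simp add: kern_def)

lemma kern_commute: "kern s (x - y) = kern s (y - x)"
  by (simp add: kern_def norm_minus_commute)

lemma kern_0 [simp]: "kern s 0 = 0"
  by (simp add: kern_def)

lemma kern_measurable [measurable]: "kern s \<in> borel_measurable borel"
  by (simp add: kern_def[abs_def])

section \<open>Scaling, two-sided bounds and integrability of the kernel\<close>

locale frac_order =
  fixes s :: real
  assumes s_pos: "0 < s" and s_less_1: "s < 1"
begin

lemma kern_scale:
  fixes h :: "'a::euclidean_space"
  assumes "0 < r"
  shows "kern s (r *\<^sub>R h) = r powr - (real DIM('a) + 2 * s) * kern s h"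
  unfolding kern_def powr_minus_divide using assms by (simp add: powr_mult)

lemma kern_le:
  fixes h :: "'a::euclidean_space"
  assumes "0 < r" "r \<le> norm h"
  shows "kern s h \<le> r powr - (real DIM('a) + 2 * s)"
proof -
  have "r powr (real DIM('a) + 2 * s) \<le> norm h powr (real DIM('a) + 2 * s)"
    using assms s_pos by (intro powr_mono2) auto
  moreover have "0 < norm h" using assms by linarith
  ultimately have "1 / norm h powr (real DIM('a) + 2 * s) \<le> 1 / r powr (real DIM('a) + 2 * s)"
    using assms by (intro divide_left_mono) auto
  then show ?thesis
    unfolding kern_def by (subst powr_minus_divide)
qed

lemma kern_ge:
  fixes h :: "'a::euclidean_space"
  assumes "h \<noteq> 0" "norm h \<le> r"
  shows "r powr - (real DIM('a) + 2 * s) \<le> kern s h"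
proof -
  have "norm h powr (real DIM('a) + 2 * s) \<le> r powr (real DIM('a) + 2 * s)"
    using assms s_pos by (intro powr_mono2) auto
  moreover have "0 < r" using assms by (meson norm_le_zero_iff not_le order_trans)
  ultimately have "1 / r powr (real DIM('a) + 2 * s) \<le> 1 / norm h powr (real DIM('a) + 2 * s)"
    using assms by (intro divide_left_mono) auto
  then show ?thesis
    unfolding kern_def by (subst powr_minus_divide)
qed

text \<open>Dyadic shells 2^m <= |h| < 2^(m+1) take the place of polar coordinates: the kernel is at
  most 2^(-m(n+2s)) on a shell whose volume is of order 2^(mn), so the series is geometric with
  ratio 2^(-2s).\<close>

lemma kern_tail_nn_integral_finite:
  "(\<integral>\<^sup>+h. ennreal (kern s (h::'a::euclidean_space)) * indicator {h. 1 \<le> norm h} h \<partial>lborel) < \<infinity>"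
proof -
  define p where "p = real DIM('a) + 2 * s"
  define V where "V = measure lborel (ball (0::'a) 1)"
  have V: "0 \<le> V" by (simp add: V_def)
  have pw: "ennreal (kern s h) * indicator {h. 1 \<le> norm h} h
      \<le> (\<Sum>m. ennreal (2 powr - (real m * p)) * indicator (ball 0 (2 ^ Suc m)) h)" for h :: 'a
  proof (cases "1 \<le> norm h")
    case True
    define m where "m = nat \<lfloor>log 2 (norm h)\<rfloor>"
    have "0 < norm h" using True by linarith
    then have l0: "0 \<le> log 2 (norm h)" using True by (subst zero_le_log_cancel_iff) auto
    have m1: "real m \<le> log 2 (norm h)" unfolding m_def using l0 by linarith
    have m2: "log 2 (norm h) < real (Suc m)" unfolding m_def using l0 by linarith
    have h1: "2 ^ m \<le> norm h"
    proof -
      have "2 powr real m \<le> 2 powr (log 2 (norm h))" using m1 by (intro powr_mono) auto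
      then show ?thesis using \<open>0 < norm h\<close> by (simp add: powr_realpow)
    qed
    have h2: "norm h < 2 ^ Suc m"
    proof -
      have "norm h = 2 powr (log 2 (norm h))" using \<open>0 < norm h\<close> by simp
      also have "\<dots> < 2 powr real (Suc m)" using m2 by (intro powr_less_mono) auto
      also have "\<dots> = 2 ^ Suc m" by (subst powr_realpow) auto
      finally show ?thesis .
    qed
    have "kern s h \<le> (2 ^ m) powr - p"
      unfolding p_def using h1 by (intro kern_le) auto
    also have "(2 ^ m) powr - p = (2::real) powr - (real m * p)"
      by (simp add: powr_realpow[symmetric] powr_powr)
    finally have "ennreal (kern s h) * indicator {h. 1 \<le> norm h} h
        \<le> ennreal (2 powr - (real m * p)) * indicator (ball 0 (2 ^ Suc m)) h"
      using True h2 by (auto intro!: ennreal_leI)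
    also have "\<dots> \<le> (\<Sum>m. ennreal (2 powr - (real m * p)) * indicator (ball 0 (2 ^ Suc m)) h)"
      using ennreal_le_suminf[of "\<lambda>m. ennreal (2 powr - (real m * p)) * indicator (ball 0 (2 ^ Suc m)) h" m] .
    finally show ?thesis .
  qed simp
  have "(\<integral>\<^sup>+h. ennreal (kern s (h::'a)) * indicator {h. 1 \<le> norm h} h \<partial>lborel)
    \<le> (\<integral>\<^sup>+h. (\<Sum>m. ennreal (2 powr - (real m * p)) * indicator (ball 0 (2 ^ Suc m)) (h::'a)) \<partial>lborel)"
    by (intro nn_integral_mono pw)
  also have "\<dots> = (\<Sum>m. \<integral>\<^sup>+h. ennreal (2 powr - (real m * p)) * indicator (ball 0 (2 ^ Suc m)) (h::'a) \<partial>lborel)"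
    by (rule nn_integral_suminf) (intro borel_measurable_times_ennreal borel_measurable_const borel_measurable_indicator, simp)
  also have "\<dots> = (\<Sum>m. ennreal (2 powr - (real m * p)) * emeasure lborel (ball (0::'a) (2 ^ Suc m)))"
    by (subst nn_integral_cmult_indicator) simp_all
  also have "\<dots> = (\<Sum>m. ennreal (V * 2 ^ DIM('a) * (2 powr - (2 * s)) ^ m))"
  proof (intro suminf_cong)
    fix m :: nat
    have a: "(2 powr - (real m * p)) * (V * (2 ^ Suc m) ^ DIM('a)) = V * 2 ^ DIM('a) * (2 powr - (2 * s)) ^ m"
    proof -
      have "(2::real) powr - (real m * p) * (2 ^ m) ^ DIM('a) = 2 powr - (real m * p) * 2 powr (real m * DIM('a))"
        by (simp add: powr_realpow[symmetric] power_mult powr_powr powr_mult)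
      also have "\<dots> = 2 powr (real m * - (2 * s))"
        by (simp add: powr_add[symmetric] p_def algebra_simps)
      also have "\<dots> = (2 powr - (2 * s)) ^ m"
        by (subst powr_realpow[symmetric], simp, simp add: powr_powr mult.commute)
      finally show ?thesis by (simp add: power_mult_distrib field_simps)
    qed
    show "ennreal (2 powr - (real m * p)) * emeasure lborel (ball (0::'a) (2 ^ Suc m))
      = ennreal (V * 2 ^ DIM('a) * (2 powr - (2 * s)) ^ m)"
      by (subst emeasure_lborel_ball, simp, subst ennreal_mult[symmetric])
         (use a V in \<open>simp_all add: V_def\<close>)
  qed
  also have "\<dots> < \<infinity>"
  proof -
    have "2 powr - (2 * s) < (2::real) powr 0" using s_pos by (intro powr_less_mono) auto
    then have "summable (\<lambda>m. V * 2 ^ DIM('a) * (2 powr - (2 * s)) ^ m)"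
      by (intro summable_mult summable_geometric) auto
    then show ?thesis using V by (subst suminf_ennreal2) auto
  qed
  finally show ?thesis .
qed

text \<open>On the shell 2^(-m-1) <= |h| < 2^(-m) the kernel is at most 2^((m+1)(n+2s)), the factor
  |h|^2 at most 4^(-m) and the volume of order 2^(-mn). The ratio 2^(2s-2) is below 1 because s < 1.
  The factor |h|^2 is what second differences will supply.\<close>

lemma kern_core_nn_integral_finite:
  "(\<integral>\<^sup>+h. ennreal ((norm h)\<^sup>2 * kern s (h::'a::euclidean_space)) * indicator {h. norm h < 1} h \<partial>lborel) < \<infinity>"
proof -
  define p where "p = real DIM('a) + 2 * s"
  define V where "V = measure lborel (ball (0::'a) 1)"
  have V: "0 \<le> V" by (simp add: V_def)
  have pw: "ennreal ((norm h)\<^sup>2 * kern s h) * indicator {h. norm h < 1} h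
      \<le> (\<Sum>m. ennreal (2 powr (real (Suc m) * p) * (1/4) ^ m) * indicator (ball 0 ((1/2) ^ m)) h)" for h :: 'a
  proof (cases "h \<noteq> 0 \<and> norm h < 1")
    case True
    \<comment> \<open>Ceiling minus one instead of a floor: the bound
      \<open>norm h < (1/2) ^ m\<close> must be strict to place h in an open ball.\<close>
    define m where "m = nat (\<lceil>- log 2 (norm h)\<rceil> - 1)"
    have l0: "0 < - log 2 (norm h)" using True by simp
    then have c0: "1 \<le> \<lceil>- log 2 (norm h)\<rceil>" by linarith
    have m1: "real m < - log 2 (norm h)" unfolding m_def using c0 by linarith
    have m2: "- log 2 (norm h) \<le> real (Suc m)" unfolding m_def using c0 by linarith
    have h1: "2 powr - real (Suc m) \<le> norm h"
    proof -
      have "2 powr - real (Suc m) \<le> 2 powr (log 2 (norm h))" using m2 by (intro powr_mono) auto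
      then show ?thesis using True by simp
    qed
    have h2: "norm h < (1/2) ^ m"
    proof -
      have "2 powr (log 2 (norm h)) < 2 powr - real m" using m1 by (intro powr_less_mono) auto
      moreover have "(2::real) powr - real m = (1/2) ^ m"
        by (simp add: powr_minus powr_realpow power_one_over field_simps)
      ultimately show ?thesis using True by simp
    qed
    have "kern s h \<le> (2 powr - real (Suc m)) powr - p"
      unfolding p_def using h1 by (intro kern_le) auto
    also have "(2 powr - real (Suc m)) powr - p = (2::real) powr (real (Suc m) * p)"
      by (subst powr_powr) (simp add: algebra_simps)
    finally have k1: "kern s h \<le> 2 powr (real (Suc m) * p)" .
    have "(norm h)\<^sup>2 \<le> ((1/2) ^ m)\<^sup>2" using h2 by (intro power_mono) auto
    also have "((1/2::real) ^ m)\<^sup>2 = (1/4) ^ m"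
      by (simp add: power_mult[symmetric] mult.commute[of m] ) (simp add: power_mult power2_eq_square)
    finally have "(norm h)\<^sup>2 * kern s h \<le> (1/4) ^ m * 2 powr (real (Suc m) * p)"
      using k1 by (intro mult_mono) auto
    then have "ennreal ((norm h)\<^sup>2 * kern s h) * indicator {h. norm h < 1} h
        \<le> ennreal (2 powr (real (Suc m) * p) * (1/4) ^ m) * indicator (ball 0 ((1/2) ^ m)) h"
      using True h2 by (auto intro!: ennreal_leI simp: mult.commute)
    also have "\<dots> \<le> (\<Sum>m. ennreal (2 powr (real (Suc m) * p) * (1/4) ^ m) * indicator (ball 0 ((1/2) ^ m)) h)"
      using ennreal_le_suminf[of "\<lambda>m. ennreal (2 powr (real (Suc m) * p) * (1/4) ^ m) * indicator (ball 0 ((1/2) ^ m)) h" m] .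
    finally show ?thesis .
  qed auto
  have "(\<integral>\<^sup>+h. ennreal ((norm h)\<^sup>2 * kern s (h::'a)) * indicator {h. norm h < 1} h \<partial>lborel)
    \<le> (\<integral>\<^sup>+h. (\<Sum>m. ennreal (2 powr (real (Suc m) * p) * (1/4) ^ m) * indicator (ball 0 ((1/2) ^ m)) (h::'a)) \<partial>lborel)"
    by (intro nn_integral_mono pw)
  also have "\<dots> = (\<Sum>m. \<integral>\<^sup>+h. ennreal (2 powr (real (Suc m) * p) * (1/4) ^ m) * indicator (ball 0 ((1/2) ^ m)) (h::'a) \<partial>lborel)"
    by (rule nn_integral_suminf) (intro borel_measurable_times_ennreal borel_measurable_const borel_measurable_indicator, simp)
  also have "\<dots> = (\<Sum>m. ennreal (2 powr (real (Suc m) * p) * (1/4) ^ m) * emeasure lborel (ball (0::'a) ((1/2) ^ m)))"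
    by (subst nn_integral_cmult_indicator) simp_all
  also have "\<dots> = (\<Sum>m. ennreal (V * 2 powr p * (2 powr (2 * s - 2)) ^ m))"
  proof (intro suminf_cong)
    fix m :: nat
    have a: "2 powr (real (Suc m) * p) * (1/4) ^ m * (V * ((1/2) ^ m) ^ DIM('a)) = V * 2 powr p * (2 powr (2 * s - 2)) ^ m"
    proof -
      have e1: "(1/4::real) ^ m = 2 powr (- 2 * real m)"
        by (simp add: powr_minus powr_realpow power_one_over field_simps powr_powr[symmetric] power2_eq_square power_mult_distrib[symmetric])
      have e2: "((1/2::real) ^ m) ^ DIM('a) = 2 powr (- real m * DIM('a))"
        by (simp add: powr_minus powr_realpow power_one_over field_simps powr_powr[symmetric])
      have e3: "(2 powr (2 * s - 2)) ^ m = (2::real) powr (real m * (2 * s - 2))"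
        by (subst powr_realpow[symmetric], simp, simp add: powr_powr mult.commute)
      have "(2::real) powr (real (Suc m) * p) * (1/4) ^ m * ((1/2) ^ m) ^ DIM('a)
         = 2 powr (real (Suc m) * p + (- 2 * real m) + (- real m * DIM('a)))"
        unfolding e1 e2 by (simp only: powr_add)
      also have "real (Suc m) * p + (- 2 * real m) + (- real m * DIM('a)) = p + real m * (2 * s - 2)"
        by (simp add: p_def algebra_simps)
      finally show ?thesis unfolding e3 by (simp add: powr_add)
    qed
    show "ennreal (2 powr (real (Suc m) * p) * (1/4) ^ m) * emeasure lborel (ball (0::'a) ((1/2) ^ m))
      = ennreal (V * 2 powr p * (2 powr (2 * s - 2)) ^ m)"
      by (subst emeasure_lborel_ball, simp, subst ennreal_mult[symmetric])
         (use a V in \<open>simp_all add: V_def\<close>)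
  qed
  also have "\<dots> < \<infinity>"
  proof -
    have "2 powr (2 * s - 2) < (2::real) powr 0" using s_less_1 by (intro powr_less_mono) auto
    then have "summable (\<lambda>m. V * 2 powr p * (2 powr (2 * s - 2)) ^ m)"
      by (intro summable_mult summable_geometric) auto
    then show ?thesis using V by (subst suminf_ennreal2) auto
  qed
  finally show ?thesis .
qed

text \<open>The kernel damped by the size that a second difference of a function varying at scale r
  has: quadratic inside radius r, bounded outside. By scaling its integral is \<open>K0\<close>
  times r^(-2s).\<close>

definition wkern :: "real \<Rightarrow> 'a::euclidean_space \<Rightarrow> real" where
  "wkern r h = min 1 ((norm h / r)\<^sup>2) * kern s h"

lemma wkern_nonneg [simp]: "0 \<le> wkern r h"
  by (simp add: wkern_def)

lemma wkern_measurable [measurable]: "wkern r \<in> borel_measurable borel"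
  by (simp add: wkern_def[abs_def])

lemma integrable_wkern_1: "integrable lborel (wkern 1 :: 'a::euclidean_space \<Rightarrow> real)"
proof (rule integrableI_bounded)
  have "(\<integral>\<^sup>+h. ennreal (norm (wkern 1 (h::'a))) \<partial>lborel)
    \<le> (\<integral>\<^sup>+h. ennreal (kern s (h::'a)) * indicator {h. 1 \<le> norm h} h +
         ennreal ((norm h)\<^sup>2 * kern s (h::'a)) * indicator {h. norm h < 1} h \<partial>lborel)"
    by (intro nn_integral_mono)
       (auto simp: wkern_def indicator_def abs_mult intro!: ennreal_leI mult_right_mono
          mult_left_le_one_le)
  also have "\<dots> < \<infinity>"
    using kern_tail_nn_integral_finite[where 'a='a] kern_core_nn_integral_finite[where 'a='a]
    by (subst nn_integral_add) auto
  finally show "(\<integral>\<^sup>+h. ennreal (norm (wkern 1 (h::'a))) \<partial>lborel) < \<infinity>" .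
qed simp

definition K0 :: "'a::euclidean_space itself \<Rightarrow> real" where
  "K0 _ = (\<integral>h. wkern 1 (h::'a) \<partial>lborel)"

lemma K0_nonneg [simp]: "0 \<le> K0 TYPE('a::euclidean_space)"
  by (simp add: K0_def)

lemma wkern_scale:
  fixes h :: "'a::euclidean_space"
  assumes "0 < r"
  shows "wkern r h = r powr - (real DIM('a) + 2 * s) * wkern 1 (h /\<^sub>R r)"
  using kern_scale[OF assms, of "h /\<^sub>R r"] assms
  by (simp add: wkern_def field_simps)

lemma integrable_wkern:
  assumes "0 < r"
  shows "integrable lborel (wkern r :: 'a::euclidean_space \<Rightarrow> real)"
proof -
  have eq: "wkern r = (\<lambda>h::'a. r powr - (real DIM('a) + 2 * s) * wkern 1 (h /\<^sub>R r))"
    by (intro ext wkern_scale assms)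
  show ?thesis
    unfolding eq using integrable_lborel_affine[OF integrable_wkern_1[where 'a='a], of "inverse r" 0] assms
    by simp
qed

lemma integral_wkern:
  assumes "0 < r"
  shows "(\<integral>h. wkern r (h::'a::euclidean_space) \<partial>lborel) = K0 TYPE('a) * r powr - (2 * s)"
proof -
  have "(\<integral>h. wkern r (h::'a) \<partial>lborel) =
    r powr - (real DIM('a) + 2 * s) * (K0 TYPE('a) / \<bar>inverse r\<bar> ^ DIM('a))"
    using integral_lborel_affine[OF integrable_wkern_1[where 'a='a], of "inverse r" 0] assms
    by (subst wkern_scale) (simp_all add: K0_def)
  also have "\<dots> = K0 TYPE('a) * (r powr - (real DIM('a) + 2 * s) * r powr (real DIM('a)))"
    using assms by (simp add: powr_realpow power_inverse field_simps)
  also have "r powr - (real DIM('a) + 2 * s) * r powr (real DIM('a)) = r powr - (2 * s)"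
    by (simp add: powr_add[symmetric])
  finally show ?thesis .
qed

lemma wkern_far: "0 < r \<Longrightarrow> r \<le> norm h \<Longrightarrow> wkern r h = kern s h"
  by (simp add: wkern_def min_def)

lemma wkern_near: "0 < r \<Longrightarrow> norm h \<le> r \<Longrightarrow> wkern r h = (norm h / r)\<^sup>2 * kern s h"
  by (simp add: wkern_def min_def power_le_one field_simps)

end

section \<open>Smooth bumps\<close>

definition expinv :: "nat \<Rightarrow> real \<Rightarrow> real" where
  "expinv k t = (if 0 < t then exp (- 1 / t) / t ^ k else 0)"

lemma power_div_fact_le_exp:
  fixes y :: real
  assumes "0 \<le> y"
  shows "y ^ n / fact n \<le> exp y"
proof -
  have "(\<Sum>i\<in>{n}. y ^ i / fact i) \<le> exp y"
    using sum_le_suminf[OF summable_exp_generic[of y], of "{n}"] assms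
    by (simp add: exp_def divide_inverse mult.commute)
  then show ?thesis by simp
qed

lemma expinv_nonneg [simp]: "0 \<le> expinv k t"
  by (simp add: expinv_def)

text \<open>Since exp(1/t) dominates (1/t)^(k+m) / (k+m)!, the function vanishes at 0 to every order
  m. The case m = 0 gives boundedness, m = 2 differentiability at 0.\<close>

lemma expinv_le: "expinv k t \<le> fact (k + m) * \<bar>t\<bar> ^ m"
proof (cases "0 < t")
  case True
  have "(1 / t) ^ (k + m) / fact (k + m) \<le> exp (1 / t)"
    using True by (intro power_div_fact_le_exp) auto
  then have "exp (- 1 / t) * ((1 / t) ^ (k + m) / fact (k + m)) \<le> exp (- 1 / t) * exp (1 / t)"
    by (intro mult_left_mono) auto
  then have "exp (- 1 / t) * ((1 / t) ^ (k + m) / fact (k + m)) \<le> 1"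
    by (simp add: mult_exp_exp)
  then have "exp (- 1 / t) * (1 / t) ^ (k + m) \<le> fact (k + m)"
    unfolding times_divide_eq_right by (subst (asm) divide_le_eq_1_pos) auto
  then have "exp (- 1 / t) * (1 / t) ^ (k + m) * t ^ m \<le> fact (k + m) * t ^ m"
    using True by (intro mult_right_mono) auto
  moreover have "exp (- 1 / t) * (1 / t) ^ (k + m) * t ^ m = expinv k t"
    using True by (simp add: expinv_def power_add field_simps)
  ultimately show ?thesis using True by (simp only: abs_of_pos)
next
  case False
  then show ?thesis by (simp add: expinv_def)
qed

lemma expinv_bound: "expinv k t \<le> fact k"
  using expinv_le[of k t 0] by simp

text \<open>This is why the family is indexed by k: differentiating member k leads to members k + 2
  and k + 1. At t = 0 flatness of order two controls the difference quotient.\<close>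

lemma expinv_derivative:
  "(expinv k has_real_derivative expinv (k + 2) t - real k * expinv (k + 1) t) (at t)"
proof -
  consider "t > 0" | "t < 0" | "t = 0" by linarith
  then show ?thesis
  proof cases
    case 1
    have k: "real k * t ^ (k - Suc 0) = real k * t ^ k / t"
      using 1 by (cases k) auto
    have "((\<lambda>t. exp (- 1 / t)) has_real_derivative exp (- 1 / t) / t\<^sup>2) (at t)"
      using 1 by (auto intro!: derivative_eq_intros simp: power2_eq_square)
    from DERIV_divide[OF this DERIV_pow[of k t]] 1
    have "((\<lambda>t. exp (- 1 / t) / t ^ k) has_real_derivative
        (exp (- 1 / t) / t\<^sup>2 * t ^ k - exp (- 1 / t) * (real k * t ^ k / t)) / (t ^ k * t ^ k)) (at t)"
      by (simp add: k)
    also have "(exp (- 1 / t) / t\<^sup>2 * t ^ k - exp (- 1 / t) * (real k * t ^ k / t)) / (t ^ k * t ^ k)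
      = expinv (k + 2) t - real k * expinv (k + 1) t"
      using 1 by (simp add: expinv_def power_add power2_eq_square field_simps)
    finally have "((\<lambda>t. exp (- 1 / t) / t ^ k) has_real_derivative
        expinv (k + 2) t - real k * expinv (k + 1) t) (at t)" .
    then show ?thesis
      by (rule has_field_derivative_transform_within[where d=t and S=UNIV])
         (use 1 in \<open>auto simp: expinv_def dist_real_def\<close>)
  next
    case 2
    have "((\<lambda>t. 0) has_real_derivative 0) (at t)" by simp
    then have "(expinv k has_real_derivative 0) (at t)"
      by (rule has_field_derivative_transform_within[where d="-t" and S=UNIV])
         (use 2 in \<open>auto simp: expinv_def dist_real_def\<close>)
    then show ?thesis using 2 by (simp add: expinv_def)
  next
    case 3
    have "((\<lambda>h. expinv k h / h) \<longlongrightarrow> 0) (at 0)"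
    proof (rule Lim_null_comparison[of _ "\<lambda>h. fact (k + 2) * \<bar>h\<bar>"])
      show "\<forall>\<^sub>F h in at 0. norm (expinv k h / h) \<le> fact (k + 2) * \<bar>h\<bar>"
      proof (rule eventuallyI)
        fix h :: real
        show "norm (expinv k h / h) \<le> fact (k + 2) * \<bar>h\<bar>"
          using expinv_le[of k h 2]
          by (cases "h = 0") (auto simp: abs_mult divide_le_eq power2_eq_square mult.assoc)
      qed
      show "((\<lambda>h. fact (k + 2) * \<bar>h\<bar>) \<longlongrightarrow> (0::real)) (at 0)"
        by (auto intro!: tendsto_eq_intros)
    qed
    then show ?thesis using 3 by (simp add: DERIV_def expinv_def)
  qed
qed

text \<open>An algebra generated by the radial functions built from \<open>expinv\<close> and by
  linear functionals. Directional derivatives stay inside it, so membership yields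
  \<open>Ck k\<close> for all k by one induction, without formulas for higher derivatives of the
  bump.\<close>

inductive_set smooth_gen :: "('a::euclidean_space \<Rightarrow> real) set" where
  expinv: "(\<lambda>x. expinv k (1 - x \<bullet> x)) \<in> smooth_gen"
| const: "(\<lambda>x. c) \<in> smooth_gen"
| lin: "(\<lambda>x. x \<bullet> v) \<in> smooth_gen"
| add: "f \<in> smooth_gen \<Longrightarrow> g \<in> smooth_gen \<Longrightarrow> (\<lambda>x. f x + g x) \<in> smooth_gen"
| mult: "f \<in> smooth_gen \<Longrightarrow> g \<in> smooth_gen \<Longrightarrow> (\<lambda>x. f x * g x) \<in> smooth_gen"

lemma expinv_ball_derivative:
  "((\<lambda>x::'a::euclidean_space. expinv k (1 - x \<bullet> x)) has_derivative
     (\<lambda>v. (expinv (k + 2) (1 - x \<bullet> x) + - real k * expinv (k + 1) (1 - x \<bullet> x)) * (-2 * (x \<bullet> v)))) (at x)"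
proof -
  have "((\<lambda>x::'a. 1 - x \<bullet> x) has_derivative (\<lambda>v. -2 * (x \<bullet> v))) (at x)"
    by (auto intro!: derivative_eq_intros simp: inner_commute)
  from has_derivative_compose[OF this expinv_derivative[of k "1 - x \<bullet> x", unfolded has_field_derivative_def]]
  show ?thesis by (simp add: algebra_simps)
qed

lemma smooth_gen_derivative:
  assumes "f \<in> smooth_gen"
  shows "\<exists>D. (\<forall>x. (f has_derivative D x) (at x)) \<and> (\<forall>v. (\<lambda>x. D x v) \<in> smooth_gen)"
  using assms
proof induction
  case (expinv k)
  show ?case
    by (rule exI[of _ "\<lambda>x v. (expinv (k + 2) (1 - x \<bullet> x) + - real k * expinv (k + 1) (1 - x \<bullet> x)) * (-2 * (x \<bullet> v))"])
       (intro conjI allI expinv_ball_derivative smooth_gen.intros)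
next
  case (const c)
  show ?case by (rule exI[of _ "\<lambda>x v. 0"]) (auto intro: smooth_gen.const)
next
  case (lin w)
  show ?case
    by (rule exI[of _ "\<lambda>x v. v \<bullet> w"]) (auto intro!: smooth_gen.const derivative_eq_intros)
next
  case (add f g)
  then obtain Df Dg where "\<forall>x. (f has_derivative Df x) (at x)" "\<forall>v. (\<lambda>x. Df x v) \<in> smooth_gen"
     "\<forall>x. (g has_derivative Dg x) (at x)" "\<forall>v. (\<lambda>x. Dg x v) \<in> smooth_gen" by blast
  then show ?case
    by (intro exI[of _ "\<lambda>x v. Df x v + Dg x v"]) (auto intro!: smooth_gen.add derivative_eq_intros)
next
  case (mult f g)
  then obtain Df Dg where "\<forall>x. (f has_derivative Df x) (at x)" "\<forall>v. (\<lambda>x. Df x v) \<in> smooth_gen"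
     "\<forall>x. (g has_derivative Dg x) (at x)" "\<forall>v. (\<lambda>x. Dg x v) \<in> smooth_gen" by blast
  with mult show ?case
    by (intro exI[of _ "\<lambda>x v. f x * Dg x v + Df x v * g x"])
       (auto intro!: smooth_gen.add smooth_gen.mult has_derivative_mult)
qed

lemma Ck_smooth_gen: "f \<in> smooth_gen \<Longrightarrow> Ck k f"
proof (induction k arbitrary: f)
  case 0
  from smooth_gen_derivative[OF this] obtain D where "\<And>x. (f has_derivative D x) (at x)" by blast
  then show ?case
    by (auto intro!: continuous_at_imp_continuous_on intro: has_derivative_continuous)
next
  case (Suc k)
  from smooth_gen_derivative[OF Suc.prems] obtain D where
    D: "\<And>x. (f has_derivative D x) (at x)" "\<And>v. (\<lambda>x. D x v) \<in> smooth_gen" by blast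
  have "frechet_derivative f (at x) = D x" for x
    using D(1) by (metis frechet_derivative_at)
  with D Suc.IH show ?case by (auto simp: differentiable_def)
qed

text \<open>The factor c belongs to the induction because each derivative produces a further factor
  a.\<close>

lemma Ck_affine:
  fixes f :: "'a::real_normed_vector \<Rightarrow> real"
  shows "Ck k f \<Longrightarrow> Ck k (\<lambda>x. c * f (a *\<^sub>R x + b))"
proof (induction k arbitrary: f c)
  case 0
  then have "continuous_on UNIV f" by simp
  then have "continuous_on UNIV (\<lambda>x. f (a *\<^sub>R x + b))"
    by (rule continuous_on_compose2) (auto intro!: continuous_intros)
  then show ?case by (auto intro!: continuous_intros)
next
  case (Suc k)
  let ?D = "\<lambda>y. frechet_derivative f (at y)"
  have d: "((\<lambda>x. c * f (a *\<^sub>R x + b)) has_derivative (\<lambda>v. c * ?D (a *\<^sub>R x + b) (a *\<^sub>R v))) (at x)" for x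
  proof -
    have "(f has_derivative ?D (a *\<^sub>R x + b)) (at (a *\<^sub>R x + b))"
      using Suc.prems by (auto simp: frechet_derivative_works[symmetric])
    moreover have "((\<lambda>x. a *\<^sub>R x + b) has_derivative (\<lambda>v. a *\<^sub>R v)) (at x)"
      by (auto intro!: derivative_eq_intros)
    ultimately have "((\<lambda>x. f (a *\<^sub>R x + b)) has_derivative (\<lambda>v. ?D (a *\<^sub>R x + b) (a *\<^sub>R v))) (at x)"
      by (rule has_derivative_compose[rotated])
    then show ?thesis by (rule has_derivative_mult_right)
  qed
  have e: "frechet_derivative (\<lambda>x. c * f (a *\<^sub>R x + b)) (at x) v = c * a * ?D (a *\<^sub>R x + b) v" for x v
  proof -
    have "linear (?D (a *\<^sub>R x + b))"
      using Suc.prems by (auto intro!: linear_frechet_derivative)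
    then show ?thesis
      unfolding frechet_derivative_at[OF d, symmetric] by (simp add: linear_cmul)
  qed
  have "Ck k (\<lambda>x. c * a * ?D (a *\<^sub>R x + b) v)" for v
    using Suc.prems by (intro Suc.IH[of "\<lambda>x. ?D x v" "c * a"]) auto
  then show ?case
    using d by (auto simp: e differentiable_def)
qed

text \<open>The mean value theorem for t -> f(x + t h) + f(x - t h) on [0, 1]: the derivative of
  this sum is a difference of values of D at points 2 t |h| apart, so a Lipschitz bound on D takes
  the place of a second derivative.\<close>

lemma second_difference_bound:
  fixes f :: "'a::real_normed_vector \<Rightarrow> real"
  assumes D: "\<And>x. (f has_derivative D x) (at x)"
    and L: "\<And>x y v. \<bar>D x v - D y v\<bar> \<le> L * norm v * norm (x - y)"
  shows "\<bar>2 * f x - f (x + h) - f (x - h)\<bar> \<le> 2 * L * (norm h)\<^sup>2"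
proof -
  define G where "G t = f (x + t *\<^sub>R h) + f (x - t *\<^sub>R h)" for t :: real
  have dG: "(G has_real_derivative (D (x + t *\<^sub>R h) h - D (x - t *\<^sub>R h) h)) (at t)" for t
  proof -
    have lin: "linear (D y)" for y using D has_derivative_linear by blast
    have "((\<lambda>t. x + t *\<^sub>R h) has_derivative (\<lambda>u. u *\<^sub>R h)) (at t)"
         "((\<lambda>t. x - t *\<^sub>R h) has_derivative (\<lambda>u. - (u *\<^sub>R h))) (at t)"
      by (auto intro!: derivative_eq_intros)
    from has_derivative_add[OF has_derivative_compose[OF this(1) D] has_derivative_compose[OF this(2) D]]
    show ?thesis
      unfolding G_def[abs_def] has_field_derivative_def
      by (rule back_subst[where P="\<lambda>d. (_ has_derivative d) _"])
         (auto simp: fun_eq_iff linear_cmul[OF lin] linear_neg[OF lin] algebra_simps)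
  qed
  obtain t where t: "0 < t" "t < 1" "G 1 - G 0 = (1 - 0) * (D (x + t *\<^sub>R h) h - D (x - t *\<^sub>R h) h)"
    using MVT2[of 0 1 G "\<lambda>t. D (x + t *\<^sub>R h) h - D (x - t *\<^sub>R h) h"] dG by auto
  have "\<bar>2 * f x - f (x + h) - f (x - h)\<bar> = \<bar>G 1 - G 0\<bar>" by (simp add: G_def)
  also have "\<dots> = \<bar>D (x + t *\<^sub>R h) h - D (x - t *\<^sub>R h) h\<bar>" using t by simp
  also have "\<dots> \<le> L * norm h * norm ((x + t *\<^sub>R h) - (x - t *\<^sub>R h))" by (rule L)
  also have "(x + t *\<^sub>R h) - (x - t *\<^sub>R h) = (2 * t) *\<^sub>R h" by (simp add: scaleR_2[symmetric])
  also have "L * norm h * norm ((2 * t) *\<^sub>R h) = 2 * (t * (L * (norm h)\<^sup>2))"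
    using t by (simp add: power2_eq_square)
  also have "\<dots> \<le> 2 * (1 * (L * (norm h)\<^sup>2))"
  proof -
    have "0 \<le> L * norm h * norm h" using order_trans[OF abs_ge_zero L[of h h 0]] by simp
    then have "0 \<le> L * (norm h)\<^sup>2" by (simp add: power2_eq_square mult.assoc)
    then show ?thesis using t by (intro mult_left_mono mult_right_mono) auto
  qed
  finally show ?thesis by simp
qed

section \<open>The radial bump and the normalised mollifiers\<close>

definition bump :: "'a::euclidean_space \<Rightarrow> real" where
  "bump x = expinv 0 (1 - x \<bullet> x)"

lemma bump_nonneg [simp]: "0 \<le> bump x"
  by (simp add: bump_def)

lemma bump_le_1: "bump x \<le> 1"
  using expinv_bound[of 0] by (simp add: bump_def)

lemma bump_le_bump_0: "bump x \<le> bump 0"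
proof (cases "x \<bullet> x < 1")
  case True
  have "1 / 1 \<le> 1 / (1 - x \<bullet> x)" using True by (intro divide_left_mono) auto
  then show ?thesis using True by (simp add: bump_def expinv_def)
next
  case False then show ?thesis by (simp add: bump_def expinv_def)
qed

lemma bump_0_pos: "0 < bump 0"
  by (simp add: bump_def expinv_def)

lemma expinv_ball_eq_0: "1 \<le> norm x \<Longrightarrow> expinv k (1 - x \<bullet> x) = 0"
  using power_less_one_iff[of "norm x" 2] by (auto simp: expinv_def dot_square_norm)

lemma bump_eq_0: "1 \<le> norm x \<Longrightarrow> bump x = 0"
  by (simp add: bump_def expinv_ball_eq_0)

lemma bump_pos: "norm x < 1 \<Longrightarrow> 0 < bump x"
  by (simp add: bump_def expinv_def dot_square_norm power_less_one_iff abs_square_less_1)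

lemma Ck_bump: "Ck k (bump :: 'a::euclidean_space \<Rightarrow> real)"
  unfolding bump_def[abs_def] by (rule Ck_smooth_gen) (rule smooth_gen.intros)

lemma bump_derivative:
  "(bump has_derivative (\<lambda>v. expinv 2 (1 - x \<bullet> x) * (-2 * (x \<bullet> v)))) (at (x::'a::euclidean_space))"
  using expinv_ball_derivative[of 0 x] by (simp add: bump_def[abs_def] numeral_2_eq_2)

lemma continuous_bump: "continuous_on S bump"
  by (intro continuous_at_imp_continuous_on ballI has_derivative_continuous[OF bump_derivative])

lemma bump_measurable [measurable]: "bump \<in> borel_measurable borel"
  by (intro borel_measurable_continuous_onI continuous_bump)

lemma expinv_ball_mult_norm_le: "expinv k (1 - x \<bullet> x) * norm x \<le> fact k"
proof (cases "norm x < 1")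
  case True
  then have "expinv k (1 - x \<bullet> x) * norm x \<le> fact k * 1"
    by (intro mult_mono expinv_bound) auto
  then show ?thesis by simp
next
  case False
  then show ?thesis by (simp add: expinv_ball_eq_0)
qed

lemma expinv_ball_mult_norm2_le: "expinv k (1 - x \<bullet> x) * (norm x * norm x) \<le> fact k"
proof (cases "norm x < 1")
  case True
  then have "norm x * norm x \<le> 1 * 1" by (intro mult_mono) auto
  then have "expinv k (1 - x \<bullet> x) * (norm x * norm x) \<le> fact k * 1"
    by (intro mult_mono expinv_bound) auto
  then show ?thesis by simp
next
  case False
  then show ?thesis by (simp add: expinv_ball_eq_0)
qed

lemma bump_lipschitz: "\<bar>bump x - bump (y::'a::euclidean_space)\<bar> \<le> 4 * norm (x - y)"
proof -
  have "norm (bump x - bump y) \<le> 4 * norm (x - y)"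
  proof (rule differentiable_bound[of UNIV])
    fix x :: 'a
    show "(bump has_derivative (\<lambda>v. expinv 2 (1 - x \<bullet> x) * (-2 * (x \<bullet> v)))) (at x within UNIV)"
      using bump_derivative by simp
    show "onorm (\<lambda>v. expinv 2 (1 - x \<bullet> x) * (-2 * (x \<bullet> v))) \<le> 4"
    proof (rule onorm_le)
      fix v :: 'a
      have "norm (expinv 2 (1 - x \<bullet> x) * (-2 * (x \<bullet> v))) = expinv 2 (1 - x \<bullet> x) * (2 * \<bar>x \<bullet> v\<bar>)"
        by (simp add: abs_mult)
      also have "\<dots> \<le> expinv 2 (1 - x \<bullet> x) * (2 * (norm x * norm v))"
        by (intro mult_left_mono Cauchy_Schwarz_ineq2) auto
      also have "\<dots> = 2 * (expinv 2 (1 - x \<bullet> x) * norm x) * norm v" by simp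
      also have "\<dots> \<le> 2 * (fact 2) * norm v"
        by (intro mult_right_mono mult_left_mono expinv_ball_mult_norm_le) auto
      finally show "norm (expinv 2 (1 - x \<bullet> x) * (-2 * (x \<bullet> v))) \<le> 4 * norm v" by simp
    qed
  qed auto
  then show ?thesis by simp
qed

text \<open>The second derivative combines \<open>expinv 4\<close>, \<open>expinv 3\<close> and
  \<open>expinv 2\<close>, which are bounded by 24, 6 and 2. This gives 4 (24 + 12) + 4 = 148,
  rounded up to 200, and the mean value argument doubles it.\<close>

lemma bump_second_difference:
  "\<bar>2 * bump x - bump (x + h) - bump (x - h)\<bar> \<le> 400 * (norm (h::'a::euclidean_space))\<^sup>2"
proof -
  let ?D = "\<lambda>x v::'a. expinv 2 (1 - x \<bullet> x) * (-2 * (x \<bullet> v))"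
  have "\<bar>?D x v - ?D y v\<bar> \<le> (200 * norm v) * norm (x - y)" for x y v
  proof -
    have "norm (?D x v - ?D y v) \<le> (200 * norm v) * norm (x - y)"
    proof (rule differentiable_bound[of UNIV])
      fix x :: 'a
      let ?D2 = "\<lambda>w. (expinv 4 (1 - x \<bullet> x) + - 2 * expinv 3 (1 - x \<bullet> x)) * (-2 * (x \<bullet> w)) * (-2 * (x \<bullet> v))
          + expinv 2 (1 - x \<bullet> x) * (-2 * (w \<bullet> v))"
      show "((\<lambda>x. ?D x v) has_derivative ?D2) (at x within UNIV)"
        using expinv_ball_derivative[of 2 x]
        by (auto intro!: derivative_eq_intros simp: numeral_eq_Suc)
      show "onorm ?D2 \<le> 200 * norm v"
      proof (rule onorm_le)
        fix w :: 'a
        let ?a = "expinv 4 (1 - x \<bullet> x)" and ?b = "expinv 3 (1 - x \<bullet> x)" and ?c = "expinv 2 (1 - x \<bullet> x)"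
        have xw: "\<bar>x \<bullet> w\<bar> * \<bar>x \<bullet> v\<bar> \<le> (norm x * norm w) * (norm x * norm v)"
          by (intro mult_mono Cauchy_Schwarz_ineq2) auto
        have "\<bar>(?a + - 2 * ?b) * (-2 * (x \<bullet> w)) * (-2 * (x \<bullet> v))\<bar>
          = \<bar>?a - 2 * ?b\<bar> * (4 * (\<bar>x \<bullet> w\<bar> * \<bar>x \<bullet> v\<bar>))" by (simp add: abs_mult)
        also have "\<dots> \<le> (?a + 2 * ?b) * (4 * ((norm x * norm w) * (norm x * norm v)))"
        proof (rule mult_mono)
          have "0 \<le> ?a" "0 \<le> ?b" by simp_all
          then show "\<bar>?a - 2 * ?b\<bar> \<le> ?a + 2 * ?b" by linarith
        qed (use xw in auto)
        also have "\<dots> = 4 * (?a * (norm x * norm x) + 2 * (?b * (norm x * norm x))) * (norm v * norm w)"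
          by (simp add: algebra_simps)
        also have "\<dots> \<le> 4 * (fact 4 + 2 * fact 3) * (norm v * norm w)"
          by (intro mult_right_mono mult_left_mono add_mono expinv_ball_mult_norm2_le) auto
        finally have 1: "\<bar>(?a + - 2 * ?b) * (-2 * (x \<bullet> w)) * (-2 * (x \<bullet> v))\<bar> \<le> 144 * (norm v * norm w)"
          by (simp add: fact_numeral)
        have "\<bar>?c * (-2 * (w \<bullet> v))\<bar> = ?c * (2 * \<bar>w \<bullet> v\<bar>)" by (simp add: abs_mult)
        also have "\<dots> \<le> fact 2 * (2 * (norm w * norm v))"
          by (intro mult_mono expinv_bound mult_left_mono Cauchy_Schwarz_ineq2) auto
        finally have 2: "\<bar>?c * (-2 * (w \<bullet> v))\<bar> \<le> 4 * (norm v * norm w)" by (simp add: mult.commute)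
        have "norm (?D2 w) \<le> 148 * (norm v * norm w)"
          using 1 2 unfolding real_norm_def by linarith
        also have "\<dots> \<le> 200 * norm v * norm w"
          by (simp add: mult_right_mono)
        finally show "norm (?D2 w) \<le> 200 * norm v * norm w" .
      qed
    qed auto
    then show ?thesis by simp
  qed
  from second_difference_bound[of bump ?D 200 x h, OF bump_derivative this] show ?thesis by simp
qed

lemma integrable_bounded_support:
  fixes f :: "'a::euclidean_space \<Rightarrow> real"
  assumes [measurable]: "f \<in> borel_measurable borel"
    and "\<And>x. \<bar>f x\<bar> \<le> C" "\<And>x. r \<le> norm x \<Longrightarrow> f x = 0"
  shows "integrable lborel f"
proof -
  have "integrable lborel (\<lambda>x. C * indicator (ball (0::'a) r) x)"
    by (intro integrable_mult_right integrable_indicator_ball)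
  then show ?thesis
  proof (rule Bochner_Integration.integrable_bound)
    show "AE x in lborel. norm (f x) \<le> norm (C * indicator (ball (0::'a) r) x)"
    proof (rule AE_I2)
      fix x :: 'a
      have "0 \<le> C" using order_trans[OF abs_ge_zero assms(2)] .
      then show "norm (f x) \<le> norm (C * indicator (ball (0::'a) r) x)"
        using assms(2)[of x] assms(3)[of x] by (cases "norm x < r") auto
    qed
  qed simp
qed

lemma integrable_bump: "integrable lborel (bump :: 'a::euclidean_space \<Rightarrow> real)"
  by (rule integrable_bounded_support[of _ 1 1]) (auto simp: bump_le_1 bump_eq_0)

lemma integral_bump_pos: "0 < (\<integral>x. bump (x::'a::euclidean_space) \<partial>lborel)"
proof -
  have "(\<integral>x. bump (x::'a) \<partial>lborel) \<noteq> 0"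
  proof
    assume "(\<integral>x. bump (x::'a) \<partial>lborel) = 0"
    then have "AE x::'a in lborel. bump x = 0"
      using integral_nonneg_eq_0_iff_AE[OF integrable_bump[where 'a='a]] by simp
    then have "AE x::'a in lborel. x \<notin> ball 0 1"
      by eventually_elim (use bump_pos in fastforce)
    then have "emeasure lborel (ball (0::'a) 1) = 0"
      by (subst (asm) AE_iff_measurable[of "ball 0 1"]) auto
    then show False using emeasure_lborel_ball[of 1 "0::'a"] measure_unit_ball_pos[where 'a='a] by simp
  qed
  moreover have "0 \<le> (\<integral>x. bump (x::'a) \<partial>lborel)" by simp
  ultimately show ?thesis by linarith
qed

definition moll :: "real \<Rightarrow> 'a::euclidean_space \<Rightarrow> real" where
  "moll e x = bump (x /\<^sub>R e) / ((\<integral>x. bump (x::'a) \<partial>lborel) * e ^ DIM('a))"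

lemma moll_nonneg [simp]: "0 \<le> e \<Longrightarrow> 0 \<le> moll e x"
  using integral_bump_pos[where 'a='a] by (simp add: moll_def)

lemma moll_measurable [measurable]: "moll e \<in> borel_measurable borel"
  by (simp add: moll_def[abs_def])

lemma moll_eq_0: "0 < e \<Longrightarrow> e \<le> norm x \<Longrightarrow> moll e x = 0"
  by (simp add: moll_def bump_eq_0 field_simps)

lemma integrable_moll: "0 < e \<Longrightarrow> integrable lborel (moll e :: 'a::euclidean_space \<Rightarrow> real)"
  using integrable_lborel_affine[OF integrable_bump[where 'a='a], of "inverse e" 0]
  by (simp add: moll_def[abs_def])

lemma integral_moll: "0 < e \<Longrightarrow> (\<integral>x. moll e (x::'a::euclidean_space) \<partial>lborel) = 1"
  using integral_lborel_affine[OF integrable_bump[where 'a='a], of "inverse e" 0]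
    integral_bump_pos[where 'a='a]
  by (simp add: moll_def power_inverse)

lemma integrable_moll_shift: "0 < e \<Longrightarrow> integrable lborel (\<lambda>y::'a::euclidean_space. moll e (x - y))"
  using integrable_lborel_translate(4)[OF integrable_moll] .

lemma integral_moll_shift: "0 < e \<Longrightarrow> (\<integral>y. moll e (x - y) \<partial>(lborel :: 'a::euclidean_space measure)) = 1"
  using integral_lborel_translate(4)[OF integrable_moll, of e x] integral_moll[of e] by simp

text \<open>One constant for the supremum, the Lipschitz bound and the second differences. It blows
  up as e tends to 0: it secures integrability and continuity for fixed e, and the estimates kept in
  the limit are free of it.\<close>

definition moll_const :: "'a::euclidean_space itself \<Rightarrow> real \<Rightarrow> real" where
  "moll_const _ e = (400 / e\<^sup>2 + 4 / e + 4) / ((\<integral>x. bump (x::'a) \<partial>lborel) * e ^ DIM('a))"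

lemma
  assumes e: "0 < e"
  shows moll_const_pos: "0 < moll_const TYPE('a::euclidean_space) e"
    and moll_le: "moll e (x::'a) \<le> moll_const TYPE('a) e"
    and moll_lipschitz: "\<bar>moll e x - moll e (y::'a)\<bar> \<le> moll_const TYPE('a) e * norm (x - y)"
    and moll_second_difference:
      "\<bar>2 * moll e x - moll e (x + h) - moll e (x - (h::'a))\<bar> \<le> moll_const TYPE('a) e * min 1 ((norm h)\<^sup>2)"
proof -
  define I where "I = (\<integral>x. bump (x::'a) \<partial>lborel) * e ^ DIM('a)"
  have I: "0 < I" using integral_bump_pos[where 'a='a] e by (simp add: I_def)
  have C: "moll_const TYPE('a) e = (400 / e\<^sup>2 + 4 / e + 4) / I" by (simp add: moll_const_def I_def)
  have m: "moll e (x::'a) = bump (x /\<^sub>R e) / I" for x by (simp add: moll_def I_def)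
  have pos: "0 < 400 / e\<^sup>2" "0 < 4 / e" using e by auto
  show "0 < moll_const TYPE('a) e" unfolding C using I pos by (intro divide_pos_pos) linarith+
  have le1: "bump z \<le> 400 / e\<^sup>2 + 4 / e + 4" for z :: 'a using bump_le_1[of z] pos by linarith
  show "moll e x \<le> moll_const TYPE('a) e"
    unfolding C m using I le1 by (intro divide_right_mono) auto
  have "\<bar>bump (x /\<^sub>R e) - bump (y /\<^sub>R e)\<bar> \<le> 4 * norm (x /\<^sub>R e - y /\<^sub>R e)"
    by (rule bump_lipschitz)
  also have "norm (x /\<^sub>R e - y /\<^sub>R e) = norm (x - y) / e"
  proof -
    have "x /\<^sub>R e - y /\<^sub>R e = (x - y) /\<^sub>R e" by (simp add: scaleR_diff_right)
    then show ?thesis using e by (simp add: divide_inverse mult.commute)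
  qed
  also have "4 * (norm (x - y) / e) \<le> (400 / e\<^sup>2 + 4 / e + 4) * norm (x - y)"
    using pos e by (simp add: field_simps)
  finally have "\<bar>bump (x /\<^sub>R e) - bump (y /\<^sub>R e)\<bar> / I \<le> (400 / e\<^sup>2 + 4 / e + 4) * norm (x - y) / I"
    using I by (intro divide_right_mono) auto
  then show "\<bar>moll e x - moll e y\<bar> \<le> moll_const TYPE('a) e * norm (x - y)"
    unfolding C m using I by (simp add: diff_divide_distrib[symmetric])
  let ?d = "2 * bump (x /\<^sub>R e) - bump ((x + h) /\<^sub>R e) - bump ((x - h) /\<^sub>R e)"
  have "\<bar>?d\<bar> \<le> 400 * (norm (h /\<^sub>R e))\<^sup>2"
    using bump_second_difference[of "x /\<^sub>R e" "h /\<^sub>R e"] by (simp add: scaleR_add_right scaleR_diff_right)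
  also have "\<dots> = 400 / e\<^sup>2 * (norm h)\<^sup>2"
    by (simp add: power_mult_distrib power_inverse field_simps)
  also have "\<dots> \<le> (400 / e\<^sup>2 + 4 / e + 4) * (norm h)\<^sup>2" using pos by (intro mult_right_mono) auto
  finally have 1: "\<bar>?d\<bar> \<le> (400 / e\<^sup>2 + 4 / e + 4) * (norm h)\<^sup>2" .
  have "\<bar>?d\<bar> \<le> 4"
    using bump_le_1[of "x /\<^sub>R e"] bump_le_1[of "(x + h) /\<^sub>R e"] bump_le_1[of "(x - h) /\<^sub>R e"]
     bump_nonneg[of "x /\<^sub>R e"] bump_nonneg[of "(x + h) /\<^sub>R e"] bump_nonneg[of "(x - h) /\<^sub>R e"] by linarith
  then have 2: "\<bar>?d\<bar> \<le> (400 / e\<^sup>2 + 4 / e + 4) * 1" unfolding mult_1_right using pos by linarith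
  from 1 2 have "\<bar>?d\<bar> \<le> (400 / e\<^sup>2 + 4 / e + 4) * min 1 ((norm h)\<^sup>2)"
    by (cases "1 \<le> (norm h)\<^sup>2") (auto simp: min_def)
  then have "\<bar>?d\<bar> / I \<le> (400 / e\<^sup>2 + 4 / e + 4) * min 1 ((norm h)\<^sup>2) / I"
    using I by (intro divide_right_mono) auto
  moreover have "\<bar>2 * moll e x - moll e (x + h) - moll e (x - h)\<bar> = \<bar>?d\<bar> / I"
    unfolding m using I by (simp add: diff_divide_distrib[symmetric])
  ultimately show "\<bar>2 * moll e x - moll e (x + h) - moll e (x - h)\<bar> \<le> moll_const TYPE('a) e * min 1 ((norm h)\<^sup>2)"
    unfolding C by simp
qed

text \<open>The reflected translate is the weight that convolution at x integrates against, so
  testing with it evaluates the convolved inequality at x.\<close>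

lemma moll_test_function:
  fixes x :: "'a::euclidean_space"
  assumes "0 < e" "cball x e \<subseteq> \<Omega>"
  shows "(\<lambda>y. moll e (x - y)) \<in> test_functions \<Omega>"
proof -
  have "Ck k (\<lambda>y. moll e (x - y))" for k
    using Ck_affine[OF Ck_bump, of k "1 / ((\<integral>x. bump (x::'a) \<partial>lborel) * e ^ DIM('a))" "- inverse e" "x /\<^sub>R e"]
    by (simp add: moll_def scaleR_diff_right)
  moreover have "{y. moll e (x - y) \<noteq> 0} \<subseteq> cball x e"
  proof
    fix y assume "y \<in> {y. moll e (x - y) \<noteq> 0}"
    then show "y \<in> cball x e"
      using moll_eq_0[OF assms(1), of "x - y"] by (cases "e \<le> norm (x - y)") (auto simp: dist_norm)
  qed
  then have "closure {y. moll e (x - y) \<noteq> 0} \<subseteq> cball x e"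
    by (rule closure_minimal) (rule closed_cball)
  then have "closure {y. moll e (x - y) \<noteq> 0} \<subseteq> \<Omega>" "bounded (closure {y. moll e (x - y) \<noteq> 0})"
    using assms(2) bounded_subset[OF bounded_cball] by (blast, metis)
  then have "{y. moll e (x - y) \<noteq> 0} \<Subset> \<Omega>"
    by (simp add: compactly_contained_def compact_eq_bounded_closed)
  ultimately show ?thesis by (simp add: test_functions_def)
qed

section \<open>Mollification\<close>

lemma inner_regular_lborel_compact:
  fixes A :: "'a::euclidean_space set"
  assumes A: "A \<in> sets borel" "emeasure lborel A < \<infinity>" and "0 < (e::real)"
  obtains K where "compact K" "K \<subseteq> A" "emeasure lborel (A - K) < ennreal e"
proof -
  \<comment> \<open>Inner regularity is applied to a finite measure, so Lebesgue measure is first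
    cut down to A.\<close>
  let ?M = "density lborel (indicator A)"
  have eM: "emeasure ?M B = emeasure lborel (A \<inter> B)" if "B \<in> sets borel" for B
    using A that by (simp add: emeasure_density indicator_inter_arith[symmetric])
  have SUP: "emeasure ?M A = (SUP K \<in> {K. K \<subseteq> A \<and> compact K}. emeasure ?M K)"
    using A eM[of UNIV] by (intro inner_regular) (auto simp: less_top[symmetric])
  have "\<exists>K. K \<subseteq> A \<and> compact K \<and> emeasure lborel A < emeasure lborel K + ennreal e"
  proof (rule ccontr)
    assume neg: "\<not> ?thesis"
    have "emeasure ?M K + ennreal e \<le> emeasure lborel A" if "K \<subseteq> A" "compact K" for K
      using neg that by (auto simp: eM borel_compact not_less Int_absorb1)
    then have "(SUP K \<in> {K. K \<subseteq> A \<and> compact K}. emeasure ?M K + ennreal e) \<le> emeasure lborel A"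
      by (intro SUP_least) auto
    also have "(SUP K \<in> {K. K \<subseteq> A \<and> compact K}. emeasure ?M K + ennreal e)
       = (SUP K \<in> {K. K \<subseteq> A \<and> compact K}. emeasure ?M K) + ennreal e"
      by (rule ennreal_SUP_add_left) auto
    also have "\<dots> = emeasure lborel A + ennreal e" using A by (simp add: SUP[symmetric] eM)
    finally have "ennreal e \<le> 0"
      using A(2) by (metis add.right_neutral ennreal_add_left_cancel_le infinity_ennreal_def less_irrefl)
    then show False using \<open>0 < e\<close> by simp
  qed
  then obtain K where K: "K \<subseteq> A" "compact K" "emeasure lborel A < emeasure lborel K + ennreal e" by blast
  have "emeasure lborel (A - K) = emeasure lborel A - emeasure lborel K"
    using K A by (intro emeasure_Diff) (auto simp: borel_compact emeasure_compact_finite less_top[symmetric]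
       dest: emeasure_compact_finite)
  also have "\<dots> < ennreal e"
  proof -
    have a: "emeasure lborel A = ennreal (measure lborel A)" "emeasure lborel K = ennreal (measure lborel K)"
      using A(2) emeasure_compact_finite[OF K(2)] by (auto intro!: emeasure_eq_ennreal_measure)
    have "ennreal (measure lborel A) < ennreal (measure lborel K + e)"
      using K(3) \<open>0 < e\<close> by (simp add: a)
    then have "measure lborel A - measure lborel K < e" by (simp add: ennreal_less_iff)
    then show ?thesis using \<open>0 < e\<close> by (simp add: a ennreal_minus ennreal_lessI)
  qed
  finally show ?thesis using K that by blast
qed

text \<open>Squeeze A between a compact K and an open U with U - K of small measure. A short
  translation moves no point of K out of U, so the indicator of A changes only on U - K and on a
  translate of it.\<close>

lemma translation_continuous_indicator:
  fixes A :: "'a::euclidean_space set"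
  assumes A: "A \<in> sets borel" "emeasure lborel A < \<infinity>" and "0 < (d::real)"
  shows "\<exists>\<eta>>0. \<forall>t. norm t < \<eta> \<longrightarrow> (\<integral>x. \<bar>indicator A (x + t) - indicator A x\<bar> \<partial>lborel) < d"
proof -
  obtain K where K: "compact K" "K \<subseteq> A" "emeasure lborel (A - K) < ennreal (d/4)"
    using inner_regular_lborel_compact[OF A, of "d/4"] \<open>0 < d\<close> by auto
  obtain U where U: "open U" "A \<subseteq> U" "emeasure lborel (U - A) < ennreal (d/4)"
    using outer_regular_lborel[OF A(1), of "d/4"] \<open>0 < d\<close> by auto
  obtain \<eta> where \<eta>: "0 < \<eta>" "(\<Union>x\<in>K. ball x \<eta>) \<subseteq> U"
    using compact_subset_open_imp_ball_epsilon_subset[OF K(1) U(1)] K U by blast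
  let ?D = "U - K"
  have [measurable]: "U \<in> sets borel" "K \<in> sets borel" "A \<in> sets borel"
    using U K A by (auto simp: borel_compact)
  have D[measurable]: "?D \<in> sets borel" using U K by (auto simp: borel_compact)
  have "emeasure lborel ?D \<le> emeasure lborel (A - K) + emeasure lborel (U - A)"
    using K U by (intro order_trans[OF emeasure_mono emeasure_subadditive]) auto
  also have "\<dots> < ennreal (d/4) + ennreal (d/4)"
    using K U by (intro add_strict_mono) auto
  also have "\<dots> = ennreal (d/2)" using \<open>0 < d\<close> by (subst ennreal_plus[symmetric]) auto
  finally have mD: "emeasure lborel ?D < ennreal (d/2)" .
  then have fin: "emeasure lborel ?D < \<infinity>" by (rule order.strict_trans) simp
  have iD: "integrable lborel (indicator ?D :: 'a \<Rightarrow> real)"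
    using fin by (intro integrable_real_indicator) auto
  have "measure lborel ?D < d/2"
    using mD fin \<open>0 < d\<close> by (auto simp: emeasure_eq_ennreal_measure ennreal_less_iff)
  moreover have "(\<integral>x. \<bar>indicator A (x + t) - indicator A x\<bar> \<partial>lborel) \<le> 2 * measure lborel ?D"
    if t: "norm t < \<eta>" for t
  proof -
    have "(\<integral>x. \<bar>indicator A (x + t) - indicator A x :: real\<bar> \<partial>lborel)
      \<le> (\<integral>x. indicator ?D (x + t) + indicator ?D x \<partial>lborel)"
    proof (rule integral_mono')
      show "integrable lborel (\<lambda>x. indicator ?D (x + t) + indicator ?D x :: real)"
        by (intro Bochner_Integration.integrable_add integrable_lborel_translate iD)
      fix x :: 'a
      have "x \<in> K \<Longrightarrow> x + t \<in> U"
        using \<eta>(2) t by (force simp: dist_norm)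
      moreover have "x + t \<in> K \<Longrightarrow> x \<in> U"
        using \<eta>(2) t by (force simp: dist_norm)
      ultimately show "\<bar>indicator A (x + t) - indicator A x :: real\<bar> \<le> indicator ?D (x + t) + indicator ?D x"
        using U(2) K(2) by (auto simp: indicator_def)
    qed auto
    also have "\<dots> = 2 * measure lborel ?D"
      using integral_lborel_translate(1)[OF iD, of t] integrable_lborel_translate(1)[OF iD, of t] iD
      by simp
    finally show ?thesis .
  qed
  ultimately show ?thesis using \<eta>(1) by (intro exI[of _ \<eta>]) force
qed

lemma translation_continuous_L1:
  fixes f :: "'a::euclidean_space \<Rightarrow> real"
  assumes f: "integrable lborel f" and "0 < (d::real)"
  shows "\<exists>\<eta>>0. \<forall>t. norm t < \<eta> \<longrightarrow> (\<integral>x. \<bar>f (x + t) - f x\<bar> \<partial>lborel) < d"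
proof -
  have "\<forall>d>0. \<exists>\<eta>>0. \<forall>t. norm t < \<eta> \<longrightarrow> (\<integral>x. \<bar>f (x + t) - f x\<bar> \<partial>lborel) < d"
    using f
  proof (induction rule: integrable_induct)
    case (base A c)
    show ?case
    proof (intro allI impI)
      fix d :: real assume "0 < d"
      then have d: "0 < d / (\<bar>c\<bar> + 1)" by simp
      from translation_continuous_indicator[OF _ _ d, of A] base obtain \<eta> where
        \<eta>: "\<eta> > 0" "\<And>t. norm t < \<eta> \<Longrightarrow> (\<integral>x. \<bar>indicator A (x + t) - indicator A x\<bar> \<partial>lborel) < d / (\<bar>c\<bar> + 1)"
        by auto
      have "(\<integral>x. \<bar>indicator A (x + t) *\<^sub>R c - indicator A x *\<^sub>R c\<bar> \<partial>lborel) < d" if "norm t < \<eta>" for t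
      proof -
        have "(\<integral>x. \<bar>indicator A (x + t) *\<^sub>R c - indicator A x *\<^sub>R c\<bar> \<partial>lborel) =
           (\<integral>x. \<bar>indicator A (x + t) - indicator A x\<bar> \<partial>lborel) * \<bar>c\<bar>"
          by (subst integral_mult_left_zero[symmetric]) (simp add: abs_mult[symmetric] left_diff_distrib)
        also have "\<dots> \<le> (\<integral>x. \<bar>indicator A (x + t) - indicator A x\<bar> \<partial>lborel) * (\<bar>c\<bar> + 1)"
          by (intro mult_left_mono) auto
        also have "\<dots> < d" using \<eta>(2)[OF that] by (simp add: pos_less_divide_eq)
        finally show ?thesis .
      qed
      with \<eta>(1) show "\<exists>\<eta>>0. \<forall>t. norm t < \<eta> \<longrightarrow>
          (\<integral>x. \<bar>indicator A (x + t) *\<^sub>R c - indicator A x *\<^sub>R c\<bar> \<partial>lborel) < d" by blast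
    qed
  next
    case (add f g)
    show ?case
    proof (intro allI impI)
      fix d :: real assume "0 < d"
      then have d: "0 < d / 2" by simp
      from add.IH(1)[rule_format, OF d] add.IH(2)[rule_format, OF d] obtain \<eta>1 \<eta>2 where
        \<eta>: "\<eta>1 > 0" "\<And>t. norm t < \<eta>1 \<Longrightarrow> (\<integral>x. \<bar>f (x + t) - f x\<bar> \<partial>lborel) < d / 2"
           "\<eta>2 > 0" "\<And>t. norm t < \<eta>2 \<Longrightarrow> (\<integral>x. \<bar>g (x + t) - g x\<bar> \<partial>lborel) < d / 2" by blast
      have "(\<integral>x. \<bar>f (x + t) + g (x + t) - (f x + g x)\<bar> \<partial>lborel) < d" if "norm t < min \<eta>1 \<eta>2" for t
      proof -
        note i = integrable_lborel_translate(1)[OF add.hyps(1), of t] integrable_lborel_translate(1)[OF add.hyps(2), of t]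
          add.hyps
        have "(\<integral>x. \<bar>f (x + t) + g (x + t) - (f x + g x)\<bar> \<partial>lborel)
          \<le> (\<integral>x. \<bar>f (x + t) - f x\<bar> + \<bar>g (x + t) - g x\<bar> \<partial>lborel)"
          using i by (intro integral_mono) auto
        also have "\<dots> = (\<integral>x. \<bar>f (x + t) - f x\<bar> \<partial>lborel) + (\<integral>x. \<bar>g (x + t) - g x\<bar> \<partial>lborel)"
          using i by (intro Bochner_Integration.integral_add) auto
        also have "\<dots> < d" using \<eta>(2)[of t] \<eta>(4)[of t] that by simp
        finally show ?thesis .
      qed
      with \<eta> show "\<exists>\<eta>>0. \<forall>t. norm t < \<eta> \<longrightarrow> (\<integral>x. \<bar>f (x + t) + g (x + t) - (f x + g x)\<bar> \<partial>lborel) < d"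
        by (intro exI[of _ "min \<eta>1 \<eta>2"]) auto
    qed
  next
    case (lim f s)
    show ?case
    proof (intro allI impI)
      fix d :: real assume "0 < d"
      have "(\<lambda>i. \<integral>x. \<bar>s i x - f x\<bar> \<partial>lborel) \<longlonglongrightarrow> (\<integral>x. (0::real) \<partial>(lborel :: 'a measure))"
      proof (rule integral_dominated_convergence[where w="\<lambda>x. 3 * \<bar>f x\<bar>"])
        show "AE x in lborel. (\<lambda>i. \<bar>s i x - f x\<bar>) \<longlonglongrightarrow> 0"
          using lim.hyps(2) by (intro AE_I2 tendsto_rabs_zero) (simp add: LIM_zero)
        show "AE x in lborel. norm \<bar>s i x - f x\<bar> \<le> 3 * \<bar>f x\<bar>" for i
        proof (rule AE_I2)
          fix x :: 'a
          have "\<bar>s i x\<bar> \<le> 2 * \<bar>f x\<bar>" using lim.hyps(3)[of x i] by simp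
          then show "norm \<bar>s i x - f x\<bar> \<le> 3 * \<bar>f x\<bar>" by simp
        qed
      qed (use lim.hyps in auto)
      then have "\<forall>\<^sub>F i in sequentially. (\<integral>x. \<bar>s i x - f x\<bar> \<partial>lborel) < d / 4"
        using \<open>0 < d\<close> by (intro order_tendstoD(2)[of _ "0::real"]) auto
      then obtain i where i: "(\<integral>x. \<bar>s i x - f x\<bar> \<partial>lborel) < d / 4"
        by (meson eventually_sequentially order_refl)
      obtain \<eta> where \<eta>: "\<eta> > 0" "\<And>t. norm t < \<eta> \<Longrightarrow> (\<integral>x. \<bar>s i (x + t) - s i x\<bar> \<partial>lborel) < d / 4"
        using lim.IH[of i] \<open>0 < d\<close> by (metis divide_pos_pos zero_less_numeral)
      have "(\<integral>x. \<bar>f (x + t) - f x\<bar> \<partial>lborel) < d" if "norm t < \<eta>" for t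
      proof -
        have sf: "integrable lborel (\<lambda>x. \<bar>s i x - f x\<bar>)" using lim.hyps by auto
        have ss: "integrable lborel (\<lambda>x. \<bar>s i (x + t) - s i x\<bar>)"
          using lim.hyps(1)[of i] integrable_lborel_translate(1)[OF lim.hyps(1)[of i], of t] by auto
        note sft = integrable_lborel_translate(1)[OF sf, of t]
        have "(\<integral>x. \<bar>f (x + t) - f x\<bar> \<partial>lborel)
          \<le> (\<integral>x. \<bar>s i (x + t) - f (x + t)\<bar> + \<bar>s i x - f x\<bar> + \<bar>s i (x + t) - s i x\<bar> \<partial>lborel)"
          using sf ss sft lim.hyps(4) integrable_lborel_translate(1)[OF lim.hyps(4), of t]
          by (intro integral_mono) auto
        also have "\<dots> = (\<integral>x. \<bar>s i (x + t) - f (x + t)\<bar> \<partial>lborel) + (\<integral>x. \<bar>s i x - f x\<bar> \<partial>lborel)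
            + (\<integral>x. \<bar>s i (x + t) - s i x\<bar> \<partial>lborel)"
          using sf ss sft by (simp add: Bochner_Integration.integral_add)
        also have "(\<integral>x. \<bar>s i (x + t) - f (x + t)\<bar> \<partial>lborel) = (\<integral>x. \<bar>s i x - f x\<bar> \<partial>lborel)"
          using integral_lborel_translate(1)[OF sf, of t] by simp
        finally show ?thesis using i \<eta>(2)[OF that] \<open>0 < d\<close> by linarith
      qed
      with \<eta>(1) show "\<exists>\<eta>>0. \<forall>t. norm t < \<eta> \<longrightarrow> (\<integral>x. \<bar>f (x + t) - f x\<bar> \<partial>lborel) < d" by blast
    qed
  qed
  with \<open>0 < d\<close> show ?thesis by blast
qed

section \<open>Convolution with mollifiers\<close>

definition mollify :: "real \<Rightarrow> ('a::euclidean_space \<Rightarrow> real) \<Rightarrow> 'a \<Rightarrow> real" where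
  "mollify e f x = (\<integral>y. f y * moll e (x - y) \<partial>lborel)"

lemma abs_moll_le: "0 < e \<Longrightarrow> \<bar>moll e (x::'a::euclidean_space)\<bar> \<le> moll_const TYPE('a) e"
  using moll_le[of e x] moll_nonneg[of e x] by simp

lemma integrable_mult_bounded:
  fixes f g :: "'a \<Rightarrow> real"
  assumes f: "integrable M f" and [measurable]: "g \<in> borel_measurable M" and "\<And>x. \<bar>g x\<bar> \<le> C"
  shows "integrable M (\<lambda>x. f x * g x)"
proof (rule Bochner_Integration.integrable_bound[of _ "\<lambda>x. C * f x"])
  show "AE x in M. norm (f x * g x) \<le> norm (C * f x)"
  proof (rule AE_I2)
    fix x
    have "0 \<le> C" using order_trans[OF abs_ge_zero assms(3)] .
    then show "norm (f x * g x) \<le> norm (C * f x)"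
      using mult_right_mono[OF assms(3)[of x], of "\<bar>f x\<bar>"] by (simp add: abs_mult mult.commute)
  qed
qed (use f in auto)

context
  fixes f :: "'a::euclidean_space \<Rightarrow> real" and e :: real
  assumes f: "integrable lborel f" and e: "0 < e"
begin

lemma integrable_mollify_integrand: "integrable lborel (\<lambda>y. f y * moll e (x - y))"
  using f e by (intro integrable_mult_bounded[where C="moll_const TYPE('a) e"] abs_moll_le) auto

text \<open>Here g is a function and not only a constant because the density argument compares f
  with k minus a multiple of an indicator.\<close>

lemma integral_moll_le_mollify: 
  assumes "AE y in lborel. norm (x - y) < e \<longrightarrow> g y \<le> f y" "integrable lborel (\<lambda>y. g y * moll e (x - y))"
  shows "(\<integral>y. g y * moll e (x - y) \<partial>lborel) \<le> mollify e f x"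
  unfolding mollify_def
proof (rule integral_mono_AE)
  show "AE y in lborel. g y * moll e (x - y) \<le> f y * moll e (x - y)"
    using assms(1)
  proof eventually_elim
    case (elim y)
    then show ?case using moll_eq_0[OF e, of "x - y"] e
      by (cases "norm (x - y) < e") (auto intro!: mult_right_mono)
  qed
qed (use assms(2) integrable_mollify_integrand in auto)

lemma mollify_ge:
  assumes "AE y in lborel. norm (x - y) < e \<longrightarrow> c \<le> f y"
  shows "c \<le> mollify e f x"
proof -
  have "(\<integral>y. c * moll e (x - y) \<partial>lborel) \<le> mollify e f x"
    using assms integrable_moll_shift[OF e]
    by (intro integral_moll_le_mollify) auto
  then show ?thesis
    using integral_moll_shift[OF e, of x] by simp
qed

lemma mollify_lipschitz:
  "\<bar>mollify e f x - mollify e f z\<bar> \<le> moll_const TYPE('a) e * (\<integral>y. \<bar>f y\<bar> \<partial>lborel) * norm (x - z)"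
proof -
  have "\<bar>mollify e f x - mollify e f z\<bar> = \<bar>\<integral>y. f y * moll e (x - y) - f y * moll e (z - y) \<partial>lborel\<bar>"
    unfolding mollify_def using integrable_mollify_integrand by simp
  also have "\<dots> \<le> (\<integral>y. \<bar>f y * moll e (x - y) - f y * moll e (z - y)\<bar> \<partial>lborel)"
    by (rule integral_abs_bound)
  also have "\<dots> \<le> (\<integral>y. \<bar>f y\<bar> * (moll_const TYPE('a) e * norm (x - z)) \<partial>lborel)"
  proof (rule integral_mono)
    show "integrable lborel (\<lambda>y. \<bar>f y * moll e (x - y) - f y * moll e (z - y)\<bar>)"
      using integrable_mollify_integrand by auto
    show "integrable lborel (\<lambda>y. \<bar>f y\<bar> * (moll_const TYPE('a) e * norm (x - z)))" using f by auto
    fix y :: 'a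
    have "\<bar>f y * moll e (x - y) - f y * moll e (z - y)\<bar> = \<bar>f y\<bar> * \<bar>moll e (x - y) - moll e (z - y)\<bar>"
      by (simp add: abs_mult[symmetric] right_diff_distrib)
    also have "\<dots> \<le> \<bar>f y\<bar> * (moll_const TYPE('a) e * norm (x - z))"
      using moll_lipschitz[OF e, of "x - y" "z - y"] by (intro mult_left_mono) auto
    finally show "\<bar>f y * moll e (x - y) - f y * moll e (z - y)\<bar> \<le> \<bar>f y\<bar> * (moll_const TYPE('a) e * norm (x - z))" .
  qed
  also have "\<dots> = moll_const TYPE('a) e * (\<integral>y. \<bar>f y\<bar> \<partial>lborel) * norm (x - z)" by simp
  finally show ?thesis .
qed

lemma continuous_mollify: "continuous_on S (mollify e f)"
proof (rule continuous_on_subset[OF lipschitz_on_continuous_on])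
  let ?L = "moll_const TYPE('a) e * (\<integral>y. \<bar>f y\<bar> \<partial>lborel)"
  have "0 \<le> ?L" using moll_const_pos[where 'a='a, OF e] by simp
  then show "?L-lipschitz_on UNIV (mollify e f)"
    using mollify_lipschitz by (intro lipschitz_onI) (auto simp: dist_norm)
qed simp

lemma mollify_measurable [measurable]: "mollify e f \<in> borel_measurable borel"
  by (intro borel_measurable_continuous_onI continuous_mollify)

lemma integrable_mollify_pair:
  "integrable (lborel \<Otimes>\<^sub>M lborel) (\<lambda>(y, x). f y * moll e (x - y))"
proof (rule lborel_pair.Fubini_integrable)
  have [measurable]: "f \<in> borel_measurable borel" using f by auto
  show "(\<lambda>(y, x). f y * moll e (x - y)) \<in> borel_measurable (lborel \<Otimes>\<^sub>M lborel)" by simp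
  have "(\<integral>x. norm (f y * moll e (x - y)) \<partial>lborel) = \<bar>f y\<bar>" for y
  proof -
    have "(\<integral>x. norm (f y * moll e (x - y)) \<partial>lborel) = \<bar>f y\<bar> * (\<integral>x. moll e (x - y) \<partial>lborel)"
      using e by (simp add: abs_mult)
    then show ?thesis
      using integral_lborel_translate(3)[OF integrable_moll[where 'a='a, OF e], of y]
        integral_moll[where 'a='a, OF e] by simp
  qed
  then show "integrable lborel (\<lambda>y. \<integral>x. norm (case (y, x) of (y, x) \<Rightarrow> f y * moll e (x - y)) \<partial>lborel)"
    using f by simp
  show "AE y in lborel. integrable lborel (\<lambda>x. case (y, x) of (y, x) \<Rightarrow> f y * moll e (x - y))"
    using integrable_lborel_translate(3)[OF integrable_moll[where 'a='a, OF e]] by simp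
qed

lemma integrable_mollify: "integrable lborel (mollify e f)"
  using lborel_pair.integrable_snd[OF integrable_mollify_pair] by (simp add: mollify_def[abs_def])

lemma integral_mollify: "(\<integral>x. mollify e f x \<partial>lborel) = (\<integral>x. f x \<partial>lborel)"
proof -
  have "(\<integral>x. mollify e f x \<partial>lborel) = (\<integral>y. \<integral>x. f y * moll e (x - y) \<partial>lborel \<partial>lborel)"
    unfolding mollify_def using lborel_pair.Fubini_integral[OF integrable_mollify_pair] by simp
  also have "\<dots> = (\<integral>x. f x \<partial>lborel)"
    using integral_lborel_translate(3)[OF integrable_moll[where 'a='a, OF e]]
        integral_moll[where 'a='a, OF e] by simp
  finally show ?thesis .
qed

end

lemma integral_abs_mollify_le:
  fixes f :: "'a::euclidean_space \<Rightarrow> real"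
  assumes f: "integrable lborel f" and e: "0 < e"
  shows "(\<integral>x. \<bar>mollify e f x\<bar> \<partial>lborel) \<le> (\<integral>x. \<bar>f x\<bar> \<partial>lborel)"
proof -
  have "integrable lborel (\<lambda>x. \<bar>f x\<bar>)" using f by simp
  note f' = this
  have "(\<integral>x. \<bar>mollify e f x\<bar> \<partial>lborel) \<le> (\<integral>x. mollify e (\<lambda>x. \<bar>f x\<bar>) x \<partial>lborel)"
  proof (rule integral_mono)
    fix x :: 'a
    have "\<bar>mollify e f x\<bar> \<le> (\<integral>y. \<bar>f y * moll e (x - y)\<bar> \<partial>lborel)"
      unfolding mollify_def by (rule integral_abs_bound)
    also have "\<dots> = mollify e (\<lambda>x. \<bar>f x\<bar>) x"
      unfolding mollify_def using e by (simp add: abs_mult)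
    finally show "\<bar>mollify e f x\<bar> \<le> mollify e (\<lambda>x. \<bar>f x\<bar>) x" .
  qed (use integrable_mollify[OF f e] integrable_mollify[OF f' e] in auto)
  then show ?thesis using integral_mollify[OF f' e] by simp
qed

text \<open>The difference f_e - f is an average of the translation differences f(x - t) - f(x) over
  |t| < e. The integrals are exchanged as \<open>nn_integral\<close>s, where Tonelli asks for
  measurability only.\<close>

lemma mollify_L1_close:
  fixes f :: "'a::euclidean_space \<Rightarrow> real"
  assumes f: "integrable lborel f" and "0 < d"
  shows "\<exists>\<eta>>0. \<forall>e. 0 < e \<and> e < \<eta> \<longrightarrow> (\<integral>x. \<bar>mollify e f x - f x\<bar> \<partial>lborel) \<le> d"
proof -
  have [measurable]: "f \<in> borel_measurable borel" using f by auto
  obtain \<eta> where \<eta>: "\<eta> > 0" "\<And>t. norm t < \<eta> \<Longrightarrow> (\<integral>x. \<bar>f (x + t) - f x\<bar> \<partial>lborel) < d"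
    using translation_continuous_L1[OF f \<open>0 < d\<close>] by blast
  have "(\<integral>x. \<bar>mollify e f x - f x\<bar> \<partial>lborel) \<le> d" if e: "0 < e" "e < \<eta>" for e
  proof -
    have pw: "ennreal \<bar>mollify e f x - f x\<bar> \<le> (\<integral>\<^sup>+t. ennreal (\<bar>f (x - t) - f x\<bar> * moll e t) \<partial>lborel)" for x
    proof -
      have i1: "integrable lborel (\<lambda>t. f (x - t) * moll e t)"
        using integrable_lborel_translate(4)[OF integrable_mollify_integrand[OF f e(1), of x], of x] by simp
      have i2: "integrable lborel (\<lambda>t::'a. f x * moll e t)" using integrable_moll[OF e(1), where 'a='a] by simp
      have eq1: "mollify e f x = (\<integral>t. f (x - t) * moll e t \<partial>lborel)"
        unfolding mollify_def
        using integral_lborel_translate(4)[OF integrable_mollify_integrand[OF f e(1), of x], of x] by simp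
      have eq2: "f x = (\<integral>t. f x * moll e (t::'a) \<partial>lborel)" using integral_moll[OF e(1), where 'a='a] by simp
      have "mollify e f x - f x = (\<integral>t. f (x - t) * moll e t - f x * moll e t \<partial>lborel)"
        using eq1 eq2 i1 i2 by simp
      then have "ennreal \<bar>mollify e f x - f x\<bar> \<le> (\<integral>\<^sup>+t. ennreal (norm (f (x - t) * moll e t - f x * moll e t)) \<partial>lborel)"
        using integral_norm_bound_ennreal[of lborel "\<lambda>t. f (x - t) * moll e t - f x * moll e t"] i1 i2 by simp
      also have "\<dots> = (\<integral>\<^sup>+t. ennreal (\<bar>f (x - t) - f x\<bar> * moll e t) \<partial>lborel)"
        using e by (intro nn_integral_cong) (simp add: left_diff_distrib[symmetric] abs_mult)
      finally show ?thesis .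
    qed
    have "(\<integral>\<^sup>+x. ennreal \<bar>mollify e f x - f x\<bar> \<partial>lborel)
      \<le> (\<integral>\<^sup>+x. \<integral>\<^sup>+t. ennreal (\<bar>f (x - t) - f x\<bar> * moll e t) \<partial>lborel \<partial>lborel)"
      by (intro nn_integral_mono pw)
    also have "\<dots> = (\<integral>\<^sup>+t. \<integral>\<^sup>+x. ennreal (\<bar>f (x - t) - f x\<bar> * moll e t) \<partial>lborel \<partial>lborel)"
      by (rule lborel_pair.Fubini'[symmetric]) simp
    also have "\<dots> \<le> (\<integral>\<^sup>+t. ennreal (d * moll e (t::'a)) \<partial>lborel)"
    proof (rule nn_integral_mono)
      fix t :: 'a
      show "(\<integral>\<^sup>+x. ennreal (\<bar>f (x - t) - f x\<bar> * moll e t) \<partial>lborel) \<le> ennreal (d * moll e t)"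
      proof (cases "norm t < e")
        case True
        have i: "integrable lborel (\<lambda>x. \<bar>f (x - t) - f x\<bar> * moll e t)"
          using f integrable_lborel_translate(3)[OF f, of t] by simp
        have "(\<integral>\<^sup>+x. ennreal (\<bar>f (x - t) - f x\<bar> * moll e t) \<partial>lborel)
          = ennreal (\<integral>x. \<bar>f (x - t) - f x\<bar> * moll e t \<partial>lborel)"
          using e i by (intro nn_integral_eq_integral) auto
        also have "\<dots> \<le> ennreal (d * moll e t)"
          using \<eta>(2)[of "-t"] True e by (intro ennreal_leI) (auto intro!: mult_right_mono)
        finally show ?thesis .
      next
        case False
        then show ?thesis using moll_eq_0[OF e(1), of t] by simp
      qed
    qed
    also have "\<dots> = ennreal d"
      using integrable_moll[OF e(1), where 'a='a] integral_moll[OF e(1), where 'a='a] \<open>0 < d\<close> e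
      by (subst nn_integral_eq_integral) auto
    finally have "(\<integral>\<^sup>+x. ennreal \<bar>mollify e f x - f x\<bar> \<partial>lborel) \<le> ennreal d" .
    moreover have "(\<integral>\<^sup>+x. ennreal \<bar>mollify e f x - f x\<bar> \<partial>lborel) = ennreal (\<integral>x. \<bar>mollify e f x - f x\<bar> \<partial>lborel)"
      using integrable_mollify[OF f e(1)] f by (intro nn_integral_eq_integral) auto
    ultimately show ?thesis using \<open>0 < d\<close> by simp
  qed
  with \<eta>(1) show ?thesis by blast
qed

section \<open>The fractional Laplacian and touching barriers\<close>

lemma norm_scaleR_inverse: "0 < r \<Longrightarrow> norm (x /\<^sub>R r) = norm x / r"
  by (simp add: divide_inverse mult.commute)

section \<open>Second differences and their behaviour under convolution\<close>

definition second_diff :: "('a::real_normed_vector \<Rightarrow> real) \<Rightarrow> 'a \<Rightarrow> 'a \<Rightarrow> real" where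
  "second_diff f x h = 2 * f x - f (x + h) - f (x - h)"

text \<open>The bound that makes second differences integrable against the kernel, uniformly in x:
  multiplied by the kernel, the right-hand side is C times \<open>wkern 1\<close>.\<close>

definition second_diff_le :: "real \<Rightarrow> ('a::real_normed_vector \<Rightarrow> real) \<Rightarrow> bool" where
  "second_diff_le C f \<longleftrightarrow> (\<forall>x h. \<bar>second_diff f x h\<bar> \<le> C * min 1 ((norm h)\<^sup>2))"

lemma second_diff_leD: "second_diff_le C f \<Longrightarrow> \<bar>second_diff f x h\<bar> \<le> C * min 1 ((norm h)\<^sup>2)"
  by (simp add: second_diff_le_def)

lemma second_diff_measurable [measurable (raw)]:
  fixes f :: "'a::euclidean_space \<Rightarrow> real"
  assumes [measurable]: "f \<in> borel_measurable borel" "g \<in> borel_measurable M" "h \<in> borel_measurable M"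
  shows "(\<lambda>x. second_diff f (g x) (h x)) \<in> borel_measurable M"
  unfolding second_diff_def by measurable

lemma second_diff_le_moll: "0 < e \<Longrightarrow> second_diff_le (moll_const TYPE('a) e) (moll e :: 'a::euclidean_space \<Rightarrow> real)"
  using moll_second_difference[where 'a='a] by (simp add: second_diff_le_def second_diff_def)

lemma integrable_pair_mult:
  fixes f :: "'a::euclidean_space \<Rightarrow> real" and g :: "'b::euclidean_space \<Rightarrow> real"
  assumes f: "integrable lborel f" and g: "integrable lborel g"
  shows "integrable (lborel \<Otimes>\<^sub>M lborel) (\<lambda>(x, y). f x * g y)"
proof (rule lborel_pair.Fubini_integrable)
  have [measurable]: "f \<in> borel_measurable borel" "g \<in> borel_measurable borel" using f g by auto
  show "(\<lambda>(x, y). f x * g y) \<in> borel_measurable (lborel \<Otimes>\<^sub>M lborel)" by measurable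
  show "integrable lborel (\<lambda>x. \<integral>y. norm (case (x, y) of (x, y) \<Rightarrow> f x * g y) \<partial>lborel)"
    using f by (simp add: abs_mult)
  show "AE x in lborel. integrable lborel (\<lambda>y. case (x, y) of (x, y) \<Rightarrow> f x * g y)"
    using g by simp
qed

lemma second_diff_mollify:
  fixes f :: "'a::euclidean_space \<Rightarrow> real"
  assumes f: "integrable lborel f" and e: "0 < e"
  shows "second_diff (mollify e f) x h = (\<integral>y. f y * second_diff (moll e) (x - y) h \<partial>lborel)"
proof -
  note i = integrable_mollify_integrand[OF f e]
  have "(\<integral>y. f y * second_diff (moll e) (x - y) h \<partial>lborel)
     = (\<integral>y. 2 * (f y * moll e (x - y)) - f y * moll e (x + h - y) - f y * moll e (x - h - y) \<partial>lborel)"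
    by (intro Bochner_Integration.integral_cong) (auto simp: second_diff_def algebra_simps)
  also have "\<dots> = second_diff (mollify e f) x h"
    using i by (simp add: second_diff_def mollify_def)
  finally show ?thesis by simp
qed

lemma second_diff_le_mollify:
  fixes f :: "'a::euclidean_space \<Rightarrow> real"
  assumes f: "integrable lborel f" and e: "0 < e"
  shows "second_diff_le (moll_const TYPE('a) e * (\<integral>y. \<bar>f y\<bar> \<partial>lborel)) (mollify e f)"
  unfolding second_diff_le_def
proof (intro allI)
  fix x h :: 'a
  have [measurable]: "f \<in> borel_measurable borel" using f by auto
  have "\<bar>second_diff (mollify e f) x h\<bar> \<le> (\<integral>y. \<bar>f y * second_diff (moll e) (x - y) h\<bar> \<partial>lborel)"
    unfolding second_diff_mollify[OF f e] by (rule integral_abs_bound)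
  also have "\<dots> \<le> (\<integral>y. \<bar>f y\<bar> * (moll_const TYPE('a) e * min 1 ((norm h)\<^sup>2)) \<partial>lborel)"
  proof (rule integral_mono')
    fix y :: 'a
    show "\<bar>f y * second_diff (moll e) (x - y) h\<bar> \<le> \<bar>f y\<bar> * (moll_const TYPE('a) e * min 1 ((norm h)\<^sup>2))"
      using second_diff_leD[OF second_diff_le_moll[OF e], of "x - y" h]
      by (simp add: abs_mult mult_left_mono)
  qed (use f moll_const_pos[OF e, where 'a='a] in auto)
  finally show "\<bar>second_diff (mollify e f) x h\<bar>
      \<le> moll_const TYPE('a) e * (\<integral>y. \<bar>f y\<bar> \<partial>lborel) * min 1 ((norm h)\<^sup>2)"
    by (simp add: mult_ac)
qed

lemma abs_mollify_le:
  fixes f :: "'a::euclidean_space \<Rightarrow> real"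
  assumes f: "integrable lborel f" and e: "0 < e"
  shows "\<bar>mollify e f x\<bar> \<le> moll_const TYPE('a) e * (\<integral>y. \<bar>f y\<bar> \<partial>lborel)"
proof -
  have "\<bar>mollify e f x\<bar> \<le> (\<integral>y. \<bar>f y * moll e (x - y)\<bar> \<partial>lborel)"
    unfolding mollify_def by (rule integral_abs_bound)
  also have "\<dots> \<le> (\<integral>y. \<bar>f y\<bar> * moll_const TYPE('a) e \<partial>lborel)"
    using f moll_const_pos[OF e, where 'a='a]
    by (intro integral_mono') (auto simp: abs_mult intro!: mult_left_mono abs_moll_le[OF e] mult_nonneg_nonneg)
  finally show ?thesis by (simp add: mult.commute)
qed

context frac_order
begin

text \<open>Twice the principal value integral, without the constant \<open>frac_const\<close>.\<close>

definition frac_lap :: "('a::euclidean_space \<Rightarrow> real) \<Rightarrow> 'a \<Rightarrow> real" where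
  "frac_lap f x = (\<integral>h. second_diff f x h * kern s h \<partial>lborel)"

lemma frac_lap_measurable [measurable (raw)]:
  fixes f :: "'a::euclidean_space \<Rightarrow> real"
  assumes [measurable]: "f \<in> borel_measurable borel" "g \<in> borel_measurable M"
  shows "(\<lambda>x. frac_lap f (g x)) \<in> borel_measurable M"
  unfolding frac_lap_def by measurable

lemma frac_lap_minus: "frac_lap (\<lambda>x. - f x) x = - frac_lap f x"
proof -
  have "second_diff (\<lambda>x. - f x) x h * kern s h = - (second_diff f x h * kern s h)" for h
    by (simp add: second_diff_def algebra_simps)
  then show ?thesis unfolding frac_lap_def by simp
qed

lemma mult_kern_le_wkern:
  "\<bar>c\<bar> \<le> C * min 1 ((norm h)\<^sup>2) \<Longrightarrow> \<bar>c * kern s h\<bar> \<le> C * wkern 1 h"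
  using mult_right_mono[of "\<bar>c\<bar>" "C * min 1 ((norm h)\<^sup>2)" "kern s h"]
  by (simp add: wkern_def abs_mult mult.assoc)

lemma integrable_second_diff_kern:
  fixes f :: "'a::euclidean_space \<Rightarrow> real"
  assumes [measurable]: "f \<in> borel_measurable borel" and "second_diff_le C f"
  shows "integrable lborel (\<lambda>h. second_diff f x h * kern s h)"
proof (rule Bochner_Integration.integrable_bound)
  show "integrable lborel (\<lambda>h::'a. C * wkern 1 h)" using integrable_wkern[of 1] by auto
  show "AE h in lborel. norm (second_diff f x h * kern s h) \<le> norm (C * wkern 1 h)"
    using mult_kern_le_wkern[OF second_diff_leD[OF assms(2)]]
    by (intro AE_I2) (auto intro: order_trans[OF _ abs_ge_self])
qed simp

lemma abs_frac_lap_le: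
  fixes f :: "'a::euclidean_space \<Rightarrow> real"
  assumes "f \<in> borel_measurable borel" and "second_diff_le C f"
  shows "\<bar>frac_lap f x\<bar> \<le> C * K0 TYPE('a)"
proof -
  have "\<bar>frac_lap f x\<bar> \<le> (\<integral>h. \<bar>second_diff f x h * kern s h\<bar> \<partial>lborel)"
    unfolding frac_lap_def by (rule integral_abs_bound)
  also have "\<dots> \<le> (\<integral>h. C * wkern 1 (h::'a) \<partial>lborel)"
    using integrable_second_diff_kern[OF assms] integrable_wkern[of 1]
      mult_kern_le_wkern[OF second_diff_leD[OF assms(2)]]
    by (intro integral_mono) auto
  also have "\<dots> = C * K0 TYPE('a)" by (simp add: K0_def)
  finally show ?thesis .
qed

text \<open>The common majorant for exchanging the space variable with the increment h. The factor d
  is abstract because the second difference is taken sometimes at x and sometimes at a reflected and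
  shifted point.\<close>

lemma integrable_pair_mult_kern:
  fixes f :: "'a::euclidean_space \<Rightarrow> real" and d :: "'a \<Rightarrow> 'b::euclidean_space \<Rightarrow> real"
  assumes f: "integrable lborel f"
    and [measurable]: "case_prod d \<in> borel_measurable (lborel \<Otimes>\<^sub>M lborel)"
    and d: "\<And>x h. \<bar>d x h\<bar> \<le> C * min 1 ((norm h)\<^sup>2)"
  shows "integrable (lborel \<Otimes>\<^sub>M lborel) (\<lambda>(x, h). f x * (d x h * kern s h))"
proof (rule Bochner_Integration.integrable_bound)
  show "integrable (lborel \<Otimes>\<^sub>M lborel) (\<lambda>(x, h). f x * (C * wkern 1 (h::'b)))"
    using f integrable_wkern[of 1, where 'a='b] by (intro integrable_pair_mult) auto
  have [measurable]: "f \<in> borel_measurable borel" using f by auto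
  have [measurable]: "(\<lambda>x. d (fst x) (snd x)) \<in> borel_measurable (lborel \<Otimes>\<^sub>M lborel)"
    using assms(2) by (simp add: case_prod_beta')
  show "(\<lambda>(x, h). f x * (d x h * kern s h)) \<in> borel_measurable (lborel \<Otimes>\<^sub>M lborel)"
    unfolding case_prod_beta' by measurable
  show "AE z in lborel \<Otimes>\<^sub>M lborel. norm (case z of (x, h) \<Rightarrow> f x * (d x h * kern s h))
      \<le> norm (case z of (x, h) \<Rightarrow> f x * (C * wkern 1 h))"
    using order_trans[OF mult_kern_le_wkern[OF d] abs_ge_self]
    by (intro AE_I2) (auto simp: abs_mult[of "f _"] intro!: mult_left_mono)
qed

text \<open>The operator falls on the mollifier, so integrability of f is all that is asked. With
  \<open>frac_lap_moll_reflect\<close> this identifies the weak form tested at x with the operator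
  applied to f_e at x.\<close>

lemma frac_lap_mollify:
  fixes f :: "'a::euclidean_space \<Rightarrow> real"
  assumes f: "integrable lborel f" and e: "0 < e"
  shows "frac_lap (mollify e f) x = (\<integral>y. f y * frac_lap (moll e) (x - y) \<partial>lborel)"
proof -
  have i: "integrable (lborel \<Otimes>\<^sub>M lborel) (\<lambda>(y, h). f y * (second_diff (moll e) (x - y) h * kern s h))"
    using second_diff_leD[OF second_diff_le_moll[OF e]]
    by (intro integrable_pair_mult_kern f) (auto simp: case_prod_beta')
  have "frac_lap (mollify e f) x = (\<integral>h. (\<integral>y. f y * (second_diff (moll e) (x - y) h * kern s h) \<partial>lborel) \<partial>lborel)"
    unfolding frac_lap_def second_diff_mollify[OF f e] by (simp add: mult.assoc[symmetric])
  also have "\<dots> = (\<integral>y. (\<integral>h. f y * (second_diff (moll e) (x - y) h * kern s h) \<partial>lborel) \<partial>lborel)"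
    by (rule lborel_pair.Fubini_integral[OF i])
  finally show ?thesis by (simp add: frac_lap_def)
qed

lemma frac_lap_moll_reflect: "frac_lap (\<lambda>z. moll e (x - z)) y = frac_lap (moll e) (x - y)"
  unfolding frac_lap_def second_diff_def
  by (intro Bochner_Integration.integral_cong) (auto simp: algebra_simps)

lemma integral_mult_second_diff:
  fixes f g :: "'a::euclidean_space \<Rightarrow> real"
  assumes f: "integrable lborel f" and [measurable]: "g \<in> borel_measurable borel" and B: "\<And>x. \<bar>g x\<bar> \<le> B"
  shows "(\<integral>x. f x * second_diff g x h \<partial>lborel) = (\<integral>x. g x * second_diff f x h \<partial>lborel)"
proof -
  have i: "integrable lborel (\<lambda>x. f (x + a) * g (x + b))" for a b
    using B by (intro integrable_mult_bounded[where C=B] integrable_lborel_translate f) auto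
  have "(\<integral>x. f x * second_diff g x h \<partial>lborel) = 2 * (\<integral>x. f (x + 0) * g (x + 0) \<partial>lborel)
      - (\<integral>x. f (x + 0) * g (x + h) \<partial>lborel) - (\<integral>x. f (x + 0) * g (x + - h) \<partial>lborel)"
  proof -
    have "f x * second_diff g x h = 2 * (f (x + 0) * g (x + 0)) - f (x + 0) * g (x + h) - f (x + 0) * g (x + - h)" for x
      by (simp add: second_diff_def algebra_simps)
    then show ?thesis using i[of 0 0] i[of 0 h] i[of 0 "-h"] by simp
  qed
  also have "(\<integral>x. f (x + 0) * g (x + h) \<partial>lborel) = (\<integral>x. f (x + - h) * g (x + 0) \<partial>lborel)"
    using integral_lborel_translate(1)[OF i[of 0 h], of "-h"] by simp
  also have "(\<integral>x. f (x + 0) * g (x + - h) \<partial>lborel) = (\<integral>x. f (x + h) * g (x + 0) \<partial>lborel)"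
    using integral_lborel_translate(1)[OF i[of 0 "-h"], of h] by simp
  also have "2 * (\<integral>x. f (x + 0) * g (x + 0) \<partial>lborel) - (\<integral>x. f (x + - h) * g (x + 0) \<partial>lborel)
      - (\<integral>x. f (x + h) * g (x + 0) \<partial>lborel) = (\<integral>x. g x * second_diff f x h \<partial>lborel)"
  proof -
    have "g x * second_diff f x h = 2 * (f (x + 0) * g (x + 0)) - f (x + - h) * g (x + 0) - f (x + h) * g (x + 0)" for x
      by (simp add: second_diff_def algebra_simps)
    then show ?thesis using i[of 0 0] i[of h 0] i[of "-h" 0] by simp
  qed
  finally show ?thesis .
qed

text \<open>For fixed h a translation moves the second difference from g to f; integrating against
  the kernel afterwards is Fubini. It serves to put the operator on the test function in Kato's
  inequality.\<close>

lemma frac_lap_self_adjoint: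
  fixes f g :: "'a::euclidean_space \<Rightarrow> real"
  assumes f: "integrable lborel f" "second_diff_le Cf f" and g: "integrable lborel g" "second_diff_le Cg g"
    and B: "\<And>x. \<bar>g x\<bar> \<le> B"
  shows "(\<integral>x. f x * frac_lap g x \<partial>lborel) = (\<integral>x. g x * frac_lap f x \<partial>lborel)"
proof -
  have [measurable]: "f \<in> borel_measurable borel" "g \<in> borel_measurable borel" using f g by auto
  have 1: "integrable (lborel \<Otimes>\<^sub>M lborel) (\<lambda>(x, h). f x * (second_diff g x h * kern s h))"
    using second_diff_leD[OF g(2)] by (intro integrable_pair_mult_kern f) (auto simp: case_prod_beta')
  have 2: "integrable (lborel \<Otimes>\<^sub>M lborel) (\<lambda>(x, h). g x * (second_diff f x h * kern s h))"
    using second_diff_leD[OF f(2)] by (intro integrable_pair_mult_kern g) (auto simp: case_prod_beta')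
  have "(\<integral>x. f x * frac_lap g x \<partial>lborel) = (\<integral>x. \<integral>h. f x * (second_diff g x h * kern s h) \<partial>lborel \<partial>lborel)"
    by (simp add: frac_lap_def)
  also have "\<dots> = (\<integral>h. \<integral>x. f x * (second_diff g x h * kern s h) \<partial>lborel \<partial>lborel)"
    by (rule lborel_pair.Fubini_integral[OF 1, symmetric])
  also have "\<dots> = (\<integral>h. \<integral>x. g x * (second_diff f x h * kern s h) \<partial>lborel \<partial>lborel)"
    using integral_mult_second_diff[OF f(1) _ B] by (simp add: mult.assoc[symmetric])
  also have "\<dots> = (\<integral>x. \<integral>h. g x * (second_diff f x h * kern s h) \<partial>lborel \<partial>lborel)"
    by (rule lborel_pair.Fubini_integral[OF 2])
  also have "\<dots> = (\<integral>x. g x * frac_lap f x \<partial>lborel)"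
    by (simp add: frac_lap_def)
  finally show ?thesis .
qed

text \<open>Inside radius r, beta is the curvature of the barrier and q the gap to it; outside, l is
  what is known of the tail. The beta terms integrate to \<open>wkern r\<close>. For the gap the
  kernel is replaced by its lower bound on the smaller ball of radius rho, for the tail by its upper
  bound outside radius r. The factors 2 come from h and -h.\<close>

lemma frac_lap_touch:
  fixes a q l :: "'a::euclidean_space \<Rightarrow> real"
  assumes a: "integrable lborel (\<lambda>h. second_diff a x h * kern s h)"
    and r: "0 < \<rho>" "\<rho> \<le> r" and "0 \<le> \<beta>"
    and near: "\<And>h. norm h < r \<Longrightarrow> - \<beta> * (norm h / r)\<^sup>2 + q h + q (- h) \<le> second_diff a x h"
    and q: "\<And>h. norm h < r \<Longrightarrow> 0 \<le> q h" "integrable lborel (\<lambda>h. indicator (ball 0 \<rho>) h * q h)"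
    and far: "\<And>h. r \<le> norm h \<Longrightarrow> - \<beta> - l h - l (- h) \<le> second_diff a x h"
    and l: "\<And>h. 0 \<le> l h" "integrable lborel l"
  shows "- \<beta> * K0 TYPE('a) * r powr - (2 * s)
      + 2 * \<rho> powr - (real DIM('a) + 2 * s) * (\<integral>h. indicator (ball 0 \<rho>) h * q h \<partial>lborel)
      - 2 * r powr - (real DIM('a) + 2 * s) * (\<integral>h. l h \<partial>lborel) \<le> frac_lap a x"
proof -
  define P where "P = \<rho> powr - (real DIM('a) + 2 * s)"
  define R where "R = r powr - (real DIM('a) + 2 * s)"
  define Q where "Q h = indicator (ball 0 \<rho>) h * q h" for h
  have r0: "0 < r" using r by linarith
  have P0: "0 \<le> P" "0 \<le> R" by (simp_all add: P_def R_def)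
  have iQ: "integrable lborel Q" using q(2) by (simp add: Q_def[abs_def])
  have iQ': "integrable lborel (\<lambda>h. Q (- h))" "(\<integral>h. Q (- h) \<partial>lborel) = (\<integral>h. Q h \<partial>lborel)"
    using integrable_lborel_translate(4)[OF iQ, of 0] integral_lborel_translate(4)[OF iQ, of 0] by auto
  have il': "integrable lborel (\<lambda>h. l (- h))" "(\<integral>h. l (- h) \<partial>lborel) = (\<integral>h. l h \<partial>lborel)"
    using integrable_lborel_translate(4)[OF l(2), of 0] integral_lborel_translate(4)[OF l(2), of 0] by auto
  \<comment> \<open>At h = 0 the kernel has the default value 0, so the pointwise bound there rests
    on q 0 being nonpositive.\<close>
  have q0: "q 0 \<le> 0" using near[of 0] r0 by (simp add: second_diff_def)
  let ?L = "\<lambda>h. - \<beta> * wkern r h + P * (Q h + Q (- h)) - R * (l h + l (- h))"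
  have pw: "?L h \<le> second_diff a x h * kern s h" for h
  proof -
    consider "h = 0" | "h \<noteq> 0" "norm h < r" | "r \<le> norm h" by linarith
    then show ?thesis
    proof cases
      case 1
      have "P * (Q 0 + Q 0) \<le> 0"
        using P0 q0 by (intro mult_nonneg_nonpos) (auto simp: Q_def indicator_def)
      moreover have "0 \<le> R * (l 0 + l 0)" using P0 l by (intro mult_nonneg_nonneg) (auto intro: add_nonneg_nonneg)
      ultimately show ?thesis using 1 by (simp add: wkern_def)
    next
      case 2
      have *: "P * Q k \<le> q k * kern s h" if "norm k = norm h" for k
      proof (cases "norm h < \<rho>")
        case True
        then have "P \<le> kern s h" using 2 unfolding P_def by (intro kern_ge) auto
        then have "P * q k \<le> kern s h * q k" using q(1)[of k] 2 that by (intro mult_right_mono) auto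
        then show ?thesis using True that by (simp add: Q_def mult.commute)
      next
        case False
        then show ?thesis using q(1)[of k] 2 that by (simp add: Q_def)
      qed
      have "0 \<le> R * (l h + l (- h))" using P0 l by (intro mult_nonneg_nonneg) (auto intro: add_nonneg_nonneg)
      moreover have "wkern r h = (norm h / r)\<^sup>2 * kern s h" using 2 r0 by (intro wkern_near) auto
      moreover have "(- \<beta> * (norm h / r)\<^sup>2 + q h + q (- h)) * kern s h \<le> second_diff a x h * kern s h"
        using near[of h] 2 by (intro mult_right_mono) auto
      ultimately show ?thesis using *[of h] *[of "-h"] by (simp add: algebra_simps)
    next
      case 3
      have *: "l k * kern s h \<le> R * l k" for k
        using kern_le[OF r0 3] l(1)[of k] by (simp add: R_def mult.commute mult_left_mono)
      have "Q h = 0" "Q (- h) = 0" using 3 r by (auto simp: Q_def)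
      moreover have "wkern r h = kern s h" using 3 r0 by (intro wkern_far) auto
      moreover have "(- \<beta> - l h - l (- h)) * kern s h \<le> second_diff a x h * kern s h"
        using far[of h] 3 by (intro mult_right_mono) auto
      ultimately show ?thesis using *[of h] *[of "-h"] by (simp add: algebra_simps)
    qed
  qed
  have "integrable lborel ?L"
    using integrable_wkern[OF r0, where 'a='a] iQ iQ' l il'
    by (intro Bochner_Integration.integrable_diff Bochner_Integration.integrable_add integrable_mult_right) auto
  then have "(\<integral>h. ?L h \<partial>lborel) \<le> frac_lap a x"
    unfolding frac_lap_def using pw a by (intro integral_mono) auto
  also have "(\<integral>h. ?L h \<partial>lborel) = - \<beta> * (\<integral>h. wkern r (h::'a) \<partial>lborel) + P * (2 * (\<integral>h. Q h \<partial>lborel)) - R * (2 * (\<integral>h. l h \<partial>lborel))"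
    using integrable_wkern[OF r0, where 'a='a] iQ iQ' l il' by simp
  finally show ?thesis
    unfolding integral_wkern[OF r0] P_def R_def Q_def by (simp add: algebra_simps)
qed

text \<open>The constant of \<open>bump_second_difference\<close> after rescaling the bump to height
  1, as in \<open>cap\<close>.\<close>

definition bump_const :: "'a::euclidean_space itself \<Rightarrow> real" where
  "bump_const _ = 400 / bump (0::'a)"

lemma bump_const_ge: "400 \<le> bump_const TYPE('a::euclidean_space)"
  using bump_0_pos[where 'a='a] bump_le_1[of "0::'a"] by (simp add: bump_const_def field_simps)

definition cap :: "'a::euclidean_space \<Rightarrow> real \<Rightarrow> 'a \<Rightarrow> real" where
  "cap x0 r x = bump ((x - x0) /\<^sub>R r) / bump (0::'a)"

lemma cap_nonneg [simp]: "0 \<le> cap x0 r x"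
  by (simp add: cap_def)

lemma cap_le_1: "cap (x0::'a::euclidean_space) r x \<le> 1"
  using bump_0_pos[where 'a='a] bump_le_bump_0[where 'a='a] by (simp add: cap_def divide_le_eq_1)

lemma cap_center [simp]: "cap x r x = 1"
  using bump_0_pos[where 'a='a] by (simp add: cap_def)

lemma cap_eq_0: "0 < r \<Longrightarrow> r \<le> norm (x - x0) \<Longrightarrow> cap x0 r x = 0"
  using bump_eq_0[of "(x - x0) /\<^sub>R r"] by (simp add: cap_def norm_scaleR_inverse del: norm_scaleR)

lemma continuous_cap: "continuous_on S (cap x0 r)"
proof -
  have "continuous_on S (\<lambda>x. bump ((x - x0) /\<^sub>R r))"
    by (rule continuous_on_compose2[OF continuous_bump[of UNIV]]) (auto intro!: continuous_intros)
  then show ?thesis unfolding cap_def[abs_def] using bump_0_pos[where 'a='a]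
    by (intro continuous_intros) auto
qed

lemma cap_measurable [measurable]: "cap x0 r \<in> borel_measurable borel"
  by (intro borel_measurable_continuous_onI continuous_cap)

lemma second_diff_cap:
  fixes x :: "'a::euclidean_space"
  assumes "0 < r"
  shows "\<bar>second_diff (cap x0 r) x h\<bar> \<le> bump_const TYPE('a) * (norm h / r)\<^sup>2"
proof -
  have b: "0 < bump (0::'a)" by (rule bump_0_pos)
  let ?y = "(x - x0) /\<^sub>R r" and ?k = "h /\<^sub>R r"
  have "\<bar>second_diff (cap x0 r) x h\<bar> = \<bar>2 * bump ?y - bump (?y + ?k) - bump (?y - ?k)\<bar> / bump (0::'a)"
  proof -
    have "(x + h - x0) /\<^sub>R r = ?y + ?k" "(x - h - x0) /\<^sub>R r = ?y - ?k"
      by (simp_all add: algebra_simps)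
    then show ?thesis
      unfolding second_diff_def cap_def using b by (simp add: diff_divide_distrib[symmetric])
  qed
  also have "\<dots> \<le> 400 * (norm ?k)\<^sup>2 / bump (0::'a)"
    using b by (intro divide_right_mono bump_second_difference) auto
  also have "norm ?k = norm h / r" using assms by (rule norm_scaleR_inverse)
  finally show ?thesis by (simp add: bump_const_def)
qed

text \<open>If the barrier were somewhere above a, then tau cap - a would have a positive maximum at
  some z in the ball, and the touching inequality for -a at z would contradict \<open>gt\<close>.
  The gap at z is at least a - tau, so \<open>gt\<close> tolerates a negative value of the operator
  at points around which a exceeds tau on average over radius rho. Since \<open>max 0\<close> is
  nonnegative, the integral may also be discarded, which leaves the plain barrier argument.\<close>

lemma frac_lap_lower_barrier:
  fixes a :: "'a::euclidean_space \<Rightarrow> real"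
  assumes a: "continuous_on UNIV a" "second_diff_le C a" "\<And>x. 0 \<le> a x"
    and r: "0 < \<rho>" "\<rho> \<le> r" and \<tau>: "0 \<le> \<tau>"
    and gt: "\<And>x. x \<in> ball x0 r \<Longrightarrow> \<tau> * bump_const TYPE('a) * K0 TYPE('a) * r powr - (2 * s)
      - 2 * \<rho> powr - (real DIM('a) + 2 * s) * max 0 (\<integral>y. indicator (ball x \<rho>) y * (a y - \<tau>) \<partial>lborel) < frac_lap a x"
  shows "\<tau> * cap x0 r x \<le> a x"
proof (rule ccontr)
  assume neg: "\<not> ?thesis"
  define g where "g y = \<tau> * cap x0 r y - a y" for y
  have r0: "0 < r" using r by linarith
  have [measurable]: "a \<in> borel_measurable borel" using a(1) by (rule borel_measurable_continuous_onI)
  have out: "g y \<le> 0" if "y \<notin> ball x0 r" for y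
    using cap_eq_0[OF r0, of y x0] that a(3)[of y] by (simp add: g_def dist_norm norm_minus_commute not_less)
  have gx: "0 < g x" using neg by (simp add: g_def not_le)
  have "continuous_on (cball x0 r) g"
    unfolding g_def[abs_def]
    by (intro continuous_intros continuous_cap continuous_on_subset[OF a(1)]) auto
  then obtain z where z: "z \<in> cball x0 r" "\<And>y. y \<in> cball x0 r \<Longrightarrow> g y \<le> g z"
    using continuous_attains_sup[OF compact_cball, of x0 r g] r0 by fastforce
  have x: "x \<in> ball x0 r" using out[of x] gx by fastforce
  have \<mu>: "0 < g z" using z(2)[of x] x gx by auto
  have zb: "z \<in> ball x0 r" using out[of z] \<mu> by fastforce
  have gz: "g y \<le> g z" for y
  proof (cases "y \<in> ball x0 r")
    case True then show ?thesis using z(2)[of y] by auto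
  next
    case False then show ?thesis using out[of y] \<mu> by linarith
  qed
  define q where "q h = g z - g (z + h)" for h
  have q0: "0 \<le> q h" for h using gz by (simp add: q_def)
  have gm: "g \<in> borel_measurable borel" unfolding g_def[abs_def] by measurable
  have qle: "a (z + h) - \<tau> \<le> q h" for h
    using \<mu> mult_left_mono[OF cap_le_1 \<tau>, of x0 r "z + h"] by (simp add: q_def g_def)
  let ?\<beta> = "\<tau> * bump_const TYPE('a)"
  have d2: "second_diff (\<lambda>x. - a x) z h = q h + q (- h) - \<tau> * second_diff (cap x0 r) z h" for h
    by (simp add: second_diff_def q_def g_def algebra_simps)
  have near: "- ?\<beta> * (norm h / r)\<^sup>2 + q h + q (- h) \<le> second_diff (\<lambda>x. - a x) z h" for h
    using mult_left_mono[OF abs_le_D1[OF second_diff_cap[OF r0, of x0 z h]] \<tau>]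
    by (simp add: d2 mult.assoc)
  \<comment> \<open>From 0 <= a and a z <= tau the second difference of -a is at least -2 tau; as
    \<open>bump_const\<close> exceeds 2, the same beta serves inside and outside, with l =
    0.\<close>
  have far: "- ?\<beta> \<le> second_diff (\<lambda>x. - a x) z h" for h
  proof -
    have "a z \<le> \<tau>" using \<mu> mult_left_mono[OF cap_le_1 \<tau>, of x0 r z] by (simp add: g_def)
    then have "- (2 * \<tau>) \<le> second_diff (\<lambda>x. - a x) z h"
      using a(3)[of "z + h"] a(3)[of "z - h"] by (simp add: second_diff_def)
    moreover have "2 * \<tau> \<le> ?\<beta>" using bump_const_ge[where 'a='a] mult_left_mono[OF _ \<tau>, of 2 "bump_const TYPE('a)"]
      by (simp add: mult.commute)
    ultimately show ?thesis by linarith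
  qed
  have iQ: "integrable lborel (\<lambda>h. indicator (ball 0 \<rho>) h * q h)"
  proof (rule integrable_bounded_support[where r=\<rho> and C="g z + \<bar>Sup (a ` cball z \<rho>)\<bar>"])
    fix h :: 'a
    show "\<bar>indicator (ball 0 \<rho>) h * q h\<bar> \<le> g z + \<bar>Sup (a ` cball z \<rho>)\<bar>"
    proof (cases "h \<in> ball 0 \<rho>")
      case True
      have "compact (a ` cball z \<rho>)" using a(1) by (intro compact_continuous_image) (auto intro: continuous_on_subset)
      then have "a (z + h) \<le> Sup (a ` cball z \<rho>)"
        using True by (intro cSup_upper bounded_imp_bdd_above compact_imp_bounded) (auto simp: dist_norm)
      moreover have "q h \<le> g z + a (z + h)" using \<tau> by (simp add: q_def g_def)
      ultimately show ?thesis using True q0[of h] by simp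
    qed (use \<mu> in auto)
    show "(\<lambda>h. indicator (ball 0 \<rho>) h * q h) \<in> borel_measurable borel"
      unfolding q_def
      by (intro borel_measurable_times borel_measurable_indicator borel_measurable_diff borel_measurable_const
          measurable_compose[OF _ gm]) auto
  qed auto
  have "- ?\<beta> * K0 TYPE('a) * r powr - (2 * s)
      + 2 * \<rho> powr - (real DIM('a) + 2 * s) * (\<integral>h. indicator (ball 0 \<rho>) h * q h \<partial>lborel)
      - 2 * r powr - (real DIM('a) + 2 * s) * (\<integral>h. 0 \<partial>(lborel :: 'a measure)) \<le> frac_lap (\<lambda>x. - a x) z"
  proof (rule frac_lap_touch[where l="\<lambda>_. 0"])
    show "integrable lborel (\<lambda>h. second_diff (\<lambda>x. - a x) z h * kern s h)"
      using integrable_second_diff_kern[OF _ a(2), of z]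
      by (rule back_subst[where P="integrable lborel", OF integrable_minus]) (auto simp: second_diff_def algebra_simps)
    show "0 \<le> ?\<beta>" using \<tau> bump_const_ge[where 'a='a] by simp
  qed (use r near far q0 iQ in auto)
  moreover have "max 0 (\<integral>y. indicator (ball z \<rho>) y * (a y - \<tau>) \<partial>lborel) \<le> (\<integral>h. indicator (ball 0 \<rho>) h * q h \<partial>lborel)"
  proof (rule max.boundedI)
    show "0 \<le> (\<integral>h. indicator (ball 0 \<rho>) h * q h \<partial>lborel)" using q0 by simp
    have i: "integrable lborel (\<lambda>y. indicator (ball z \<rho>) y * (a y - \<tau>))"
    proof -
      have "integrable lborel (\<lambda>y. indicator (cball z \<rho>) y *\<^sub>R (a y - \<tau>))"
        by (intro borel_integrable_compact compact_cball continuous_intros continuous_on_subset[OF a(1)]) auto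
      moreover have "(indicator (ball z \<rho>) :: 'a \<Rightarrow> real) \<in> borel_measurable lborel"
        by (intro borel_measurable_indicator) auto
      ultimately have "integrable lborel (\<lambda>y. indicator (cball z \<rho>) y *\<^sub>R (a y - \<tau>) * indicator (ball z \<rho>) y)"
        by (rule integrable_mult_bounded[where C=1]) (auto simp: indicator_def)
      then show ?thesis
        by (rule Bochner_Integration.integrable_cong[THEN iffD1, rotated -1]) (auto simp: indicator_def)
    qed
    have "(\<integral>y. indicator (ball z \<rho>) y * (a y - \<tau>) \<partial>lborel) = (\<integral>h. indicator (ball z \<rho>) (z + h) * (a (z + h) - \<tau>) \<partial>lborel)"
      using integral_lborel_translate(2)[OF i, of z] by simp
    also have "\<dots> \<le> (\<integral>h. indicator (ball 0 \<rho>) h * q h \<partial>lborel)"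
    proof (rule integral_mono)
      fix h show "indicator (ball z \<rho>) (z + h) * (a (z + h) - \<tau>) \<le> indicator (ball 0 \<rho>) h * q h"
        using qle[of h] by (auto simp: indicator_def dist_norm)
    qed (use integrable_lborel_translate(2)[OF i, of z] iQ in auto)
    finally show "(\<integral>y. indicator (ball z \<rho>) y * (a y - \<tau>) \<partial>lborel) \<le> (\<integral>h. indicator (ball 0 \<rho>) h * q h \<partial>lborel)" .
  qed
  then have "2 * \<rho> powr - (real DIM('a) + 2 * s) * max 0 (\<integral>y. indicator (ball z \<rho>) y * (a y - \<tau>) \<partial>lborel)
    \<le> 2 * \<rho> powr - (real DIM('a) + 2 * s) * (\<integral>h. indicator (ball 0 \<rho>) h * q h \<partial>lborel)"
    by (intro mult_left_mono) auto
  ultimately show False using gt[OF zb] by (simp add: frac_lap_minus)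
qed

end

section \<open>Estimates for supersolutions\<close>

text \<open>The integral of (b - f)^+ over S is at most the L^1 distance of f_e and f, hence zero.
  This passes to the limit without choosing a subsequence.\<close>

lemma mollify_limit_ge:
  fixes f :: "'a::euclidean_space \<Rightarrow> real"
  assumes f: "integrable lborel f" and [measurable]: "b \<in> borel_measurable borel" "S \<in> sets borel"
    and e0: "0 < e0" and ge: "\<And>e x. 0 < e \<Longrightarrow> e < e0 \<Longrightarrow> x \<in> S \<Longrightarrow> b x \<le> mollify e f x"
  shows "AE x in lborel. x \<in> S \<longrightarrow> b x \<le> f x"
proof -
  have [measurable]: "f \<in> borel_measurable borel" using f by auto
  let ?g = "\<lambda>x. ennreal (indicator S x * max 0 (b x - f x))"
  have eps: "(\<integral>\<^sup>+x. ?g x \<partial>lborel) \<le> 0 + ennreal d" if "0 < d" for d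
  proof -
    obtain \<eta> where \<eta>: "\<eta> > 0" "\<And>e. 0 < e \<and> e < \<eta> \<Longrightarrow> (\<integral>x. \<bar>mollify e f x - f x\<bar> \<partial>lborel) \<le> d"
      using mollify_L1_close[OF f \<open>0 < d\<close>] by blast
    define e where "e = min \<eta> e0 / 2"
    have e: "0 < e" "e < \<eta>" "e < e0" using \<eta>(1) e0 by (auto simp: e_def)
    have "(\<integral>\<^sup>+x. ?g x \<partial>lborel) \<le> (\<integral>\<^sup>+x. ennreal \<bar>mollify e f x - f x\<bar> \<partial>lborel)"
    proof (intro nn_integral_mono ennreal_leI)
      fix x show "indicator S x * max 0 (b x - f x) \<le> \<bar>mollify e f x - f x\<bar>"
        using ge[of e x] e by (cases "x \<in> S") auto
    qed
    also have "\<dots> = ennreal (\<integral>x. \<bar>mollify e f x - f x\<bar> \<partial>lborel)"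
      using integrable_mollify[OF f e(1)] f by (intro nn_integral_eq_integral) auto
    also have "\<dots> \<le> ennreal d" using \<eta>(2)[of e] e by (intro ennreal_leI) auto
    finally show ?thesis by simp
  qed
  have "(\<integral>\<^sup>+x. ?g x \<partial>lborel) \<le> 0"
    by (rule ennreal_le_epsilon) (rule eps)
  then have "AE x in lborel. ?g x = 0"
    by (subst nn_integral_0_iff_AE[symmetric]) auto
  then show ?thesis
    by eventually_elim (auto simp: ennreal_eq_0_iff split: if_splits)
qed

lemma mollify_minus: "mollify e (\<lambda>x. - f x) x = - mollify e f x"
  by (simp add: mollify_def)

lemma mollify_limit_le:
  fixes f :: "'a::euclidean_space \<Rightarrow> real"
  assumes f: "integrable lborel f" and "b \<in> borel_measurable borel" "S \<in> sets borel"
    and e0: "0 < e0" and le: "\<And>e x. 0 < e \<Longrightarrow> e < e0 \<Longrightarrow> x \<in> S \<Longrightarrow> mollify e f x \<le> b x"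
  shows "AE x in lborel. x \<in> S \<longrightarrow> f x \<le> b x"
proof -
  have "AE x in lborel. x \<in> S \<longrightarrow> - b x \<le> - f x"
    using assms by (intro mollify_limit_ge[OF _ _ _ e0]) (auto simp: mollify_minus)
  then show ?thesis by simp
qed

section \<open>Barrier estimates uniform in the mollification radius\<close>

context frac_order
begin

text \<open>The choice of eta in the touching arguments: a gap on a ball of radius eta r brings a
  multiple of (eta r)^(-2s), which must outweigh a given A r^(-2s).\<close>

lemma obtain_small_ratio:
  assumes "0 < V"
  obtains \<eta> where "0 < \<eta>" "\<eta> \<le> 1" "A < V * \<eta> powr - (2 * s)"
proof -
  define M where "M = max 1 ((\<bar>A\<bar> + 1) / V)"
  have M: "1 \<le> M" "(\<bar>A\<bar> + 1) / V \<le> M" by (auto simp: M_def)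
  define \<eta> where "\<eta> = M powr - (1 / (2 * s))"
  have "\<eta> powr - (2 * s) = M" using M s_pos by (simp add: \<eta>_def powr_powr)
  moreover have "0 < \<eta>" using M by (simp add: \<eta>_def)
  moreover have "\<eta> \<le> M powr 0" unfolding \<eta>_def using M s_pos by (intro powr_mono) auto
  moreover have "A < V * M"
    using M(2) assms by (simp add: pos_divide_le_eq mult.commute)
  ultimately show ?thesis using that[of \<eta>] M by simp
qed

lemma powr_dim_split:
  assumes "0 < r"
  shows "r powr - (real DIM('a::euclidean_space) + 2 * s) * r ^ DIM('a) = r powr - (2 * s)"
  using assms by (simp add: powr_realpow[symmetric] powr_add[symmetric])

text \<open>The cost of the barrier is proportional to its height tau while the operator is at least
  gamma, so a small tau works for every e. The gap integral is discarded.\<close>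

lemma positive_lower_bound:
  fixes f :: "'a::euclidean_space \<Rightarrow> real"
  assumes f: "integrable lborel f" "\<And>x. 0 \<le> f x" and R: "0 < R" and \<gamma>: "0 < \<gamma>"
    and super: "\<And>e x. 0 < e \<Longrightarrow> e \<le> R \<Longrightarrow> x \<in> ball x0 R \<Longrightarrow> \<gamma> \<le> frac_lap (mollify e f) x"
  shows "\<exists>\<tau>>0. \<exists>r>0. AE x in lborel. x \<in> ball x0 r \<longrightarrow> \<tau> \<le> f x"
proof -
  let ?K = "bump_const TYPE('a) * K0 TYPE('a) * R powr - (2 * s)"
  have K: "0 \<le> ?K" using bump_const_ge[where 'a='a] by simp
  \<comment> \<open>The summand 1 guards against \<open>?K = 0\<close>, since \<open>K0\<close> is
    only shown to be nonnegative; the factor 2 makes the comparison with gamma strict.\<close>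
  define \<tau> where "\<tau> = \<gamma> / (2 * (?K + 1))"
  have \<tau>: "0 < \<tau>" using K \<gamma> by (simp add: \<tau>_def)
  have "\<tau> * ?K \<le> \<tau> * (?K + 1)" using \<tau> by (intro mult_left_mono) auto
  also have "\<dots> = \<gamma> / 2" using K by (simp add: \<tau>_def field_simps)
  also have "\<dots> < \<gamma>" using \<gamma> by simp
  finally have \<tau>K: "\<tau> * ?K < \<gamma>" .
  have ge: "\<tau> * cap x0 R x \<le> mollify e f x" if e: "0 < e" "e < R" for e x
  proof (rule frac_lap_lower_barrier[where \<rho>=R and C="moll_const TYPE('a) e * (\<integral>y. \<bar>f y\<bar> \<partial>lborel)"])
    fix y assume "y \<in> ball x0 R"
    then have "\<gamma> \<le> frac_lap (mollify e f) y" using super[of e y] e by auto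
    moreover have "0 \<le> 2 * R powr - (real DIM('a) + 2 * s) *
        max 0 (\<integral>z. indicator (ball y R) z * (mollify e f z - \<tau>) \<partial>lborel)" by simp
    ultimately show "\<tau> * bump_const TYPE('a) * K0 TYPE('a) * R powr - (2 * s) - 2 * R powr - (real DIM('a) + 2 * s) *
        max 0 (\<integral>z. indicator (ball y R) z * (mollify e f z - \<tau>) \<partial>lborel) < frac_lap (mollify e f) y"
      using \<tau>K by (simp only: mult.assoc)
  qed (use f e R \<tau> second_diff_le_mollify[OF f(1) e(1)] in \<open>auto intro!: continuous_mollify mollify_ge\<close>)
  have ae: "AE x in lborel. x \<in> UNIV \<longrightarrow> \<tau> * cap x0 R x \<le> f x"
    using ge by (intro mollify_limit_ge[OF f(1) _ _ R]) auto
  have "isCont (cap x0 R) x0"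
    using continuous_cap[of UNIV x0 R] by (simp add: continuous_on_eq_continuous_at)
  then have "\<forall>\<^sub>F x in nhds x0. 1/2 < cap x0 R x"
    by (intro order_tendstoD(1)[of _ "cap x0 R x0"]) (auto simp: continuous_at tendsto_nhds_iff)
  then obtain r where r: "r > 0" "\<And>x. x \<in> ball x0 r \<Longrightarrow> 1/2 < cap x0 R x"
    by (auto simp: eventually_nhds_metric dist_commute)
  from ae have "AE x in lborel. x \<in> ball x0 r \<longrightarrow> \<tau> / 2 \<le> f x"
  proof eventually_elim
    case (elim x)
    show ?case
    proof
      assume "x \<in> ball x0 r"
      then have "\<tau> * (1/2) \<le> \<tau> * cap x0 R x" using r(2)[of x] \<tau> by (intro mult_left_mono) auto
      then show "\<tau> / 2 \<le> f x" using elim by simp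
    qed
  qed
  then show ?thesis using \<tau> r(1) by (intro exI[of _ "\<tau>/2"] conjI exI[of _ r]) auto
qed

text \<open>Let B be the part of the ball of radius 3 r where f < k. From f >= k - k 1_B, with 1_B
  the indicator, convolution gives f_e - tau >= delta - k (1_B)_e, and (1_B)_e has integral |B| for
  every e. If |B| is a small multiple of r^n, the gap integral over radius eta r keeps at least half
  of delta V (eta r)^n for all e < r, and its weight (eta r)^(-n-2s) beats both the barrier and
  c.\<close>

lemma density_lower_bound:
  fixes f :: "'a::euclidean_space \<Rightarrow> real"
  assumes f: "integrable lborel f" "\<And>x. 0 \<le> f x" and R: "0 < R" "R \<le> 1" and c: "0 \<le> c"
    and super: "\<And>e x. 0 < e \<Longrightarrow> e \<le> R \<Longrightarrow> x \<in> ball x0 R \<Longrightarrow> - c \<le> frac_lap (mollify e f) x"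
    and k: "0 < \<delta>" "\<delta> < k"
    and dens: "\<And>\<gamma> r1. 0 < \<gamma> \<Longrightarrow> 0 < r1 \<Longrightarrow>
       \<exists>r. 0 < r \<and> r \<le> r1 \<and> measure lborel {y \<in> ball x0 (3 * r). f y < k} \<le> \<gamma> * r ^ DIM('a)"
  shows "\<exists>r>0. AE x in lborel. x \<in> ball x0 r \<longrightarrow> k - 2 * \<delta> \<le> f x"
proof -
  have fm[measurable]: "f \<in> borel_measurable borel" using f by auto
  define V where "V = measure lborel (ball (0::'a) 1)"
  have V: "0 < V" unfolding V_def by (rule measure_unit_ball_pos)
  define \<tau> where "\<tau> = k - \<delta>"
  have \<tau>: "0 < \<tau>" using k by (simp add: \<tau>_def)
  obtain \<eta> where \<eta>: "0 < \<eta>" "\<eta> \<le> 1"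
      "\<tau> * bump_const TYPE('a) * K0 TYPE('a) + c < \<delta> * V * \<eta> powr - (2 * s)"
    using obtain_small_ratio[of "\<delta> * V"] V k by auto
  \<comment> \<open>Makes k |B| at most half of delta V (eta r)^n. It depends on eta but not on r,
    which is chosen afterwards.\<close>
  define \<gamma> where "\<gamma> = \<delta> * V * \<eta> ^ DIM('a) / (2 * k)"
  have \<gamma>: "0 < \<gamma>" using V k \<eta> by (simp add: \<gamma>_def)
  obtain r where r: "0 < r" "r \<le> R" and bad: "measure lborel {y \<in> ball x0 (3 * r). f y < k} \<le> \<gamma> * r ^ DIM('a)"
    using dens[OF \<gamma> R(1)] by blast
  define \<rho> where "\<rho> = \<eta> * r"
  have \<rho>: "0 < \<rho>" "\<rho> \<le> r" using \<eta> r by (auto simp: \<rho>_def)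
  define B where "B = {y \<in> ball x0 (3 * r). f y < k}"
  have Bm[measurable]: "B \<in> sets borel" unfolding B_def by measurable
  have finB: "emeasure lborel B < \<infinity>"
    by (rule emeasure_bounded_finite) (auto simp: B_def intro: bounded_subset[OF bounded_ball])
  define ind_bad where "ind_bad = (indicator B :: 'a \<Rightarrow> real)"
  have ind_bad: "integrable lborel ind_bad" unfolding ind_bad_def using finB by (intro integrable_real_indicator) auto
  have ge: "\<tau> * cap x0 r x \<le> mollify e f x" if e: "0 < e" "e < r" for e x
  proof (rule frac_lap_lower_barrier[where \<rho>=\<rho> and C="moll_const TYPE('a) e * (\<integral>y. \<bar>f y\<bar> \<partial>lborel)"])
    fix x assume x: "x \<in> ball x0 r"
    have icc: "integrable lborel (\<lambda>y. mollify e ind_bad y)" by (rule integrable_mollify[OF ind_bad e(1)])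
    have cc0: "0 \<le> mollify e ind_bad y" for y using ind_bad e by (intro mollify_ge) (auto simp: ind_bad_def)
    have pw: "k - k * mollify e ind_bad y \<le> mollify e f y" if y: "y \<in> ball x \<rho>" for y
    proof -
      have i: "integrable lborel (\<lambda>z. moll e (y - z))"
        by (rule integrable_moll_shift[OF e(1)])
      note i2 = integrable_mollify_integrand[OF ind_bad e(1), of y]
      have "(\<integral>z. (k - k * ind_bad z) * moll e (y - z) \<partial>lborel) \<le> mollify e f y"
      proof (rule integral_moll_le_mollify[OF f(1) e(1)])
        show "AE z in lborel. norm (y - z) < e \<longrightarrow> k - k * ind_bad z \<le> f z"
        proof (intro AE_I2 impI)
          fix z assume "norm (y - z) < e"
          \<comment> \<open>The origin of the radius 3 r: x is within r of x0, y within rho <= r of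
            x, and z within e < r of y.\<close>
          moreover have "dist x0 y < 2 * r" using x y \<rho> dist_triangle[of x0 y x] by simp
          ultimately have "z \<in> ball x0 (3 * r)" using e dist_triangle[of x0 z y] by (simp add: dist_norm)
          then show "k - k * ind_bad z \<le> f z" using f(2)[of z] by (auto simp: ind_bad_def B_def indicator_def)
        qed
        show "integrable lborel (\<lambda>z. (k - k * ind_bad z) * moll e (y - z))"
          using i i2 by (simp add: left_diff_distrib mult.assoc)
      qed
      also have "(\<integral>z. (k - k * ind_bad z) * moll e (y - z) \<partial>lborel)
         = k * (\<integral>z. moll e (y - z) \<partial>lborel) - k * mollify e ind_bad y"
        using i i2 by (simp add: left_diff_distrib mult.assoc mollify_def)
      also have "(\<integral>z. moll e (y - z) \<partial>lborel) = 1"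
        by (rule integral_moll_shift[OF e(1)])
      finally show ?thesis by simp
    qed
    have ib: "integrable lborel (indicator (ball x \<rho>) :: 'a \<Rightarrow> real)"
      by (rule integrable_indicator_ball)
    have ibm: "integrable lborel (\<lambda>y. indicator (ball x \<rho>) y * (mollify e f y - \<tau>))"
    proof -
      have "integrable lborel (\<lambda>y. mollify e f y * indicator (ball x \<rho>) y)"
        using integrable_mollify[OF f(1) e(1)] ib
        by (intro integrable_mult_bounded[where C=1]) (auto simp: indicator_def)
      then have "integrable lborel (\<lambda>y. mollify e f y * indicator (ball x \<rho>) y - \<tau> * indicator (ball x \<rho>) y)"
        using ib by (intro Bochner_Integration.integrable_diff integrable_mult_right)
      then show ?thesis by (simp add: algebra_simps)
    qed
    have "\<delta> * (V * \<rho> ^ DIM('a)) - k * measure lborel B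
      = (\<integral>y. \<delta> * indicator (ball x \<rho>) y - k * mollify e ind_bad y \<partial>lborel)"
      using ib icc integral_mollify[OF ind_bad e(1)] measure_lborel_ball[of \<rho> x] \<rho> by (simp add: ind_bad_def V_def)
    also have "\<dots> \<le> (\<integral>y. indicator (ball x \<rho>) y * (mollify e f y - \<tau>) \<partial>lborel)"
    proof (rule integral_mono)
      fix y show "\<delta> * indicator (ball x \<rho>) y - k * mollify e ind_bad y \<le> indicator (ball x \<rho>) y * (mollify e f y - \<tau>)"
        using pw[of y] cc0[of y] k by (cases "y \<in> ball x \<rho>") (auto simp: \<tau>_def)
    qed (use ib icc ibm in auto)
    finally have G: "\<delta> * (V * \<rho> ^ DIM('a)) - k * measure lborel B
       \<le> max 0 (\<integral>y. indicator (ball x \<rho>) y * (mollify e f y - \<tau>) \<partial>lborel)" by linarith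
    have "k * measure lborel B \<le> k * (\<gamma> * r ^ DIM('a))"
      using bad k by (intro mult_left_mono) (auto simp: B_def)
    also have "\<dots> = \<delta> * (V * \<rho> ^ DIM('a)) / 2"
      using k by (simp add: \<gamma>_def \<rho>_def power_mult_distrib)
    finally have "\<delta> * (V * \<rho> ^ DIM('a)) / 2 \<le> max 0 (\<integral>y. indicator (ball x \<rho>) y * (mollify e f y - \<tau>) \<partial>lborel)"
      using G by linarith
    then have "2 * \<rho> powr - (real DIM('a) + 2 * s) * (\<delta> * (V * \<rho> ^ DIM('a)) / 2)
      \<le> 2 * \<rho> powr - (real DIM('a) + 2 * s) * max 0 (\<integral>y. indicator (ball x \<rho>) y * (mollify e f y - \<tau>) \<partial>lborel)"
      by (intro mult_left_mono) auto
    moreover have "2 * \<rho> powr - (real DIM('a) + 2 * s) * (\<delta> * (V * \<rho> ^ DIM('a)) / 2) = \<delta> * V * \<eta> powr - (2 * s) * r powr - (2 * s)"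
    proof -
      have "2 * \<rho> powr - (real DIM('a) + 2 * s) * (\<delta> * (V * \<rho> ^ DIM('a)) / 2)
         = \<delta> * V * (\<rho> powr - (real DIM('a) + 2 * s) * \<rho> ^ DIM('a))" by simp
      also have "\<dots> = \<delta> * V * \<rho> powr - (2 * s)" using powr_dim_split[OF \<rho>(1), where 'a='a] by simp
      finally show ?thesis using \<eta> r by (simp add: \<rho>_def powr_mult)
    qed
    moreover have "(\<tau> * bump_const TYPE('a) * K0 TYPE('a) + c) * r powr - (2 * s) < \<delta> * V * \<eta> powr - (2 * s) * r powr - (2 * s)"
      using \<eta>(3) r by (intro mult_strict_right_mono) auto
    moreover have "c * 1 \<le> c * r powr - (2 * s)"
    proof -
      have "r powr 0 \<le> r powr - (2 * s)" using r R s_pos by (intro powr_mono') auto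
      then show ?thesis using c r by (intro mult_left_mono) auto
    qed
    moreover have "- c \<le> frac_lap (mollify e f) x" using super[of e x] x r e by auto
    ultimately show "\<tau> * bump_const TYPE('a) * K0 TYPE('a) * r powr - (2 * s)
      - 2 * \<rho> powr - (real DIM('a) + 2 * s) * max 0 (\<integral>y. indicator (ball x \<rho>) y * (mollify e f y - \<tau>) \<partial>lborel)
      < frac_lap (mollify e f) x" unfolding distrib_right by linarith
  qed (use f e \<rho> \<tau> second_diff_le_mollify[OF f(1) e(1)] in \<open>auto intro!: continuous_mollify mollify_ge\<close>)
  have ae: "AE x in lborel. x \<in> UNIV \<longrightarrow> \<tau> * cap x0 r x \<le> f x"
    using ge by (intro mollify_limit_ge[OF f(1) _ _ r(1)]) auto
  have "isCont (\<lambda>x. \<tau> * cap x0 r x) x0"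
    using continuous_cap[of UNIV x0 r] by (intro continuous_intros) (simp add: continuous_on_eq_continuous_at)
  then have "\<forall>\<^sub>F x in nhds x0. \<tau> - \<delta> < \<tau> * cap x0 r x"
    using k by (intro order_tendstoD(1)[of _ "\<tau> * cap x0 r x0"]) (auto simp: continuous_at tendsto_nhds_iff)
  then obtain r' where r': "r' > 0" "\<And>x. x \<in> ball x0 r' \<Longrightarrow> \<tau> - \<delta> < \<tau> * cap x0 r x"
    by (auto simp: eventually_nhds_metric dist_commute)
  from ae have "AE x in lborel. x \<in> ball x0 r' \<longrightarrow> k - 2 * \<delta> \<le> f x"
  proof eventually_elim
    case (elim x)
    then show ?case using r'(2)[of x] by (force simp: \<tau>_def)
  qed
  then show ?thesis using r'(1) by blast
qed

text \<open>Let d^n z_e be maximal at x1, d being the distance to the boundary of the ball, and put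
  m = z_e(x1), r = d(x1) / 4. If the maximum exceeds S0, a barrier of height comparable to m on the
  ball of radius r around x1, raised by a constant, touches z_e from above at some x2. There the gap
  is at least m - |z_e|, and its integral over radius eta r makes the operator too large for
  \<open>sub\<close>. S0 depends on z only through the L^1 norm, so the bound survives e ->
  0.\<close>

lemma local_maximum_principle:
  fixes z :: "'a::euclidean_space \<Rightarrow> real"
  assumes z: "integrable lborel z" and R: "0 < R" "R \<le> 1" and DE: "0 \<le> D" "0 \<le> E"
    and sub: "\<And>e x. 0 < e \<Longrightarrow> e < R \<Longrightarrow> x \<in> ball x0 R \<Longrightarrow> frac_lap (mollify e z) x \<le> D + E * mollify e z x"
  shows "\<exists>M. AE x in lborel. x \<in> ball x0 (R / 2) \<longrightarrow> z x \<le> M"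
proof -
  define V where "V = measure lborel (ball (0::'a) 1)"
  have V: "0 < V" unfolding V_def by (rule measure_unit_ball_pos)
  define N where "N = (\<integral>x. \<bar>z x\<bar> \<partial>lborel)"
  have N: "0 \<le> N" by (simp add: N_def)
  let ?n = "DIM('a)" and ?cb = "bump_const TYPE('a)"
  obtain \<eta> where \<eta>: "0 < \<eta>" "\<eta> \<le> 1"
      "2 ^ (?n + 1) * ?cb * K0 TYPE('a) + 2 + D + E * 2 ^ ?n < V * \<eta> powr - (2 * s)"
    using obtain_small_ratio[OF V] by blast
  \<comment> \<open>The three entries yield, in this order, 1 <= m, the absorption of the tail
    outside radius r, and that of the L^1 norm in the gap integral over radius eta r.\<close>
  define S0 where "S0 = Max {1, 4 ^ ?n * N, 2 * N * (4 / \<eta>) ^ ?n / V}"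
  have S0: "1 \<le> S0" "4 ^ ?n * N \<le> S0" "2 * N * (4 / \<eta>) ^ ?n / V \<le> S0"
    unfolding S0_def by (auto intro: Max_ge)
  have main: "(R - norm (x - x0)) ^ ?n * mollify e z x \<le> S0" if e: "0 < e" "e < R" and x: "x \<in> cball x0 R" for e x
  proof (rule ccontr)
    define a where "a = mollify e z"
    have ca: "continuous_on T a" for T unfolding a_def by (rule continuous_mollify[OF z e(1)])
    define d where "d y = R - norm (y - x0)" for y
    assume neg: "\<not> ?thesis"
    have "continuous_on (cball x0 R) (\<lambda>y. d y ^ ?n * a y)"
      unfolding d_def by (intro continuous_intros ca)
    then obtain x1 where x1: "x1 \<in> cball x0 R" "\<And>y. y \<in> cball x0 R \<Longrightarrow> d y ^ ?n * a y \<le> d x1 ^ ?n * a x1"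
      using continuous_attains_sup[OF compact_cball, of x0 R "\<lambda>y. d y ^ ?n * a y"] R by fastforce
    define S where "S = d x1 ^ ?n * a x1"
    have S: "S0 < S" using neg x1(2)[OF x] by (simp add: S_def d_def a_def)
    have S1: "0 < S" using S S0 by linarith
    have d1: "0 < d x1"
    proof -
      have "0 \<le> d x1" using x1(1) by (simp add: d_def dist_norm norm_minus_commute)
      moreover have "d x1 \<noteq> 0" using S1 by (auto simp: S_def zero_power)
      ultimately show ?thesis by simp
    qed
    define m where "m = a x1"
    have m: "0 < m" using S1 d1 by (simp add: S_def m_def zero_less_mult_iff)
    define r where "r = d x1 / 4"
    have "d x1 \<le> R" by (simp add: d_def)
    then have r: "0 < r" "4 * r \<le> 1" "r \<le> 1" using d1 R by (auto simp: r_def)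
    have mS: "m * (4 * r) ^ ?n = S" using d1 by (simp add: m_def r_def S_def)
    \<comment> \<open>On the ball of radius 2 r around x1 the distance d is at least 2 r, half of
      its value at x1, so maximality loses at most the factor 2^n.\<close>
    have up: "a y \<le> 2 ^ ?n * m" if y: "y \<in> ball x1 (2 * r)" for y
    proof -
      have "norm (y - x0) \<le> norm (x1 - x0) + norm (y - x1)"
        using norm_triangle_ineq[of "x1 - x0" "y - x1"] by simp
      then have dy: "2 * r \<le> d y" using y by (simp add: d_def r_def dist_norm norm_minus_commute)
      then have "y \<in> cball x0 R" using r by (simp add: d_def dist_norm norm_minus_commute)
      from x1(2)[OF this] have "d y ^ ?n * a y \<le> m * (4 * r) ^ ?n" using mS by (simp add: S_def)
      also have "(4 * r) ^ ?n = (2 * r) ^ ?n * 2 ^ ?n" by (subst power_mult_distrib[symmetric]) simp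
      also have "m * ((2 * r) ^ ?n * 2 ^ ?n) = (2 * r) ^ ?n * (2 ^ ?n * m)" by simp
      also have "\<dots> \<le> d y ^ ?n * (2 ^ ?n * m)" using dy r m by (intro mult_right_mono power_mono) auto
      finally show ?thesis using dy r by (simp add: mult_le_cancel_left_pos)
    qed
    \<comment> \<open>Twice the bound in \<open>up\<close>, so that subtracting the barrier makes G
      negative between the radii r and 2 r, while G is m at the centre. The maximum of G is thus
      interior.\<close>
    define \<beta>0 where "\<beta>0 = 2 ^ (?n + 1) * m"
    have \<beta>0: "0 < \<beta>0" using m by (simp add: \<beta>0_def)
    define b where "b y = \<beta>0 * (1 - cap x1 r y)" for y
    have b0: "0 \<le> b y" for y using cap_le_1[of x1 r y] \<beta>0 by (simp add: b_def)
    define G where "G y = a y - b y" for y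
    have cG: "continuous_on T G" for T unfolding G_def b_def by (intro continuous_intros ca continuous_cap)
    obtain x2 where x2: "x2 \<in> cball x1 r" "\<And>y. y \<in> cball x1 r \<Longrightarrow> G y \<le> G x2"
      using continuous_attains_sup[OF compact_cball _ cG, of x1 r] r by fastforce
    define \<mu> where "\<mu> = G x2"
    have "G x1 = m" by (simp add: G_def b_def m_def)
    then have \<mu>m: "m \<le> \<mu>" using x2(2)[of x1] r by (simp add: \<mu>_def)
    have out: "G y < 0" if "y \<in> ball x1 (2 * r)" "y \<notin> ball x1 r" for y
    proof -
      have "cap x1 r y = 0" using that r by (intro cap_eq_0) (auto simp: dist_norm norm_minus_commute)
      moreover have "2 ^ ?n * m < 2 * (2 ^ ?n * m)" using m by simp
      then have "a y < 2 * (2 ^ ?n * m)" using up[OF that(1)] by linarith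
      ultimately show ?thesis by (simp add: G_def b_def \<beta>0_def mult.assoc)
    qed
    have x2b: "x2 \<in> ball x1 r"
    proof (rule ccontr)
      assume "x2 \<notin> ball x1 r"
      then have "G x2 < 0" using x2(1) r by (intro out) auto
      then show False using \<mu>m m by (simp add: \<mu>_def)
    qed
    have G\<mu>: "G y \<le> \<mu>" if "y \<in> ball x1 (2 * r)" for y
      using x2(2)[of y] out[OF that] \<mu>m m by (cases "y \<in> ball x1 r") (auto simp: \<mu>_def)
    define q where "q h = \<mu> - G (x2 + h)" for h
    have nb: "x2 + h \<in> ball x1 (2 * r)" if "norm h < r" for h
      using x2b that norm_triangle_ineq[of "x2 - x1" h] by (simp add: dist_norm norm_minus_commute algebra_simps)
    have q0: "0 \<le> q h" if "norm h < r" for h using G\<mu>[OF nb[OF that]] by (simp add: q_def)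
    define \<rho> where "\<rho> = \<eta> * r"
    have \<rho>: "0 < \<rho>" "\<rho> \<le> r" using \<eta> r by (auto simp: \<rho>_def)
    have ax2: "0 \<le> a x2" "a x2 \<le> 2 ^ ?n * m"
    proof -
      have "a x2 = \<mu> + b x2" by (simp add: \<mu>_def G_def)
      then show "0 \<le> a x2" using \<mu>m m b0[of x2] by simp
      show "a x2 \<le> 2 ^ ?n * m" using x2b r by (intro up) auto
    qed
    have ia: "integrable lborel (\<lambda>y. \<bar>a y\<bar>)" unfolding a_def using integrable_mollify[OF z e(1)] by simp
    have iaN: "(\<integral>y. \<bar>a y\<bar> \<partial>lborel) \<le> N" unfolding a_def N_def by (rule integral_abs_mollify_le[OF z e(1)])
    have il: "integrable lborel (\<lambda>h. \<bar>a (x2 + h)\<bar>)" "(\<integral>h. \<bar>a (x2 + h)\<bar> \<partial>lborel) = (\<integral>y. \<bar>a y\<bar> \<partial>lborel)"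
      using integrable_lborel_translate(2)[OF ia, of x2] integral_lborel_translate(2)[OF ia, of x2] by auto
    have gm: "G \<in> borel_measurable borel" using cG by (rule borel_measurable_continuous_onI)
    have ib: "integrable lborel (indicator (ball 0 \<rho>) :: 'a \<Rightarrow> real)"
      by (rule integrable_indicator_ball)
    have iQ: "integrable lborel (\<lambda>h. indicator (ball 0 \<rho>) h * q h)"
    proof (rule Bochner_Integration.integrable_bound)
      show "integrable lborel (\<lambda>h. (\<mu> + \<beta>0) * indicator (ball 0 \<rho>) h + \<bar>a (x2 + h)\<bar>)" using ib il by auto
      show "(\<lambda>h. indicator (ball 0 \<rho>) h * q h) \<in> borel_measurable lborel"
        unfolding q_def measurable_lborel1
        by (intro borel_measurable_times borel_measurable_indicator borel_measurable_diff borel_measurable_const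
          measurable_compose[OF _ gm]) auto
      show "AE h in lborel. norm (indicator (ball 0 \<rho>) h * q h) \<le> norm ((\<mu> + \<beta>0) * indicator (ball 0 \<rho>) h + \<bar>a (x2 + h)\<bar>)"
      proof (rule AE_I2)
        fix h :: 'a
        show "norm (indicator (ball 0 \<rho>) h * q h) \<le> norm ((\<mu> + \<beta>0) * indicator (ball 0 \<rho>) h + \<bar>a (x2 + h)\<bar>)"
        proof (cases "h \<in> ball 0 \<rho>")
          case True
          have "b (x2 + h) \<le> \<beta>0" using \<beta>0 by (simp add: b_def mult_le_cancel_left1)
          then have "q h \<le> \<mu> + \<beta>0 + \<bar>a (x2 + h)\<bar>" by (simp add: q_def G_def)
          moreover have "0 \<le> q h" using True \<rho> by (intro q0) auto
          ultimately show ?thesis using True \<mu>m m \<beta>0 by simp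
        qed simp
      qed
    qed
    \<comment> \<open>The barrier is nonnegative and mu >= m, so the gap is at least m - |a|; what
      |a| takes away is at most its L^1 norm.\<close>
    have Qge: "m * (V * \<rho> ^ ?n) - N \<le> (\<integral>h. indicator (ball 0 \<rho>) h * q h \<partial>lborel)"
    proof -
      have "m * (V * \<rho> ^ ?n) - N \<le> m * measure lborel (ball (0::'a) \<rho>) - (\<integral>h. \<bar>a (x2 + h)\<bar> \<partial>lborel)"
        using iaN il measure_lborel_ball[of \<rho> "0::'a"] \<rho> by (simp add: V_def)
      also have "\<dots> = (\<integral>h. m * indicator (ball 0 \<rho>) h - \<bar>a (x2 + h)\<bar> \<partial>lborel)"
        using ib il by simp
      also have "\<dots> \<le> (\<integral>h. indicator (ball 0 \<rho>) h * q h \<partial>lborel)"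
      proof (rule integral_mono)
        fix h show "m * indicator (ball 0 \<rho>) h - \<bar>a (x2 + h)\<bar> \<le> indicator (ball 0 \<rho>) h * q h"
          using b0[of "x2 + h"] \<mu>m by (cases "h \<in> ball 0 \<rho>") (auto simp: q_def G_def)
      qed (use ib il iQ in auto)
      finally show ?thesis .
    qed
    have d2a: "second_diff a x2 h = q h + q (- h) - \<beta>0 * second_diff (cap x1 r) x2 h" for h
      by (simp add: second_diff_def q_def G_def b_def \<mu>_def algebra_simps)
    have cb0: "0 \<le> ?cb" using bump_const_ge[where 'a='a] by linarith
    have touch: "- (\<beta>0 * ?cb) * K0 TYPE('a) * r powr - (2 * s)
        + 2 * \<rho> powr - (real ?n + 2 * s) * (\<integral>h. indicator (ball 0 \<rho>) h * q h \<partial>lborel)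
        - 2 * r powr - (real ?n + 2 * s) * (\<integral>h. \<bar>a (x2 + h)\<bar> \<partial>lborel) \<le> frac_lap a x2"
    proof (rule frac_lap_touch)
      show "integrable lborel (\<lambda>h. second_diff a x2 h * kern s h)"
        unfolding a_def using z e
        by (intro integrable_second_diff_kern[OF _ second_diff_le_mollify]) auto
      show "- (\<beta>0 * ?cb) * (norm h / r)\<^sup>2 + q h + q (- h) \<le> second_diff a x2 h" if "norm h < r" for h
        using mult_left_mono[OF abs_le_D1[OF second_diff_cap[OF r(1), of x1 x2 h]], of \<beta>0] \<beta>0
        by (simp add: d2a mult.assoc)
      \<comment> \<open>Beyond radius r around x2 only the L^1 norm of a is available, so |a| plays
        the role of l; the central term is dropped because a x2 >= 0.\<close>
      show "- (\<beta>0 * ?cb) - \<bar>a (x2 + h)\<bar> - \<bar>a (x2 + - h)\<bar> \<le> second_diff a x2 h" if "r \<le> norm h" for h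
      proof -
        have "0 \<le> \<beta>0 * ?cb" using \<beta>0 cb0 by simp
        then show ?thesis using ax2(1) by (simp add: second_diff_def)
      qed
    qed (use \<rho> \<beta>0 cb0 q0 iQ il in auto)
    have "N \<le> m * (V * \<rho> ^ ?n) / 2"
    proof -
      have "2 * N * (4 / \<eta>) ^ ?n / V \<le> m * (4 * r) ^ ?n" using S0(3) S mS by linarith
      then have "2 * N * (4 / \<eta>) ^ ?n \<le> m * (4 * r) ^ ?n * V" using V by (simp add: pos_divide_le_eq)
      moreover have "(4 * r) ^ ?n = (4 / \<eta>) ^ ?n * \<rho> ^ ?n"
        using \<eta> by (subst power_mult_distrib[symmetric]) (simp add: \<rho>_def)
      ultimately have "(4 / \<eta>) ^ ?n * (2 * N) \<le> (4 / \<eta>) ^ ?n * (m * (V * \<rho> ^ ?n))" by (simp add: mult_ac)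
      then show ?thesis using \<eta> by (simp add: mult_le_cancel_left_pos)
    qed
    then have "m * (V * \<rho> ^ ?n) / 2 \<le> (\<integral>h. indicator (ball 0 \<rho>) h * q h \<partial>lborel)" using Qge by linarith
    then have "2 * \<rho> powr - (real ?n + 2 * s) * (m * (V * \<rho> ^ ?n) / 2)
       \<le> 2 * \<rho> powr - (real ?n + 2 * s) * (\<integral>h. indicator (ball 0 \<rho>) h * q h \<partial>lborel)"
      by (intro mult_left_mono) auto
    moreover have "2 * \<rho> powr - (real ?n + 2 * s) * (m * (V * \<rho> ^ ?n) / 2) = m * (V * \<eta> powr - (2 * s)) * r powr - (2 * s)"
    proof -
      have "2 * \<rho> powr - (real ?n + 2 * s) * (m * (V * \<rho> ^ ?n) / 2)
         = m * V * (\<rho> powr - (real ?n + 2 * s) * \<rho> ^ ?n)" by simp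
      also have "\<dots> = m * V * \<rho> powr - (2 * s)" using powr_dim_split[OF \<rho>(1), where 'a='a] by simp
      finally show ?thesis using \<eta> r by (simp add: \<rho>_def powr_mult)
    qed
    moreover have "2 * r powr - (real ?n + 2 * s) * (\<integral>h. \<bar>a (x2 + h)\<bar> \<partial>lborel) \<le> 2 * m * r powr - (2 * s)"
    proof -
      have "4 ^ ?n * N \<le> m * (4 * r) ^ ?n" using S0(2) S mS by linarith
      then have "4 ^ ?n * N \<le> 4 ^ ?n * (m * r ^ ?n)" by (simp add: power_mult_distrib mult_ac)
      then have "N \<le> m * r ^ ?n" by (simp add: mult_le_cancel_left_pos)
      then have "(\<integral>h. \<bar>a (x2 + h)\<bar> \<partial>lborel) \<le> m * r ^ ?n" using iaN il by linarith
      then have "2 * r powr - (real ?n + 2 * s) * (\<integral>h. \<bar>a (x2 + h)\<bar> \<partial>lborel) \<le> 2 * r powr - (real ?n + 2 * s) * (m * r ^ ?n)"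
        by (intro mult_left_mono) auto
      also have "\<dots> = 2 * m * (r powr - (real ?n + 2 * s) * r ^ ?n)" by simp
      also have "\<dots> = 2 * m * r powr - (2 * s)" using powr_dim_split[OF r(1), where 'a='a] by simp
      finally show ?thesis .
    qed
    moreover have "frac_lap a x2 \<le> (D + E * 2 ^ ?n) * m * r powr - (2 * s)"
    proof -
      have "norm (x2 - x0) \<le> norm (x2 - x1) + norm (x1 - x0)"
        using norm_triangle_ineq[of "x2 - x1" "x1 - x0"] by simp
      also have "\<dots> < r + (R - 4 * r)"
      proof (rule add_less_le_mono)
        show "norm (x2 - x1) < r" using x2b by (simp add: dist_norm norm_minus_commute)
        have "4 * r = d x1" by (simp add: r_def)
        then show "norm (x1 - x0) \<le> R - 4 * r" by (simp add: d_def)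
      qed
      finally have "x2 \<in> ball x0 R" using r by (simp add: dist_norm norm_minus_commute)
      then have "frac_lap a x2 \<le> D + E * a x2" unfolding a_def using sub[of e x2] e by auto
      also have "\<dots> \<le> D * m + E * (2 ^ ?n * m)"
      proof (intro add_mono mult_left_mono ax2)
        have "(4 * r) ^ ?n \<le> 1" using r by (intro power_le_one) auto
        then have "m * (4 * r) ^ ?n \<le> m * 1" using m by (intro mult_left_mono) auto
        then have "1 \<le> m" using mS S S0 by linarith
        then have "D * 1 \<le> D * m" using DE by (intro mult_left_mono) auto
        then show "D \<le> D * m" by simp
      qed (use DE in auto)
      also have "\<dots> = (D + E * 2 ^ ?n) * m * 1" by (simp add: algebra_simps)
      also have "\<dots> \<le> (D + E * 2 ^ ?n) * m * r powr - (2 * s)"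
      proof -
        have "r powr 0 \<le> r powr - (2 * s)" using r s_pos by (intro powr_mono') auto
        then show ?thesis using DE m r by (intro mult_left_mono) auto
      qed
      finally show ?thesis .
    qed
    moreover have "(2 ^ (?n + 1) * ?cb * K0 TYPE('a) + 2 + D + E * 2 ^ ?n) * (m * r powr - (2 * s))
        < V * \<eta> powr - (2 * s) * (m * r powr - (2 * s))"
      using \<eta>(3) m r by (intro mult_strict_right_mono) auto
    moreover have "(2 ^ (?n + 1) * ?cb * K0 TYPE('a) + 2 + D + E * 2 ^ ?n) * (m * r powr - (2 * s))
        = \<beta>0 * ?cb * K0 TYPE('a) * r powr - (2 * s) + 2 * m * r powr - (2 * s) + (D + E * 2 ^ ?n) * m * r powr - (2 * s)"
      by (simp add: \<beta>0_def algebra_simps)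
    moreover have "V * \<eta> powr - (2 * s) * (m * r powr - (2 * s)) = m * (V * \<eta> powr - (2 * s)) * r powr - (2 * s)"
      by (simp add: mult_ac)
    moreover have "- (\<beta>0 * ?cb) * K0 TYPE('a) * r powr - (2 * s) = - (\<beta>0 * ?cb * K0 TYPE('a) * r powr - (2 * s))"
      by simp
    ultimately show False using touch by linarith
  qed
  have "AE x in lborel. x \<in> ball x0 (R / 2) \<longrightarrow> z x \<le> S0 / (R / 2) ^ ?n"
  proof (rule mollify_limit_le[OF z _ _ R(1)])
    fix e x assume e: "0 < e" "e < R" and x: "x \<in> ball x0 (R / 2)"
    show "mollify e z x \<le> S0 / (R / 2) ^ ?n"
    proof (cases "mollify e z x \<le> 0")
      case True
      have "0 \<le> S0 / (R / 2) ^ ?n" using S0 R by simp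
      then show ?thesis using True by linarith
    next
      case False
      have "(R / 2) ^ ?n * mollify e z x \<le> (R - norm (x - x0)) ^ ?n * mollify e z x"
        using x R False by (intro mult_right_mono power_mono) (auto simp: dist_norm norm_minus_commute)
      also have "\<dots> \<le> S0" using e x R by (intro main) auto
      finally show ?thesis using R by (simp add: field_simps)
    qed
  qed auto
  then show ?thesis by blast
qed

end

section \<open>Kato's inequality and boundedness from below\<close>

text \<open>A smooth, convex, decreasing substitute for twice the negative part: it grows like 2 |t|
  at minus infinity and tends to -1 at plus infinity. Its second derivative is at most 1, so
  composition with f_e stays within \<open>second_diff_le\<close>, which a function with a corner
  would leave. Subtracting 1 makes it vanish at 0 and so preserves integrability.\<close>

definition kato :: "real \<Rightarrow> real" where
  "kato t = sqrt (1 + t\<^sup>2) - t - 1"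

definition kato' :: "real \<Rightarrow> real" where
  "kato' t = t / sqrt (1 + t\<^sup>2) - 1"

lemma abs_le_sqrt_1_plus: "\<bar>t\<bar> \<le> sqrt (1 + t\<^sup>2)"
  by (rule real_le_rsqrt) simp

lemma sqrt_1_plus_ge_1: "1 \<le> sqrt (1 + t\<^sup>2)"
  by (rule real_le_rsqrt) simp

lemma kato'_bounds: "- 2 \<le> kato' t" "kato' t \<le> 0"
proof -
  have s: "0 < sqrt (1 + t\<^sup>2)" using sqrt_1_plus_ge_1[of t] by linarith
  have "t \<le> sqrt (1 + t\<^sup>2)" "- sqrt (1 + t\<^sup>2) \<le> t" using abs_le_sqrt_1_plus[of t] by auto
  then have "t / sqrt (1 + t\<^sup>2) \<le> 1" "- 1 \<le> t / sqrt (1 + t\<^sup>2)"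
    using s by (auto simp: pos_divide_le_eq pos_le_divide_eq)
  then show "- 2 \<le> kato' t" "kato' t \<le> 0" by (simp_all add: kato'_def)
qed

text \<open>Convexity and the bound 1 on the second derivative, obtained algebraically: with A =
  sqrt(1 + a^2) and B = sqrt(1 + b^2) the remainder is (A B - 1 - a b) / A, and (A B)^2 - (1 + a
  b)^2 = (a - b)^2.\<close>

lemma kato_expansion:
  "0 \<le> kato b - kato a - kato' a * (b - a)"
  "kato b - kato a - kato' a * (b - a) \<le> (b - a)\<^sup>2 / 2"
proof -
  define A where "A = sqrt (1 + a\<^sup>2)"
  define B where "B = sqrt (1 + b\<^sup>2)"
  have A: "1 \<le> A" "A\<^sup>2 = 1 + a\<^sup>2" and B: "1 \<le> B" "B\<^sup>2 = 1 + b\<^sup>2"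
    unfolding A_def B_def using sqrt_1_plus_ge_1 by auto
  have e: "kato b - kato a - kato' a * (b - a) = (A * B - 1 - a * b) / A"
  proof -
    have kk: "kato b = B - b - 1" "kato a = A - a - 1" "kato' a = a / A - 1"
      by (simp_all add: kato_def kato'_def A_def B_def)
    show ?thesis unfolding kk using A by (simp add: field_simps power2_eq_square)
  qed
  have "(1 + a * b)\<^sup>2 \<le> (A * B)\<^sup>2"
  proof -
    have "(A * B)\<^sup>2 - (1 + a * b)\<^sup>2 = (a - b)\<^sup>2"
      unfolding power_mult_distrib A(2) B(2) by (simp add: power2_eq_square algebra_simps)
    then show ?thesis by (metis diff_ge_0_iff_ge zero_le_power2)
  qed
  then have "1 + a * b \<le> A * B" using A B by (intro power2_le_imp_le[of "1 + a * b"]) auto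
  then show "0 \<le> kato b - kato a - kato' a * (b - a)" unfolding e using A by simp
  have "2 * (A * B) \<le> A\<^sup>2 + B\<^sup>2" using sum_squares_bound[of A B] by simp
  then have le: "A * B - 1 - a * b \<le> (b - a)\<^sup>2 / 2"
    unfolding A(2) B(2) by (simp add: power2_eq_square algebra_simps)
  have "(A * B - 1 - a * b) / A \<le> (A * B - 1 - a * b) / 1"
    using \<open>1 + a * b \<le> A * B\<close> A by (intro divide_left_mono) auto
  also have "\<dots> \<le> (b - a)\<^sup>2 / 2" unfolding div_by_1 by (rule le)
  finally show "kato b - kato a - kato' a * (b - a) \<le> (b - a)\<^sup>2 / 2"
    unfolding e .
qed

lemma kato_lipschitz: "\<bar>kato a - kato b\<bar> \<le> 2 * \<bar>a - b\<bar>"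
proof -
  have *: "kato x - kato y \<le> 2 * \<bar>x - y\<bar>" for x y
  proof -
    have "kato x - kato y \<le> kato' x * (x - y)" using kato_expansion(1)[where b=y and a=x] by (simp add: algebra_simps)
    also have "\<dots> \<le> \<bar>kato' x\<bar> * \<bar>x - y\<bar>" by (metis abs_ge_self abs_mult)
    also have "\<dots> \<le> 2 * \<bar>x - y\<bar>" using kato'_bounds[of x] by (intro mult_right_mono) auto
    finally show ?thesis .
  qed
  show ?thesis using *[of a b] *[of b a] by (simp add: abs_minus_commute abs_le_iff)
qed

lemma kato_0 [simp]: "kato 0 = 0"
  by (simp add: kato_def)

lemma neg_part_le_kato: "2 * max 0 (- t) \<le> kato t + 1"
  using abs_le_sqrt_1_plus[of t] by (auto simp: kato_def max_def)

lemma kato_measurable [measurable]: "kato \<in> borel_measurable borel"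
  unfolding kato_def[abs_def] by measurable

lemma integrable_kato:
  fixes f :: "'a::euclidean_space \<Rightarrow> real"
  assumes "integrable lborel f"
  shows "integrable lborel (\<lambda>x. kato (f x))"
proof (rule Bochner_Integration.integrable_bound[of _ "\<lambda>x. 2 * f x"])
  show "AE x in lborel. norm (kato (f x)) \<le> norm (2 * f x)"
    using kato_lipschitz[of _ 0] by (intro AE_I2) (auto simp: abs_mult)
qed (use assms in auto)

context frac_order
begin

text \<open>\<open>kato_expansion\<close> at x + h and at x - h: convexity gives the sign in the
  first claim, the quadratic bound the majorant in the second.\<close>

lemma second_diff_kato:
  "second_diff (\<lambda>x. kato (a x)) x h \<le> kato' (a x) * second_diff a x h"
  "\<bar>second_diff (\<lambda>x. kato (a x)) x h\<bar> \<le> 2 * \<bar>second_diff a x h\<bar> + ((a (x + h) - a x)\<^sup>2 + (a (x - h) - a x)\<^sup>2) / 2"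
proof -
  define k1 where "k1 = kato (a (x + h)) - kato (a x) - kato' (a x) * (a (x + h) - a x)"
  define k2 where "k2 = kato (a (x - h)) - kato (a x) - kato' (a x) * (a (x - h) - a x)"
  have k: "0 \<le> k1" "k1 \<le> (a (x + h) - a x)\<^sup>2 / 2" "0 \<le> k2" "k2 \<le> (a (x - h) - a x)\<^sup>2 / 2"
    unfolding k1_def k2_def by (rule kato_expansion)+
  have e: "second_diff (\<lambda>x. kato (a x)) x h = kato' (a x) * second_diff a x h - k1 - k2"
    by (simp add: second_diff_def k1_def k2_def algebra_simps)
  show "second_diff (\<lambda>x. kato (a x)) x h \<le> kato' (a x) * second_diff a x h" unfolding e using k by linarith
  have "\<bar>kato' (a x) * second_diff a x h\<bar> \<le> 2 * \<bar>second_diff a x h\<bar>"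
    unfolding abs_mult using kato'_bounds[of "a x"] by (intro mult_right_mono) auto
  then show "\<bar>second_diff (\<lambda>x. kato (a x)) x h\<bar> \<le> 2 * \<bar>second_diff a x h\<bar> + ((a (x + h) - a x)\<^sup>2 + (a (x - h) - a x)\<^sup>2) / 2"
    unfolding e using k by argo
qed

lemma second_diff_le_kato:
  fixes a :: "'a::euclidean_space \<Rightarrow> real"
  assumes "second_diff_le C a" and B: "\<And>x. \<bar>a x\<bar> \<le> B" and L: "\<And>x y. \<bar>a x - a y\<bar> \<le> L * norm (x - y)"
  shows "second_diff_le (2 * C + (2 * B + \<bar>L\<bar>)\<^sup>2) (\<lambda>x. kato (a x))"
  unfolding second_diff_le_def
proof (intro allI)
  fix x h :: 'a
  let ?M = "2 * B + \<bar>L\<bar>"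
  have B0: "0 \<le> B" using order_trans[OF abs_ge_zero B] .
  have sq: "(a y - a x)\<^sup>2 \<le> ?M\<^sup>2 * min 1 ((norm h)\<^sup>2)" if "norm (y - x) = norm h" for y
  proof -
    have "\<bar>a y - a x\<bar> \<le> 2 * B" using B[of x] B[of y] by linarith
    then have "\<bar>a y - a x\<bar> \<le> \<bar>?M\<bar>" by linarith
    then have 1: "(a y - a x)\<^sup>2 \<le> ?M\<^sup>2" by (simp only: abs_le_square_iff)
    have "\<bar>a y - a x\<bar> \<le> L * norm h" using L[of y x] that by simp
    also have "\<dots> \<le> ?M * norm h" using B0 by (intro mult_right_mono) auto
    also have "\<dots> \<le> \<bar>?M * norm h\<bar>" by simp
    finally have 2: "(a y - a x)\<^sup>2 \<le> (?M * norm h)\<^sup>2" by (simp only: abs_le_square_iff)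
    show ?thesis using 1 2 by (auto simp: min_def power_mult_distrib)
  qed
  have "\<bar>second_diff (\<lambda>x. kato (a x)) x h\<bar> \<le> 2 * \<bar>second_diff a x h\<bar> + ((a (x + h) - a x)\<^sup>2 + (a (x - h) - a x)\<^sup>2) / 2"
    by (rule second_diff_kato)
  also have "\<dots> \<le> 2 * (C * min 1 ((norm h)\<^sup>2)) + (?M\<^sup>2 * min 1 ((norm h)\<^sup>2) + ?M\<^sup>2 * min 1 ((norm h)\<^sup>2)) / 2"
    by (intro add_mono mult_left_mono divide_right_mono second_diff_leD assms(1) sq) auto
  also have "\<dots> = (2 * C + ?M\<^sup>2) * min 1 ((norm h)\<^sup>2)" by (simp add: algebra_simps)
  finally show "\<bar>second_diff (\<lambda>x. kato (a x)) x h\<bar> \<le> (2 * C + ?M\<^sup>2) * min 1 ((norm h)\<^sup>2)" .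
qed

lemma frac_lap_kato_le:
  fixes a :: "'a::euclidean_space \<Rightarrow> real"
  assumes [measurable]: "a \<in> borel_measurable borel" and "second_diff_le C a" "second_diff_le C' (\<lambda>x. kato (a x))"
  shows "frac_lap (\<lambda>x. kato (a x)) x \<le> kato' (a x) * frac_lap a x"
proof -
  have "frac_lap (\<lambda>x. kato (a x)) x \<le> (\<integral>h. kato' (a x) * (second_diff a x h * kern s h) \<partial>lborel)"
    unfolding frac_lap_def
  proof (rule integral_mono)
    show "integrable lborel (\<lambda>h. second_diff (\<lambda>x. kato (a x)) x h * kern s h)"
      by (rule integrable_second_diff_kern[OF _ assms(3)]) simp
    show "integrable lborel (\<lambda>h. kato' (a x) * (second_diff a x h * kern s h))"
      using integrable_second_diff_kern[OF assms(1,2)] by simp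
    fix h
    show "second_diff (\<lambda>x. kato (a x)) x h * kern s h \<le> kato' (a x) * (second_diff a x h * kern s h)"
      using mult_right_mono[OF second_diff_kato(1) kern_nonneg] by (simp add: mult.assoc)
  qed
  then show ?thesis by (simp add: frac_lap_def)
qed

text \<open>The pointwise inequality is available for the smooth f_e only. The operator is moved
  onto phi before e tends to 0, because kato(f_e) converges to kato(f) in L^1 while its second
  differences are not controlled in the limit. The factor 2 on the right is the bound on
  |kato'|.\<close>

lemma kato_inequality:
  fixes f \<phi> :: "'a::euclidean_space \<Rightarrow> real"
  assumes f: "integrable lborel f" and R: "0 < R" and C: "0 \<le> C" "0 \<le> C0"
    and super: "\<And>e x. 0 < e \<Longrightarrow> e \<le> R \<Longrightarrow> x \<in> ball x0 R \<Longrightarrow>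
       - C - C0 * mollify e (\<lambda>y. max 0 (- f y)) x \<le> frac_lap (mollify e f) x"
    and \<phi>: "integrable lborel \<phi>" "second_diff_le C\<phi> \<phi>" "\<And>x. 0 \<le> \<phi> x" "\<And>x. \<phi> x \<le> B"
      "\<And>x. x \<notin> ball x0 R \<Longrightarrow> \<phi> x = 0"
  shows "(\<integral>x. kato (f x) * frac_lap \<phi> x \<partial>lborel) \<le> (\<integral>x. \<phi> x * (2 * C + 2 * C0 * max 0 (- f x)) \<partial>lborel)"
proof (rule field_le_epsilon)
  fix d :: real assume d: "0 < d"
  define fn where "fn y = max 0 (- f y)" for y
  have fn: "integrable lborel fn" "\<And>y. 0 \<le> fn y" unfolding fn_def using f by auto
  have [measurable]: "f \<in> borel_measurable borel" "\<phi> \<in> borel_measurable borel" "fn \<in> borel_measurable borel"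
    using f \<phi> fn by auto
  \<comment> \<open>Dominates the coefficients of the two convergence errors, for f and for its
    negative part, so that accuracy d / Q in each adds up to at most d.\<close>
  define Q where "Q = 2 * \<bar>C\<phi> * K0 TYPE('a)\<bar> + 2 * C0 * \<bar>B\<bar> + 1"
  have Q: "0 < Q" using C by (simp add: Q_def add_nonneg_pos)
  obtain \<eta>1 where \<eta>1: "\<eta>1 > 0" "\<And>e. 0 < e \<and> e < \<eta>1 \<Longrightarrow> (\<integral>x. \<bar>mollify e f x - f x\<bar> \<partial>lborel) \<le> d / Q"
    using mollify_L1_close[OF f, of "d / Q"] d Q by auto
  obtain \<eta>2 where \<eta>2: "\<eta>2 > 0" "\<And>e. 0 < e \<and> e < \<eta>2 \<Longrightarrow> (\<integral>x. \<bar>mollify e fn x - fn x\<bar> \<partial>lborel) \<le> d / Q"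
    using mollify_L1_close[OF fn(1), of "d / Q"] d Q by auto
  define e where "e = min R (min \<eta>1 \<eta>2) / 2"
  have e: "0 < e" "e \<le> R" "e < \<eta>1" "e < \<eta>2" using R \<eta>1 \<eta>2 by (auto simp: e_def)
  define a where "a = mollify e f"
  have am[measurable]: "a \<in> borel_measurable borel" unfolding a_def by (rule mollify_measurable[OF f e(1)])
  have ia: "integrable lborel a" unfolding a_def by (rule integrable_mollify[OF f e(1)])
  define b where "b = mollify e fn"
  have ib: "integrable lborel b" unfolding b_def by (rule integrable_mollify[OF fn(1) e(1)])
  have b0: "0 \<le> b x" for x unfolding b_def using fn e by (intro mollify_ge) auto
  have sa: "second_diff_le (moll_const TYPE('a) e * (\<integral>y. \<bar>f y\<bar> \<partial>lborel)) a"
    unfolding a_def by (rule second_diff_le_mollify[OF f e(1)])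
  note sj = second_diff_le_kato[OF sa, unfolded a_def, OF abs_mollify_le[OF f e(1)] mollify_lipschitz[OF f e(1)],
      folded a_def]
  have fb: "\<bar>frac_lap \<phi> x\<bar> \<le> \<bar>C\<phi> * K0 TYPE('a)\<bar>" for x
    using abs_frac_lap_le[OF _ \<phi>(2), of x] by (auto intro: order_trans[OF _ abs_ge_self])
  have ij: "integrable lborel (\<lambda>x. kato (a x))" by (rule integrable_kato[OF ia])
  have ijf: "integrable lborel (\<lambda>x. kato (f x))" by (rule integrable_kato[OF f])
  have \<phi>B: "\<bar>\<phi> x\<bar> \<le> \<bar>B\<bar>" for x using \<phi>(3,4)[of x] by linarith
  have i\<phi>b: "integrable lborel (\<lambda>x. \<phi> x * b x)"
    using integrable_mult_bounded[where g=\<phi>, OF ib _ \<phi>B] by (simp add: mult.commute)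
  have i\<phi>fn: "integrable lborel (\<lambda>x. \<phi> x * fn x)"
    using integrable_mult_bounded[where g=\<phi>, OF fn(1) _ \<phi>B] by (simp add: mult.commute)
  have 1: "(\<integral>x. kato (f x) * frac_lap \<phi> x \<partial>lborel) - (\<integral>x. kato (a x) * frac_lap \<phi> x \<partial>lborel)
      \<le> 2 * \<bar>C\<phi> * K0 TYPE('a)\<bar> * (d / Q)"
  proof -
    have i1: "integrable lborel (\<lambda>x. kato (f x) * frac_lap \<phi> x)" "integrable lborel (\<lambda>x. kato (a x) * frac_lap \<phi> x)"
      by (rule integrable_mult_bounded[OF ijf _ fb] integrable_mult_bounded[OF ij _ fb]; simp)+
    have "(\<integral>x. kato (f x) * frac_lap \<phi> x \<partial>lborel) - (\<integral>x. kato (a x) * frac_lap \<phi> x \<partial>lborel)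
      = (\<integral>x. kato (f x) * frac_lap \<phi> x - kato (a x) * frac_lap \<phi> x \<partial>lborel)" using i1 by simp
    also have "\<dots> \<le> (\<integral>x. 2 * \<bar>C\<phi> * K0 TYPE('a)\<bar> * \<bar>a x - f x\<bar> \<partial>lborel)"
    proof (rule integral_mono)
      fix x
      have "kato (f x) * frac_lap \<phi> x - kato (a x) * frac_lap \<phi> x \<le> \<bar>kato (f x) - kato (a x)\<bar> * \<bar>frac_lap \<phi> x\<bar>"
        by (metis abs_ge_self abs_mult left_diff_distrib)
      also have "\<dots> \<le> (2 * \<bar>f x - a x\<bar>) * \<bar>C\<phi> * K0 TYPE('a)\<bar>"
        by (intro mult_mono kato_lipschitz fb) auto
      finally show "kato (f x) * frac_lap \<phi> x - kato (a x) * frac_lap \<phi> x \<le> 2 * \<bar>C\<phi> * K0 TYPE('a)\<bar> * \<bar>a x - f x\<bar>"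
        by (simp add: mult_ac abs_minus_commute)
    qed (use i1 ia f in auto)
    also have "\<dots> \<le> 2 * \<bar>C\<phi> * K0 TYPE('a)\<bar> * (d / Q)"
      using mult_left_mono[OF \<eta>1(2)[of e], of "2 * \<bar>C\<phi> * K0 TYPE('a)\<bar>"] e by (simp add: a_def)
    finally show ?thesis .
  qed
  have 2: "(\<integral>x. kato (a x) * frac_lap \<phi> x \<partial>lborel) \<le> (\<integral>x. \<phi> x * (2 * C + 2 * C0 * b x) \<partial>lborel)"
  proof -
    have "(\<integral>x. kato (a x) * frac_lap \<phi> x \<partial>lborel) = (\<integral>x. \<phi> x * frac_lap (\<lambda>x. kato (a x)) x \<partial>lborel)"
      by (rule frac_lap_self_adjoint[OF ij sj \<phi>(1,2) \<phi>B])
    also have "\<dots> \<le> (\<integral>x. \<phi> x * (2 * C + 2 * C0 * b x) \<partial>lborel)"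
    proof (rule integral_mono)
      show "integrable lborel (\<lambda>x. \<phi> x * frac_lap (\<lambda>x. kato (a x)) x)"
        by (rule integrable_mult_bounded[OF \<phi>(1) _ abs_frac_lap_le[OF _ sj]]) auto
      have "integrable lborel (\<lambda>x. \<phi> x * (2 * C) + 2 * C0 * (\<phi> x * b x))" using \<phi>(1) i\<phi>b by auto
      then show "integrable lborel (\<lambda>x. \<phi> x * (2 * C + 2 * C0 * b x))" by (simp add: algebra_simps)
      fix x
      show "\<phi> x * frac_lap (\<lambda>x. kato (a x)) x \<le> \<phi> x * (2 * C + 2 * C0 * b x)"
      proof (cases "x \<in> ball x0 R")
        case True
        have s: "- (C + C0 * b x) \<le> frac_lap a x"
          using super[of e x] True e by (simp add: a_def b_def fn_def[abs_def])
        have "frac_lap (\<lambda>x. kato (a x)) x \<le> kato' (a x) * frac_lap a x" by (rule frac_lap_kato_le[OF am sa sj])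
        also have "\<dots> \<le> kato' (a x) * - (C + C0 * b x)"
          using s kato'_bounds[of "a x"] by (intro mult_left_mono_neg) auto
        also have "\<dots> = - kato' (a x) * (C + C0 * b x)" by (simp add: algebra_simps)
        also have "\<dots> \<le> 2 * (C + C0 * b x)"
          using kato'_bounds[of "a x"] C b0[of x] by (intro mult_right_mono) auto
        finally show ?thesis using \<phi>(3)[of x] by (intro mult_left_mono) auto
      qed (use \<phi>(5) in simp)
    qed
    finally show ?thesis .
  qed
  have 3: "(\<integral>x. \<phi> x * (2 * C + 2 * C0 * b x) \<partial>lborel) - (\<integral>x. \<phi> x * (2 * C + 2 * C0 * fn x) \<partial>lborel)
      \<le> 2 * C0 * \<bar>B\<bar> * (d / Q)"
  proof -
    have "(\<integral>x. \<phi> x * (2 * C + 2 * C0 * b x) \<partial>lborel) - (\<integral>x. \<phi> x * (2 * C + 2 * C0 * fn x) \<partial>lborel)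
      = 2 * C0 * (\<integral>x. \<phi> x * b x - \<phi> x * fn x \<partial>lborel)"
    proof -
      have eqs: "(\<integral>x. \<phi> x * (2 * C + 2 * C0 * b x) \<partial>lborel) = (\<integral>x. 2 * C * \<phi> x + 2 * C0 * (\<phi> x * b x) \<partial>lborel)"
        "(\<integral>x. \<phi> x * (2 * C + 2 * C0 * fn x) \<partial>lborel) = (\<integral>x. 2 * C * \<phi> x + 2 * C0 * (\<phi> x * fn x) \<partial>lborel)"
        by (simp_all add: algebra_simps)
      show ?thesis unfolding eqs using \<phi>(1) i\<phi>b i\<phi>fn by (simp add: right_diff_distrib)
    qed
    also have "(\<integral>x. \<phi> x * b x - \<phi> x * fn x \<partial>lborel) \<le> (\<integral>x. \<bar>B\<bar> * \<bar>b x - fn x\<bar> \<partial>lborel)"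
    proof (rule integral_mono)
      fix x
      have "\<phi> x * b x - \<phi> x * fn x \<le> \<bar>\<phi> x\<bar> * \<bar>b x - fn x\<bar>"
        by (metis abs_ge_self abs_mult right_diff_distrib)
      also have "\<dots> \<le> \<bar>B\<bar> * \<bar>b x - fn x\<bar>" using \<phi>B by (intro mult_right_mono) auto
      finally show "\<phi> x * b x - \<phi> x * fn x \<le> \<bar>B\<bar> * \<bar>b x - fn x\<bar>" .
    qed (use i\<phi>b i\<phi>fn ib fn in auto)
    also have "\<dots> \<le> \<bar>B\<bar> * (d / Q)"
      using mult_left_mono[OF \<eta>2(2)[of e], of "\<bar>B\<bar>"] e by (simp add: b_def)
    finally show ?thesis using C by (simp add: mult.assoc mult_left_mono)
  qed
  have "2 * \<bar>C\<phi> * K0 TYPE('a)\<bar> * (d / Q) + 2 * C0 * \<bar>B\<bar> * (d / Q) \<le> Q * (d / Q)"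
    unfolding distrib_right[symmetric] using d Q by (intro mult_right_mono) (auto simp: Q_def)
  also have "\<dots> = d" using Q by simp
  finally show "(\<integral>x. kato (f x) * frac_lap \<phi> x \<partial>lborel) \<le> (\<integral>x. \<phi> x * (2 * C + 2 * C0 * max 0 (- f x)) \<partial>lborel) + d"
    using 1 2 3 unfolding fn_def by linarith
qed

text \<open>Kato's inequality tested with a mollifier is a pointwise inequality for the convolution
  of z = kato(f), and 2 f^- <= z + 1 turns its zero order term into one in z. An upper bound on z is
  a lower bound on f. The radius is halved once for the support of the mollifier and once by the
  maximum principle.\<close>

lemma supersolution_bounded_below:
  fixes f :: "'a::euclidean_space \<Rightarrow> real"
  assumes f: "integrable lborel f" and R: "0 < R" "R \<le> 1" and C: "0 \<le> C" "0 \<le> C0"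
    and super: "\<And>e x. 0 < e \<Longrightarrow> e \<le> R \<Longrightarrow> x \<in> ball x0 R \<Longrightarrow>
       - C - C0 * mollify e (\<lambda>y. max 0 (- f y)) x \<le> frac_lap (mollify e f) x"
  shows "\<exists>M. AE x in lborel. x \<in> ball x0 (R / 4) \<longrightarrow> - M \<le> f x"
proof -
  define z where "z x = kato (f x)" for x
  have z: "integrable lborel z" unfolding z_def by (rule integrable_kato[OF f])
  have "\<exists>M. AE x in lborel. x \<in> ball x0 ((R / 2) / 2) \<longrightarrow> z x \<le> M"
  proof (rule local_maximum_principle[OF z, where D="2 * C + C0" and E=C0])
    fix e x assume e: "0 < e" "e < R / 2" and x: "x \<in> ball x0 (R / 2)"
    define \<phi> where "\<phi> y = moll e (x - y)" for y
    have i\<phi>: "integrable lborel \<phi>" unfolding \<phi>_def by (rule integrable_moll_shift[OF e(1)])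
    have "second_diff \<phi> y h = second_diff (moll e) (x - y) h" for y h
      by (simp add: \<phi>_def second_diff_def algebra_simps)
    then have s\<phi>: "second_diff_le (moll_const TYPE('a) e) \<phi>"
      using second_diff_le_moll[OF e(1), where 'a='a] by (simp add: second_diff_le_def)
    have "(\<integral>y. kato (f y) * frac_lap \<phi> y \<partial>lborel) \<le> (\<integral>y. \<phi> y * (2 * C + 2 * C0 * max 0 (- f y)) \<partial>lborel)"
    proof (rule kato_inequality[OF f R(1) C super i\<phi> s\<phi>])
      show "0 \<le> \<phi> y" for y using e by (simp add: \<phi>_def)
      show "\<phi> y \<le> moll_const TYPE('a) e" for y unfolding \<phi>_def by (rule moll_le[OF e(1)])
      show "\<phi> y = 0" if "y \<notin> ball x0 R" for y
        unfolding \<phi>_def using that x e dist_triangle[of x0 y x]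
        by (intro moll_eq_0) (auto simp: dist_norm)
    qed
    also have "\<dots> \<le> (\<integral>y. (2 * C + C0) * \<phi> y + C0 * (z y * moll e (x - y)) \<partial>lborel)"
    proof (rule integral_mono)
      have fn: "integrable lborel (\<lambda>y. max 0 (- f y))" using f by auto
      have "integrable lborel (\<lambda>y. 2 * C * \<phi> y + 2 * C0 * (max 0 (- f y) * moll e (x - y)))"
        using i\<phi> integrable_mollify_integrand[OF fn e(1), of x] by auto
      then show "integrable lborel (\<lambda>y. \<phi> y * (2 * C + 2 * C0 * max 0 (- f y)))"
        by (simp add: algebra_simps \<phi>_def)
      show "integrable lborel (\<lambda>y. (2 * C + C0) * \<phi> y + C0 * (z y * moll e (x - y)))"
        using i\<phi> integrable_mollify_integrand[OF z e(1), of x] by auto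
      fix y
      have "C0 * (2 * max 0 (- f y)) \<le> C0 * (z y + 1)"
        using neg_part_le_kato[of "f y"] C unfolding z_def by (intro mult_left_mono) auto
      then have "\<phi> y * (2 * C + 2 * C0 * max 0 (- f y)) \<le> \<phi> y * (2 * C + C0 * (z y + 1))"
        using e by (intro mult_left_mono) (auto simp: \<phi>_def)
      then show "\<phi> y * (2 * C + 2 * C0 * max 0 (- f y)) \<le> (2 * C + C0) * \<phi> y + C0 * (z y * moll e (x - y))"
        by (simp add: \<phi>_def algebra_simps)
    qed
    also have "\<dots> = (2 * C + C0) * (\<integral>y. \<phi> y \<partial>lborel) + C0 * mollify e z x"
      using i\<phi> integrable_mollify_integrand[OF z e(1), of x] by (simp add: mollify_def)
    also have "(\<integral>y. \<phi> y \<partial>lborel) = 1" unfolding \<phi>_def by (rule integral_moll_shift[OF e(1)])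
    also have "(\<integral>y. kato (f y) * frac_lap \<phi> y \<partial>lborel) = frac_lap (mollify e z) x"
      unfolding frac_lap_mollify[OF z e(1)] \<phi>_def frac_lap_moll_reflect z_def ..
    finally show "frac_lap (mollify e z) x \<le> 2 * C + C0 + C0 * mollify e z x" by simp
  qed (use R C in auto)
  then obtain M where "AE x in lborel. x \<in> ball x0 (R / 4) \<longrightarrow> z x \<le> M" by auto
  then have "AE x in lborel. x \<in> ball x0 (R / 4) \<longrightarrow> - ((M + 1) / 2) \<le> f x"
  proof eventually_elim
    case (elim x)
    show ?case
    proof
      assume "x \<in> ball x0 (R / 4)"
      then have "kato (f x) \<le> M" using elim by (simp add: z_def)
      moreover have "- f x \<le> max 0 (- f x)" by simp
      ultimately have "2 * - f x \<le> M + 1" using neg_part_le_kato[of "f x"] by linarith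
      then show "- ((M + 1) / 2) \<le> f x" by (simp add: field_simps)
    qed
  qed
  then show ?thesis by blast
qed

end

section \<open>Localization of the regional form\<close>

lemma integrable_pair_convolution:
  fixes g h :: "'a::euclidean_space \<Rightarrow> real"
  assumes g: "integrable lborel g" and h: "integrable lborel h"
  shows "integrable (lborel \<Otimes>\<^sub>M lborel) (\<lambda>(x, y). g x * h (x - y))"
    and "integrable (lborel \<Otimes>\<^sub>M lborel) (\<lambda>(x, y). g y * h (x - y))"
proof -
  have *: "integrable (lborel \<Otimes>\<^sub>M lborel) (\<lambda>(x, y). g x * k (x - y))"
    if k: "integrable lborel k" for k :: "'a \<Rightarrow> real"
  proof (rule lborel_pair.Fubini_integrable)
    have [measurable]: "g \<in> borel_measurable borel" "k \<in> borel_measurable borel" using g k by auto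
    show "(\<lambda>(x, y). g x * k (x - y)) \<in> borel_measurable (lborel \<Otimes>\<^sub>M lborel)" by measurable
    have "integrable lborel (\<lambda>y. \<bar>k y\<bar>)" using k by auto
    note k' = this
    have "(\<integral>y. norm (g x * k (x - y)) \<partial>lborel) = \<bar>g x\<bar> * (\<integral>y. \<bar>k y\<bar> \<partial>lborel)" for x
      using integral_lborel_translate(4)[OF k', of x] by (simp add: abs_mult)
    then show "integrable lborel (\<lambda>x. \<integral>y. norm (case (x, y) of (x, y) \<Rightarrow> g x * k (x - y)) \<partial>lborel)"
      using g by simp
    show "AE x in lborel. integrable lborel (\<lambda>y. case (x, y) of (x, y) \<Rightarrow> g x * k (x - y))"
      using integrable_lborel_translate(4)[OF k] by simp
  qed
  show "integrable (lborel \<Otimes>\<^sub>M lborel) (\<lambda>(x, y). g x * h (x - y))" by (rule *[OF h])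
  have "integrable lborel (\<lambda>y. h (- y))" using integrable_lborel_translate(4)[OF h, of 0] by simp
  from lborel_pair.integrable_product_swap[OF *[OF this]]
  show "integrable (lborel \<Otimes>\<^sub>M lborel) (\<lambda>(x, y). g y * h (x - y))" by (simp add: case_prod_beta')
qed

text \<open>Taking h as the outer variable makes the kernel a constant factor in the inner
  integral.\<close>

lemma integral_pair_shear:
  fixes J :: "'a::euclidean_space \<Rightarrow> 'a \<Rightarrow> real"
  assumes J: "integrable (lborel \<Otimes>\<^sub>M lborel) (case_prod J)"
  shows "integrable (lborel \<Otimes>\<^sub>M lborel) (\<lambda>(x, h). J x (x + h))"
    and "(\<integral>z. case_prod J z \<partial>(lborel \<Otimes>\<^sub>M lborel)) = (\<integral>h. \<integral>x. J x (x + h) \<partial>lborel \<partial>lborel)"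
proof -
  have Jm: "case_prod J \<in> borel_measurable (lborel \<Otimes>\<^sub>M lborel)" using J by auto
  have Jm'[measurable]: "(\<lambda>(x, h). J x (x + h)) \<in> borel_measurable (lborel \<Otimes>\<^sub>M lborel)"
  proof -
    have "(\<lambda>z. (fst z, fst z + snd z)) \<in> lborel \<Otimes>\<^sub>M lborel \<rightarrow>\<^sub>M (lborel \<Otimes>\<^sub>M lborel :: ('a \<times> 'a) measure)"
      by measurable
    from measurable_compose[OF this Jm] show ?thesis by (simp add: case_prod_beta')
  qed
  have ae: "AE x in lborel. integrable lborel (J x)"
    using lborel_pair.AE_integrable_fst'[OF J] by simp
  show i: "integrable (lborel \<Otimes>\<^sub>M lborel) (\<lambda>(x, h). J x (x + h))"
  proof (rule lborel_pair.Fubini_integrable)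
    have "integrable lborel (\<lambda>x. \<integral>y. norm (J x y) \<partial>lborel)"
      using lborel_pair.integrable_fst'[OF integrable_norm[OF J]] by simp
    then show "integrable lborel (\<lambda>x. \<integral>h. norm (case (x, h) of (x, h) \<Rightarrow> J x (x + h)) \<partial>lborel)"
    proof (rule integrable_cong_AE[THEN iffD1, rotated -1])
      show "AE x in lborel. (\<integral>y. norm (J x y) \<partial>lborel) = (\<integral>h. norm (case (x, h) of (x, h) \<Rightarrow> J x (x + h)) \<partial>lborel)"
        using ae
      proof eventually_elim
        case (elim x)
        from integral_lborel_translate(2)[OF integrable_norm[OF elim], of x] show ?case by simp
      qed
    qed (use Jm Jm' in \<open>auto intro!: lborel.borel_measurable_lebesgue_integral simp: case_prod_beta'\<close>)
    show "AE x in lborel. integrable lborel (\<lambda>h. case (x, h) of (x, h) \<Rightarrow> J x (x + h))"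
      using ae by eventually_elim (use integrable_lborel_translate(2) in auto)
  qed fact
  have "(\<integral>z. case_prod J z \<partial>(lborel \<Otimes>\<^sub>M lborel)) = (\<integral>x. \<integral>y. J x y \<partial>lborel \<partial>lborel)"
    using lborel_pair.integral_fst'[OF J] by simp
  also have "\<dots> = (\<integral>x. \<integral>h. J x (x + h) \<partial>lborel \<partial>lborel)"
  proof (rule integral_cong_AE)
    show "AE x in lborel. (\<integral>y. J x y \<partial>lborel) = (\<integral>h. J x (x + h) \<partial>lborel)"
      using ae by eventually_elim (simp add: integral_lborel_translate(2))
  qed (use Jm Jm' in \<open>auto intro!: lborel.borel_measurable_lebesgue_integral simp: case_prod_beta'\<close>)
  also have "\<dots> = (\<integral>h. \<integral>x. J x (x + h) \<partial>lborel \<partial>lborel)"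
    by (rule lborel_pair.Fubini_integral[OF i, symmetric])
  finally show "(\<integral>z. case_prod J z \<partial>(lborel \<Otimes>\<^sub>M lborel)) = (\<integral>h. \<integral>x. J x (x + h) \<partial>lborel \<partial>lborel)" .
qed

context frac_order
begin

lemma gagliardo_pairing_eq:
  fixes f \<phi> :: "'a::euclidean_space \<Rightarrow> real"
  assumes f: "integrable lborel f" and [measurable]: "\<phi> \<in> borel_measurable borel"
    and B: "\<And>x. \<bar>\<phi> x\<bar> \<le> B" and sd: "second_diff_le C \<phi>"
    and J: "integrable (lborel \<Otimes>\<^sub>M lborel) (\<lambda>(x, y). (f x - f y) * (\<phi> x - \<phi> y) * kern s (x - y))"
  shows "(\<integral>(x, y). (f x - f y) * (\<phi> x - \<phi> y) * kern s (x - y) \<partial>(lborel \<Otimes>\<^sub>M lborel))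
    = (\<integral>x. f x * frac_lap \<phi> x \<partial>lborel)"
proof -
  have [measurable]: "f \<in> borel_measurable borel" using f by auto
  have i: "integrable lborel (\<lambda>x. f (x + a) * \<phi> (x + b))" for a b
    using B by (intro integrable_mult_bounded[where C=B] integrable_lborel_translate f) auto
  have h: "(\<integral>x. (f x - f (x + h)) * (\<phi> x - \<phi> (x + h)) * kern s (x - (x + h)) \<partial>lborel)
     = (\<integral>x. f x * (second_diff \<phi> x h * kern s h) \<partial>lborel)" for h
  proof -
    have "(\<integral>x. (f x - f (x + h)) * (\<phi> x - \<phi> (x + h)) \<partial>lborel)
      = (\<integral>x. f (x + 0) * \<phi> (x + 0) - f (x + 0) * \<phi> (x + h) - f (x + h) * \<phi> (x + 0) + f (x + h) * \<phi> (x + h) \<partial>lborel)"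
      by (simp add: algebra_simps)
    also have "\<dots> = (\<integral>x. f (x + 0) * \<phi> (x + 0) \<partial>lborel) - (\<integral>x. f (x + 0) * \<phi> (x + h) \<partial>lborel)
       - (\<integral>x. f (x + h) * \<phi> (x + 0) \<partial>lborel) + (\<integral>x. f (x + h) * \<phi> (x + h) \<partial>lborel)"
      using i[of 0 0] i[of 0 h] i[of h 0] i[of h h] by simp
    also have "(\<integral>x. f (x + h) * \<phi> (x + h) \<partial>lborel) = (\<integral>x. f (x + 0) * \<phi> (x + 0) \<partial>lborel)"
      using integral_lborel_translate(1)[OF i[of 0 0], of h] by simp
    also have "(\<integral>x. f (x + h) * \<phi> (x + 0) \<partial>lborel) = (\<integral>x. f (x + 0) * \<phi> (x + - h) \<partial>lborel)"
      using integral_lborel_translate(1)[OF i[of 0 "-h"], of h] by simp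
    also have "(\<integral>x. f (x + 0) * \<phi> (x + 0) \<partial>lborel) - (\<integral>x. f (x + 0) * \<phi> (x + h) \<partial>lborel)
       - (\<integral>x. f (x + 0) * \<phi> (x + - h) \<partial>lborel) + (\<integral>x. f (x + 0) * \<phi> (x + 0) \<partial>lborel)
      = (\<integral>x. 2 * (f (x + 0) * \<phi> (x + 0)) - f (x + 0) * \<phi> (x + h) - f (x + 0) * \<phi> (x + - h) \<partial>lborel)"
      using i[of 0 0] i[of 0 h] i[of 0 "-h"] by simp
    also have "\<dots> = (\<integral>x. f x * second_diff \<phi> x h \<partial>lborel)"
      by (simp add: second_diff_def algebra_simps)
    finally have "(\<integral>x. (f x - f (x + h)) * (\<phi> x - \<phi> (x + h)) \<partial>lborel) = (\<integral>x. f x * second_diff \<phi> x h \<partial>lborel)" .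
    then show ?thesis by (simp add: mult.assoc[symmetric])
  qed
  have i2: "integrable (lborel \<Otimes>\<^sub>M lborel) (\<lambda>(x, h). f x * (second_diff \<phi> x h * kern s h))"
    using second_diff_leD[OF sd] by (intro integrable_pair_mult_kern f) (auto simp: case_prod_beta')
  have "(\<integral>(x, y). (f x - f y) * (\<phi> x - \<phi> y) * kern s (x - y) \<partial>(lborel \<Otimes>\<^sub>M lborel))
    = (\<integral>h. \<integral>x. f x * (second_diff \<phi> x h * kern s h) \<partial>lborel \<partial>lborel)"
    using integral_pair_shear(2)[OF J] unfolding h .
  also have "\<dots> = (\<integral>x. \<integral>h. f x * (second_diff \<phi> x h * kern s h) \<partial>lborel \<partial>lborel)"
    by (rule lborel_pair.Fubini_integral[OF i2])
  finally show ?thesis by (simp add: frac_lap_def)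
qed

text \<open>The constant c is subtracted from u0, so it must be integrable against the weight over
  the possibly unbounded set U - B.\<close>

lemma integrable_weight: "integrable lborel (\<lambda>y::'a::euclidean_space. 1 / (1 + norm y powr (real DIM('a) + 2 * s)))"
proof (rule Bochner_Integration.integrable_bound)
  have "integrable lborel (indicator (ball 0 1) :: 'a \<Rightarrow> real)"
    by (rule integrable_indicator_ball)
  then show "integrable lborel (\<lambda>y::'a. indicator (ball 0 1) y + wkern 1 y)"
    using integrable_wkern[of 1] by auto
  show "AE y in lborel. norm (1 / (1 + norm (y::'a) powr (real DIM('a) + 2 * s))) \<le> norm (indicator (ball 0 1) y + wkern 1 y)"
  proof (rule AE_I2)
    fix y :: 'a
    have pos: "0 < 1 + norm y powr (real DIM('a) + 2 * s)" by (simp add: add_pos_nonneg)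
    show "norm (1 / (1 + norm y powr (real DIM('a) + 2 * s))) \<le> norm (indicator (ball 0 1) y + wkern 1 y)"
    proof (cases "norm y < 1")
      case True
      have "1 / (1 + norm y powr (real DIM('a) + 2 * s)) \<le> 1" using pos by (simp add: divide_le_eq_1)
      moreover have "0 \<le> wkern 1 y" by simp
      ultimately have "1 / (1 + norm y powr (real DIM('a) + 2 * s)) \<le> 1 + wkern 1 y" by linarith
      then show ?thesis using True pos by (simp add: abs_of_nonneg)
    next
      case False
      then have "wkern 1 y = kern s y" by (intro wkern_far) auto
      moreover have "1 / (1 + norm y powr (real DIM('a) + 2 * s)) \<le> kern s y"
      proof -
        have "0 < norm y" using False by linarith
        then show ?thesis unfolding kern_def using pos by (intro divide_left_mono mult_pos_pos) auto
      qed
      ultimately show ?thesis using False pos by simp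
    qed
  qed
qed simp

text \<open>For these x and y the distance |x - y| is at least 2 R and also at least a fixed
  multiple of |y|, so the kernel is controlled by the weight of the integrability hypothesis,
  uniformly in x.\<close>

lemma kern_le_weight:
  fixes x0 :: "'a::euclidean_space"
  assumes R: "0 < R"
  obtains A where "0 \<le> A" "\<And>x y. x \<in> ball x0 (2 * R) \<Longrightarrow> y \<notin> ball x0 (4 * R) \<Longrightarrow>
    kern s (x - y) \<le> A / (1 + norm y powr (real DIM('a) + 2 * s))"
proof -
  define p where "p = real DIM('a) + 2 * s"
  have p: "0 < p" using s_pos by (simp add: p_def add_pos_pos)
  define X where "X = 1 + (norm x0 + 2 * R) / (2 * R)"
  have X: "0 < X" using R by (simp add: X_def add_pos_nonneg)
  define A where "A = X powr p + (1 / (2 * R)) powr p"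
  show ?thesis
  proof
    show "0 \<le> A" by (simp add: A_def)
    fix x y assume x: "x \<in> ball x0 (2 * R)" and y: "y \<notin> ball x0 (4 * R)"
    have d: "2 * R \<le> norm (x - y)" using x y dist_triangle[of x0 y x] by (simp add: dist_norm)
    have nx: "norm x \<le> norm x0 + 2 * R"
      using x norm_triangle_ineq[of x0 "x - x0"] by (simp add: dist_norm norm_minus_commute)
    have "norm y \<le> norm (x - y) + norm x" using norm_triangle_ineq4[of x "x - y"] by simp
    also have "\<dots> \<le> norm (x - y) + (norm x0 + 2 * R) / (2 * R) * norm (x - y)"
    proof -
      have "norm x0 + 2 * R = (norm x0 + 2 * R) / (2 * R) * (2 * R)" using R by simp
      also have "\<dots> \<le> (norm x0 + 2 * R) / (2 * R) * norm (x - y)" using d R by (intro mult_left_mono) auto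
      finally show ?thesis using nx by linarith
    qed
    also have "\<dots> = X * norm (x - y)" by (simp add: X_def algebra_simps)
    finally have "norm y powr p \<le> (X * norm (x - y)) powr p" using p by (intro powr_mono2) auto
    also have "\<dots> = X powr p * norm (x - y) powr p" using X by (simp add: powr_mult)
    finally have 1: "norm y powr p \<le> X powr p * norm (x - y) powr p" .
    have "1 = 1 powr p" by simp
    also have "\<dots> \<le> (1 / (2 * R) * norm (x - y)) powr p" using d R p by (intro powr_mono2) (auto simp: field_simps)
    also have "\<dots> = (1 / (2 * R)) powr p * norm (x - y) powr p" using R by (simp only: powr_mult)
    finally have "1 + norm y powr p \<le> A * norm (x - y) powr p" using 1 unfolding A_def distrib_right by linarith
    moreover have "0 < norm (x - y) powr p" using d R by auto
    moreover have "0 < 1 + norm y powr p" by (simp add: add_pos_nonneg)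
    ultimately show "kern s (x - y) \<le> A / (1 + norm y powr (real DIM('a) + 2 * s))"
      unfolding kern_def p_def[symmetric] by (simp add: field_simps)
  qed
qed

end

text \<open>
  A function on \<open>U\<close> is split as \<open>u0 - c = f + (u0 - c) 1\<^bsub>U - B\<^esub>\<close> with \<open>f\<close> supported in the ball \<open>B\<close>,
  so that the regional form tested with functions supported well inside \<open>B\<close> becomes the form of the whole space
  applied to the integrable function \<open>f\<close>, plus terms of order zero.
\<close>

locale localized = frac_order s for s :: real +
  fixes U :: "'a::euclidean_space set" and u0 :: "'a \<Rightarrow> real" and x0 :: 'a and R c :: real
  assumes U[measurable]: "U \<in> sets borel" and u0[measurable]: "u0 \<in> borel_measurable borel"
    and R: "0 < R" and BU: "ball x0 (4 * R) \<subseteq> U"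
    and weighted: "integrable lborel (\<lambda>y. indicator U y * (u0 y / (1 + norm y powr (real DIM('a) + 2 * s))))"
    and local_L1: "integrable lborel (\<lambda>x. indicator (ball x0 (4 * R)) x * u0 x)"
    and gagliardo: "integrable (lborel \<Otimes>\<^sub>M lborel)
      (\<lambda>(x, y). indicator (ball x0 (4 * R)) x * indicator (ball x0 (4 * R)) y * ((u0 x - u0 y)\<^sup>2 * kern s (x - y)))"
begin

abbreviation "B \<equiv> ball x0 (4 * R)"

definition f :: "'a \<Rightarrow> real" where
  "f x = indicator B x * (u0 x - c)"

text \<open>The discrepancy between the two forms: in the whole space f(x) interacts with the
  complement of U, which the regional form omits, and the regional form contains the values of u0 -
  c on U - B, which were cut out of f.\<close>

definition m :: "'a \<Rightarrow> 'a \<Rightarrow> real" where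
  "m x y = (f x * indicator (- U) y + (u0 y - c) * indicator (U - B) y) * kern s (x - y)"

lemma B_measurable [measurable]: "B \<in> sets borel"
  by simp

lemma f_measurable [measurable]: "f \<in> borel_measurable borel"
  unfolding f_def by measurable

lemma integrable_f: "integrable lborel f"
proof -
  have "integrable lborel (indicator B :: 'a \<Rightarrow> real)"
    by (rule integrable_indicator_ball)
  then have "integrable lborel (\<lambda>x. indicator B x * u0 x - c * indicator B x)" using local_L1 by auto
  then show ?thesis by (simp add: f_def[abs_def] algebra_simps)
qed

definition Kx :: "'a \<Rightarrow> real" where
  "Kx x = (\<integral>y. indicator (- U) y * kern s (x - y) \<partial>lborel)"

text \<open>The radii are nested for this: mollifiers of radius at most R centred in the R-ball live
  in the 2R-ball, so the correction terms never meet the singularity of the kernel.\<close>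

lemma far_from_B: "x \<in> ball x0 (2 * R) \<Longrightarrow> y \<notin> B \<Longrightarrow> 2 * R \<le> norm (x - y)"
  using dist_triangle[of x0 y x] by (simp add: dist_norm)

lemma tail_wkern:
  assumes "x \<in> ball x0 (2 * R)"
  shows "indicator (- U) y * kern s (x - y) \<le> wkern R (x - y)"
proof (cases "y \<in> U")
  case False
  then have "R \<le> norm (x - y)" using far_from_B[OF assms, of y] BU R by force
  then show ?thesis using False wkern_far[OF R, of "x - y"] by simp
qed simp

lemma Kx_bounds:
  assumes x: "x \<in> ball x0 (2 * R)"
  shows "integrable lborel (\<lambda>y. indicator (- U) y * kern s (x - y))"
    and "0 \<le> Kx x" and "Kx x \<le> K0 TYPE('a) * R powr - (2 * s)"
proof -
  have iw: "integrable lborel (\<lambda>y. wkern R (x - y))"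
    using integrable_lborel_translate(4)[OF integrable_wkern[OF R, where 'a='a], of x] .
  show i: "integrable lborel (\<lambda>y. indicator (- U) y * kern s (x - y))"
    by (rule Bochner_Integration.integrable_bound[OF iw])
       (use tail_wkern[OF x] in \<open>auto simp: abs_mult\<close>)
  show "0 \<le> Kx x" by (simp add: Kx_def)
  have "Kx x \<le> (\<integral>y. wkern R (x - y) \<partial>lborel)"
    unfolding Kx_def using i iw tail_wkern[OF x] by (intro integral_mono) auto
  then show "Kx x \<le> K0 TYPE('a) * R powr - (2 * s)"
    using integral_lborel_translate(4)[OF integrable_wkern[OF R, where 'a='a], of x] integral_wkern[OF R, where 'a='a] by simp
qed

text \<open>The majorant does not depend on x. This gives both a uniform bound on the outer term and
  joint integrability in \<open>integrable_m\<close>.\<close>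

lemma outer_bound:
  obtains W where "integrable lborel W" "\<And>y. 0 \<le> W y"
    "\<And>x y. x \<in> ball x0 (2 * R) \<Longrightarrow> \<bar>(u0 y - c) * indicator (U - B) y * kern s (x - y)\<bar> \<le> W y"
proof -
  obtain A where A: "0 \<le> A" "\<And>x y. x \<in> ball x0 (2 * R) \<Longrightarrow> y \<notin> B \<Longrightarrow>
    kern s (x - y) \<le> A / (1 + norm y powr (real DIM('a) + 2 * s))"
    using kern_le_weight[OF R, of x0] by blast
  let ?w = "\<lambda>y::'a. 1 / (1 + norm y powr (real DIM('a) + 2 * s))"
  define W where "W y = A * (\<bar>indicator U y * (u0 y / (1 + norm y powr (real DIM('a) + 2 * s)))\<bar> + \<bar>c\<bar> * ?w y)" for y
  have w0: "0 \<le> ?w y" for y by (simp add: add_nonneg_nonneg)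
  show ?thesis
  proof
    show "integrable lborel W" unfolding W_def
      by (intro integrable_mult_right Bochner_Integration.integrable_add integrable_abs weighted integrable_weight)
    show "0 \<le> W y" for y unfolding W_def using A(1) w0[of y]
      by (intro mult_nonneg_nonneg add_nonneg_nonneg) auto
    fix x y assume x: "x \<in> ball x0 (2 * R)"
    show "\<bar>(u0 y - c) * indicator (U - B) y * kern s (x - y)\<bar> \<le> W y"
    proof (cases "y \<in> U - B")
      case True
      have "\<bar>(u0 y - c) * indicator (U - B) y * kern s (x - y)\<bar> = \<bar>u0 y - c\<bar> * kern s (x - y)"
        using True by (simp add: abs_mult)
      also have "\<dots> \<le> (\<bar>u0 y\<bar> + \<bar>c\<bar>) * (A * ?w y)"
        using A(2)[OF x, of y] True by (intro mult_mono) auto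
      also have "\<dots> = A * (\<bar>u0 y\<bar> * ?w y + \<bar>c\<bar> * ?w y)" by (simp add: algebra_simps add_divide_distrib)
      also have "\<bar>u0 y\<bar> * ?w y = \<bar>indicator U y * (u0 y / (1 + norm y powr (real DIM('a) + 2 * s)))\<bar>"
        using True by (simp add: abs_divide add_nonneg_nonneg)
      finally show ?thesis unfolding W_def .
    next
      case False
      then have "\<bar>(u0 y - c) * indicator (U - B) y * kern s (x - y)\<bar> = 0" by auto
      also have "\<dots> \<le> W y" unfolding W_def using A(1) w0[of y]
        by (intro mult_nonneg_nonneg add_nonneg_nonneg) auto
      finally show ?thesis .
    qed
  qed
qed

lemma integrable_outer:
  assumes x: "x \<in> ball x0 (2 * R)"
  shows "integrable lborel (\<lambda>y. (u0 y - c) * indicator (U - B) y * kern s (x - y))"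
proof -
  obtain W where W: "integrable lborel W" "\<And>y. 0 \<le> W y"
    "\<And>x y. x \<in> ball x0 (2 * R) \<Longrightarrow> \<bar>(u0 y - c) * indicator (U - B) y * kern s (x - y)\<bar> \<le> W y"
    using outer_bound by blast
  show ?thesis
    by (rule Bochner_Integration.integrable_bound[OF W(1)]) (use W(2,3) x in auto)
qed

lemma outer_lower_bound:
  obtains C where "0 \<le> C"
    "\<And>x. x \<in> ball x0 (2 * R) \<Longrightarrow> - C \<le> (\<integral>y. (u0 y - c) * indicator (U - B) y * kern s (x - y) \<partial>lborel)"
proof -
  obtain W where W: "integrable lborel W" "\<And>y. 0 \<le> W y"
    "\<And>x y. x \<in> ball x0 (2 * R) \<Longrightarrow> \<bar>(u0 y - c) * indicator (U - B) y * kern s (x - y)\<bar> \<le> W y"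
    using outer_bound by blast
  show ?thesis
  proof (rule that[of "\<integral>y. W y \<partial>lborel"])
    fix x assume x: "x \<in> ball x0 (2 * R)"
    have "(\<integral>y. - W y \<partial>lborel) \<le> (\<integral>y. (u0 y - c) * indicator (U - B) y * kern s (x - y) \<partial>lborel)"
      using W(1) integrable_outer[OF x] W(3)[OF x] by (intro integral_mono) (auto simp: abs_le_iff minus_le_iff)
    then show "- (\<integral>y. W y \<partial>lborel) \<le> (\<integral>y. (u0 y - c) * indicator (U - B) y * kern s (x - y) \<partial>lborel)" by simp
  qed (use W(2) in simp)
qed

lemma integral_m:
  assumes x: "x \<in> ball x0 (2 * R)"
  shows "(\<integral>y. m x y \<partial>lborel) = f x * Kx x + (\<integral>y. (u0 y - c) * indicator (U - B) y * kern s (x - y) \<partial>lborel)"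
proof -
  have "(\<integral>y. m x y \<partial>lborel) = (\<integral>y. f x * (indicator (- U) y * kern s (x - y)) + (u0 y - c) * indicator (U - B) y * kern s (x - y) \<partial>lborel)"
    by (simp add: m_def algebra_simps)
  also have "\<dots> = f x * Kx x + (\<integral>y. (u0 y - c) * indicator (U - B) y * kern s (x - y) \<partial>lborel)"
    using Kx_bounds(1)[OF x] integrable_outer[OF x] by (simp add: Kx_def)
  finally show ?thesis .
qed

context
  fixes \<phi> :: "'a \<Rightarrow> real" and L P :: real
  assumes \<phi>m[measurable]: "\<phi> \<in> borel_measurable borel" and \<phi>: "\<And>x. 0 \<le> \<phi> x" "\<And>x. \<phi> x \<le> P"
    and \<phi>L: "\<And>x y. \<bar>\<phi> x - \<phi> y\<bar> \<le> L * norm (x - y)"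
    and \<phi>0: "\<And>x. x \<notin> ball x0 (2 * R) \<Longrightarrow> \<phi> x = 0"
begin

text \<open>For |x - y| < R with a point in the 2R-ball, both points lie in B, and 2|ab| <= a^2 +
  b^2 splits the integrand into the local energy of u0 and a Lipschitz term. With neither point in
  the 2R-ball phi vanishes at both. For |x - y| >= R the L^1 norm of f against
  \<open>wkern R\<close> suffices.\<close>

lemma integrable_whole_space_form:
  "integrable (lborel \<Otimes>\<^sub>M lborel) (\<lambda>(x, y). (f x - f y) * (\<phi> x - \<phi> y) * kern s (x - y))"
proof (rule Bochner_Integration.integrable_bound)
  let ?g = "\<lambda>x. L\<^sup>2 * R\<^sup>2 * indicator (ball x0 (3 * R)) x + P * \<bar>f x\<bar>"
  let ?D = "\<lambda>(x, y). (indicator B x * indicator B y * ((u0 x - u0 y)\<^sup>2 * kern s (x - y)) + ?g x * wkern R (x - y))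
      + P * \<bar>f y\<bar> * wkern R (x - y)"
  have ib: "integrable lborel (indicator (ball x0 (3 * R)) :: 'a \<Rightarrow> real)"
    by (rule integrable_indicator_ball)
  have ig: "integrable lborel ?g" using ib integrable_f by auto
  have if': "integrable lborel (\<lambda>y. P * \<bar>f y\<bar>)" using integrable_f by auto
  have P0: "0 \<le> P" using order_trans[OF \<phi>(1) \<phi>(2)] .
  show "integrable (lborel \<Otimes>\<^sub>M lborel) ?D"
    using Bochner_Integration.integrable_add[OF Bochner_Integration.integrable_add[OF gagliardo
        integrable_pair_convolution(1)[OF ig integrable_wkern[OF R]]]
        integrable_pair_convolution(2)[OF if' integrable_wkern[OF R]]]
    by (simp add: case_prod_beta')
  show "(\<lambda>(x, y). (f x - f y) * (\<phi> x - \<phi> y) * kern s (x - y)) \<in> borel_measurable (lborel \<Otimes>\<^sub>M lborel)"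
    unfolding case_prod_beta' by measurable
  show "AE z in lborel \<Otimes>\<^sub>M lborel. norm (case z of (x, y) \<Rightarrow> (f x - f y) * (\<phi> x - \<phi> y) * kern s (x - y)) \<le> norm (?D z)"
  proof (rule AE_I2, clarify)
    fix x y :: 'a
    let ?G = "indicator B x * indicator B y * ((u0 x - u0 y)\<^sup>2 * kern s (x - y))"
    have absE: "\<bar>(f x - f y) * (\<phi> x - \<phi> y) * kern s (x - y)\<bar> = \<bar>f x - f y\<bar> * \<bar>\<phi> x - \<phi> y\<bar> * kern s (x - y)"
      by (simp add: abs_mult)
    have G0: "0 \<le> ?G" by simp
    have g0: "0 \<le> ?g x * wkern R (x - y)" using P0 by simp
    have f0: "0 \<le> P * \<bar>f y\<bar> * wkern R (x - y)" using P0 by simp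
    have "\<bar>(f x - f y) * (\<phi> x - \<phi> y) * kern s (x - y)\<bar> \<le> ?G + ?g x * wkern R (x - y) + P * \<bar>f y\<bar> * wkern R (x - y)"
    proof (cases "norm (x - y) < R")
      case True
      show ?thesis
      proof (cases "x \<in> ball x0 (2 * R) \<or> y \<in> ball x0 (2 * R)")
        case in2: True
        then have x3: "x \<in> ball x0 (3 * R)" and y3: "y \<in> ball x0 (3 * R)"
          using True dist_triangle[of x0 x y] dist_triangle[of x0 y x] by (auto simp: dist_norm norm_minus_commute)
        then have xB: "x \<in> B" "y \<in> B" using R by auto
        have fe: "f x - f y = u0 x - u0 y" using xB by (simp add: f_def)
        have "\<bar>f x - f y\<bar> * \<bar>\<phi> x - \<phi> y\<bar> \<le> (u0 x - u0 y)\<^sup>2 + (\<phi> x - \<phi> y)\<^sup>2"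
        proof -
          have "2 * \<bar>f x - f y\<bar> * \<bar>\<phi> x - \<phi> y\<bar> \<le> (u0 x - u0 y)\<^sup>2 + (\<phi> x - \<phi> y)\<^sup>2"
            using sum_squares_bound[of "\<bar>f x - f y\<bar>" "\<bar>\<phi> x - \<phi> y\<bar>"] by (simp add: fe)
          moreover have "0 \<le> \<bar>f x - f y\<bar> * \<bar>\<phi> x - \<phi> y\<bar>" by simp
          ultimately show ?thesis by linarith
        qed
        also have "(\<phi> x - \<phi> y)\<^sup>2 \<le> L\<^sup>2 * R\<^sup>2 * (norm (x - y) / R)\<^sup>2"
        proof -
          have "\<bar>\<phi> x - \<phi> y\<bar>\<^sup>2 \<le> (L * norm (x - y))\<^sup>2" using \<phi>L[of x y] by (intro power_mono) auto
          then show ?thesis using R by (simp add: power_mult_distrib power_divide)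
        qed
        finally have "\<bar>f x - f y\<bar> * \<bar>\<phi> x - \<phi> y\<bar> * kern s (x - y)
          \<le> ((u0 x - u0 y)\<^sup>2 + L\<^sup>2 * R\<^sup>2 * (norm (x - y) / R)\<^sup>2) * kern s (x - y)"
          by (intro mult_right_mono) auto
        also have "\<dots> = ?G + L\<^sup>2 * R\<^sup>2 * indicator (ball x0 (3 * R)) x * wkern R (x - y)"
          using xB x3 wkern_near[OF R, of "x - y"] True by (simp add: algebra_simps)
        also have "\<dots> \<le> ?G + ?g x * wkern R (x - y)"
          using P0 by (intro add_left_mono mult_right_mono) auto
        finally show ?thesis unfolding absE using f0 by linarith
      next
        case False
        then have "\<phi> x = 0" "\<phi> y = 0" using \<phi>0 by auto
        then show ?thesis using G0 g0 f0 by simp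
      qed
    next
      case False
      then have w: "wkern R (x - y) = kern s (x - y)" using wkern_far[OF R, of "x - y"] by simp
      have "\<bar>\<phi> x - \<phi> y\<bar> \<le> P" using \<phi>(1)[of x] \<phi>(1)[of y] \<phi>(2)[of x] \<phi>(2)[of y] by linarith
      then have "\<bar>f x - f y\<bar> * \<bar>\<phi> x - \<phi> y\<bar> * kern s (x - y) \<le> (\<bar>f x\<bar> + \<bar>f y\<bar>) * P * kern s (x - y)"
        by (intro mult_right_mono mult_mono) auto
      also have "\<dots> = P * \<bar>f x\<bar> * wkern R (x - y) + P * \<bar>f y\<bar> * wkern R (x - y)"
        by (simp add: w algebra_simps)
      also have "\<dots> \<le> ?g x * wkern R (x - y) + P * \<bar>f y\<bar> * wkern R (x - y)"
        by (intro add_right_mono mult_right_mono) auto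
      finally show ?thesis unfolding absE using G0 by linarith
    qed
    then show "norm ((f x - f y) * (\<phi> x - \<phi> y) * kern s (x - y)) \<le> norm (?G + ?g x * wkern R (x - y) + P * \<bar>f y\<bar> * wkern R (x - y))"
      using G0 g0 f0 by simp
  qed
qed

lemma integrable_m: "integrable (lborel \<Otimes>\<^sub>M lborel) (\<lambda>(x, y). \<phi> x * m x y)"
proof -
  obtain W where W: "integrable lborel W" "\<And>y. 0 \<le> W y"
    "\<And>x y. x \<in> ball x0 (2 * R) \<Longrightarrow> \<bar>(u0 y - c) * indicator (U - B) y * kern s (x - y)\<bar> \<le> W y"
    using outer_bound by blast
  have P0: "0 \<le> P" using order_trans[OF \<phi>(1) \<phi>(2)] .
  have if': "integrable lborel (\<lambda>y. P * \<bar>f y\<bar>)" using integrable_f by auto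
  have ib: "integrable lborel (\<lambda>x. P * indicator (ball x0 (2 * R)) x :: real)"
    by (intro integrable_mult_right integrable_indicator_ball)
  show ?thesis
  proof (rule Bochner_Integration.integrable_bound)
    show "integrable (lborel \<Otimes>\<^sub>M lborel) (\<lambda>(x, y). P * \<bar>f x\<bar> * wkern R (x - y) + P * indicator (ball x0 (2 * R)) x * W y)"
      using Bochner_Integration.integrable_add[OF integrable_pair_convolution(1)[OF if' integrable_wkern[OF R]]
        integrable_pair_mult[OF ib W(1)]] by (simp add: case_prod_beta')
    show "(\<lambda>(x, y). \<phi> x * m x y) \<in> borel_measurable (lborel \<Otimes>\<^sub>M lborel)"
      unfolding case_prod_beta' m_def by measurable
    show "AE z in lborel \<Otimes>\<^sub>M lborel. norm (case z of (x, y) \<Rightarrow> \<phi> x * m x y)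
      \<le> norm (case z of (x, y) \<Rightarrow> P * \<bar>f x\<bar> * wkern R (x - y) + P * indicator (ball x0 (2 * R)) x * W y)"
    proof (rule AE_I2, clarify)
      fix x y :: 'a
      show "norm (\<phi> x * m x y) \<le> norm (P * \<bar>f x\<bar> * wkern R (x - y) + P * indicator (ball x0 (2 * R)) x * W y)"
      proof (cases "x \<in> ball x0 (2 * R)")
        case True
        have "\<bar>m x y\<bar> \<le> \<bar>f x * (indicator (- U) y * kern s (x - y))\<bar> + \<bar>(u0 y - c) * indicator (U - B) y * kern s (x - y)\<bar>"
          unfolding m_def by (simp add: distrib_right mult.assoc)
        also have "\<dots> \<le> \<bar>f x\<bar> * wkern R (x - y) + W y"
          using tail_wkern[OF True, of y] W(3)[OF True, of y]
          by (intro add_mono) (auto simp: abs_mult intro!: mult_left_mono)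
        finally have "\<phi> x * \<bar>m x y\<bar> \<le> P * (\<bar>f x\<bar> * wkern R (x - y) + W y)"
          using \<phi>[of x] P0 by (intro mult_mono) auto
        then show ?thesis using True \<phi>(1)[of x] by (simp add: abs_mult algebra_simps)
      qed (use \<phi>0 P0 in simp)
    qed
  qed
qed

text \<open>A pointwise identity, checked by the position of x and y relative to B and U. The two
  corrections are mirror images, whence the factor 2 in \<open>regional_form_eq\<close>.\<close>

lemma regional_form_decomposition:
  "indicator U x * indicator U y * ((u0 x - u0 y) * (\<phi> x - \<phi> y) * kern s (x - y)) =
   (f x - f y) * (\<phi> x - \<phi> y) * kern s (x - y) - \<phi> x * m x y - \<phi> y * m y x"
proof -
  have B2: "x \<in> ball x0 (2 * R) \<Longrightarrow> x \<in> B" for x using R by auto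
  have \<phi>B: "x \<notin> B \<Longrightarrow> \<phi> x = 0" for x using \<phi>0[of x] B2[of x] by blast
  consider "x \<in> B" "y \<in> B" | "x \<in> B" "y \<notin> B" | "x \<notin> B" "y \<in> B" | "x \<notin> B" "y \<notin> B" by blast
  then show ?thesis
  proof cases
    case 1
    then have "x \<in> U" "y \<in> U" using BU by auto
    with 1 show ?thesis by (simp add: f_def m_def)
  next
    case 2
    then have "x \<in> U" "\<phi> y = 0" using BU \<phi>B by auto
    with 2 show ?thesis by (cases "y \<in> U") (simp_all add: f_def m_def kern_commute[of s y x] algebra_simps)
  next
    case 3
    then have "y \<in> U" "\<phi> x = 0" using BU \<phi>B by auto
    with 3 show ?thesis by (cases "x \<in> U") (simp_all add: f_def m_def kern_commute[of s y x] algebra_simps)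
  next
    case 4
    then show ?thesis using \<phi>B by simp
  qed
qed

lemma regional_form_eq:
  assumes sd: "second_diff_le C \<phi>"
  shows "(\<integral>(x, y). indicator U x * indicator U y * ((u0 x - u0 y) * (\<phi> x - \<phi> y) * kern s (x - y)) \<partial>(lborel \<Otimes>\<^sub>M lborel))
     = (\<integral>x. f x * frac_lap \<phi> x \<partial>lborel) - 2 * (\<integral>x. \<phi> x * (\<integral>y. m x y \<partial>lborel) \<partial>lborel)"
proof -
  note iJ = integrable_whole_space_form and im = integrable_m
  have ims: "integrable (lborel \<Otimes>\<^sub>M lborel) (\<lambda>(x, y). \<phi> y * m y x)"
    using lborel_pair.integrable_product_swap[OF im] by (simp add: case_prod_beta')
  have eq: "(\<lambda>(x, y). indicator U x * indicator U y * ((u0 x - u0 y) * (\<phi> x - \<phi> y) * kern s (x - y)))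
    = (\<lambda>z. (case z of (x, y) \<Rightarrow> (f x - f y) * (\<phi> x - \<phi> y) * kern s (x - y)) - (case z of (x, y) \<Rightarrow> \<phi> x * m x y)
        - (case z of (x, y) \<Rightarrow> \<phi> y * m y x))"
    by (rule ext) (simp add: case_prod_beta' regional_form_decomposition)
  have swap: "(\<integral>(x, y). \<phi> y * m y x \<partial>(lborel \<Otimes>\<^sub>M lborel)) = (\<integral>(x, y). \<phi> x * m x y \<partial>(lborel \<Otimes>\<^sub>M lborel))"
    using lborel_pair.integral_product_swap[of "\<lambda>(x, y). \<phi> x * m x y"] im by (simp add: case_prod_beta')
  have fst: "(\<integral>(x, y). \<phi> x * m x y \<partial>(lborel \<Otimes>\<^sub>M lborel)) = (\<integral>x. \<phi> x * (\<integral>y. m x y \<partial>lborel) \<partial>lborel)"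
    using lborel_pair.integral_fst'[OF im] by simp
  have \<phi>P: "\<bar>\<phi> x\<bar> \<le> P" for x using \<phi>[of x] by simp
  show ?thesis
    unfolding eq
    by (subst Bochner_Integration.integral_diff[OF Bochner_Integration.integrable_diff[OF iJ im] ims],
        subst Bochner_Integration.integral_diff[OF iJ im],
        subst gagliardo_pairing_eq[OF integrable_f \<phi>m \<phi>P sd iJ]) (use swap fst in simp)
qed

end

text \<open>The inequality for f in convolved form. As f has no sign yet, the term f Kx is bounded
  below by its negative part with Kx replaced by its upper bound.\<close>

lemma frac_lap_mollify_ge:
  assumes e: "0 < e" "e \<le> R" and x': "x' \<in> ball x0 R"
    and nonneg: "0 \<le> (\<integral>(x, y). indicator U x * indicator U y *
        ((u0 x - u0 y) * (moll e (x' - x) - moll e (x' - y)) * kern s (x - y)) \<partial>(lborel \<Otimes>\<^sub>M lborel))"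
    and outer: "\<And>x. x \<in> ball x0 (2 * R) \<Longrightarrow> c1 \<le> (\<integral>y. (u0 y - c) * indicator (U - B) y * kern s (x - y) \<partial>lborel)"
  shows "2 * (c1 - K0 TYPE('a) * R powr - (2 * s) * mollify e (\<lambda>y. max 0 (- f y)) x') \<le> frac_lap (mollify e f) x'"
proof -
  define \<phi> where "\<phi> y = moll e (x' - y)" for y
  let ?L = "moll_const TYPE('a) e"
  let ?K = "K0 TYPE('a) * R powr - (2 * s)"
  have \<phi>m[measurable]: "\<phi> \<in> borel_measurable borel" unfolding \<phi>_def by measurable
  have \<phi>: "0 \<le> \<phi> x" "\<phi> x \<le> ?L" for x using e moll_le[OF e(1)] by (auto simp: \<phi>_def)
  have \<phi>L: "\<bar>\<phi> x - \<phi> y\<bar> \<le> ?L * norm (x - y)" for x y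
    using moll_lipschitz[OF e(1), of "x' - x" "x' - y"] by (simp add: \<phi>_def norm_minus_commute)
  have \<phi>0: "\<phi> x = 0" if "x \<notin> ball x0 (2 * R)" for x
    unfolding \<phi>_def using that x' e dist_triangle[of x0 x x'] by (intro moll_eq_0) (auto simp: dist_norm)
  have "second_diff \<phi> y h = second_diff (moll e) (x' - y) h" for y h
    by (simp add: \<phi>_def second_diff_def algebra_simps)
  then have sd: "second_diff_le ?L \<phi>"
    using second_diff_le_moll[OF e(1), where 'a='a] by (simp add: second_diff_le_def)
  have i\<phi>: "integrable lborel \<phi>" unfolding \<phi>_def by (rule integrable_moll_shift[OF e(1)])
  note eq = regional_form_eq[OF \<phi>m \<phi> \<phi>L \<phi>0 sd]
  note im = integrable_m[OF \<phi>m \<phi> \<phi>L \<phi>0]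
  have fn: "integrable lborel (\<lambda>y. max 0 (- f y))" using integrable_f by auto
  note ifn = integrable_mollify_integrand[OF fn e(1), of x', folded \<phi>_def]
  have "c1 - ?K * mollify e (\<lambda>y. max 0 (- f y)) x' = (\<integral>x. c1 * \<phi> x - ?K * (max 0 (- f x) * \<phi> x) \<partial>lborel)"
  proof -
    have "(\<integral>x. \<phi> x \<partial>lborel) = 1" unfolding \<phi>_def by (rule integral_moll_shift[OF e(1)])
    moreover have "mollify e (\<lambda>y. max 0 (- f y)) x' = (\<integral>x. max 0 (- f x) * \<phi> x \<partial>lborel)"
      by (simp add: mollify_def \<phi>_def)
    ultimately show ?thesis using i\<phi> ifn by simp
  qed
  also have "\<dots> \<le> (\<integral>x. \<phi> x * (\<integral>y. m x y \<partial>lborel) \<partial>lborel)"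
  proof (rule integral_mono)
    show "integrable lborel (\<lambda>x. c1 * \<phi> x - ?K * (max 0 (- f x) * \<phi> x))" using i\<phi> ifn by auto
    show "integrable lborel (\<lambda>x. \<phi> x * (\<integral>y. m x y \<partial>lborel))"
      using lborel_pair.integrable_fst'[OF im] by simp
    fix x
    show "c1 * \<phi> x - ?K * (max 0 (- f x) * \<phi> x) \<le> \<phi> x * (\<integral>y. m x y \<partial>lborel)"
    proof (cases "x \<in> ball x0 (2 * R)")
      case True
      have "- (?K * max 0 (- f x)) \<le> f x * Kx x"
      proof -
        have "- f x * Kx x \<le> max 0 (- f x) * Kx x" using Kx_bounds(2)[OF True] by (intro mult_right_mono) auto
        also have "\<dots> \<le> max 0 (- f x) * ?K" using Kx_bounds(3)[OF True] by (intro mult_left_mono) auto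
        finally show ?thesis by (simp add: mult.commute)
      qed
      then have "c1 - ?K * max 0 (- f x) \<le> (\<integral>y. m x y \<partial>lborel)"
        using outer[OF True] unfolding integral_m[OF True] by linarith
      then have "\<phi> x * (c1 - ?K * max 0 (- f x)) \<le> \<phi> x * (\<integral>y. m x y \<partial>lborel)"
        using \<phi>(1)[of x] by (rule mult_left_mono)
      then show ?thesis by (simp add: algebra_simps)
    qed (simp add: \<phi>0)
  qed
  also have "2 * \<dots> \<le> (\<integral>x. f x * frac_lap \<phi> x \<partial>lborel)"
    using nonneg eq unfolding \<phi>_def by simp
  also have "(\<integral>x. f x * frac_lap \<phi> x \<partial>lborel) = frac_lap (mollify e f) x'"
    unfolding frac_lap_mollify[OF integrable_f e(1)] \<phi>_def frac_lap_moll_reflect ..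
  finally show ?thesis by simp
qed

end

section \<open>Regional supersolutions\<close>

lemma moll_ge_near:
  fixes x :: "'a::euclidean_space"
  assumes e: "0 < e" and x: "norm x < e / 2"
  shows "exp (- 4 / 3) / ((\<integral>x. bump (x::'a) \<partial>lborel) * e ^ DIM('a)) \<le> moll e x"
proof -
  let ?t = "1 - (x /\<^sub>R e) \<bullet> (x /\<^sub>R e)"
  have "norm (x /\<^sub>R e) < 1 / 2" using x e by (simp add: norm_scaleR_inverse pos_divide_less_eq del: norm_scaleR)
  then have "norm (x /\<^sub>R e) * norm (x /\<^sub>R e) \<le> 1 / 2 * (1 / 2)" by (intro mult_mono) auto
  then have t: "3 / 4 \<le> ?t" by (simp only: dot_square_norm power2_eq_square)
  then have "1 / ?t \<le> 1 / (3 / 4)" by (intro divide_left_mono) auto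
  then have "exp (- 4 / 3) \<le> exp (- 1 / ?t)" by simp
  also have "\<dots> = bump (x /\<^sub>R e)" using t unfolding bump_def expinv_def by simp
  finally show ?thesis
    unfolding moll_def using integral_bump_pos[where 'a='a] e by (intro divide_right_mono) auto
qed

text \<open>Density zero along some radii tending to 0 is all that a barrier asks for. It follows
  from a.e. convergence of a subsequence of the convolved indicators, because a mollifier of radius
  e is at least a multiple of e^(-n) on the ball of radius e / 2.\<close>

lemma AE_density_point:
  fixes A :: "'a::euclidean_space set"
  assumes A[measurable]: "A \<in> sets borel" and fin: "emeasure lborel A < \<infinity>"
  shows "AE x in lborel. x \<notin> A \<longrightarrow> (\<forall>\<gamma>>0. \<forall>r1>0. \<exists>r. 0 < r \<and> r \<le> r1 \<and>
     measure lborel (A \<inter> ball x (3 * r)) \<le> \<gamma> * r ^ DIM('a))"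
proof -
  define g where "g = (indicator A :: 'a \<Rightarrow> real)"
  have g: "integrable lborel g" unfolding g_def using fin by (intro integrable_real_indicator) auto
  let ?e = "\<lambda>n. 1 / real (Suc n)"
  have L1: "(\<lambda>n. \<integral>x. norm (mollify (?e n) g x - g x) \<partial>lborel) \<longlonglongrightarrow> 0"
  proof (rule LIMSEQ_I)
    fix d :: real assume "0 < d"
    then obtain \<eta> where \<eta>: "\<eta> > 0" "\<And>e. 0 < e \<and> e < \<eta> \<Longrightarrow> (\<integral>x. \<bar>mollify e g x - g x\<bar> \<partial>lborel) \<le> d / 2"
      using mollify_L1_close[OF g, of "d / 2"] by auto
    obtain N where N: "?e N < \<eta>" using nat_approx_posE[OF \<eta>(1)] by blast
    have "norm ((\<integral>x. norm (mollify (?e n) g x - g x) \<partial>lborel) - 0) < d" if "N \<le> n" for n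
    proof -
      have "?e n \<le> ?e N" using that by (intro divide_left_mono) auto
      then have "(\<integral>x. \<bar>mollify (?e n) g x - g x\<bar> \<partial>lborel) \<le> d / 2" using N by (intro \<eta>(2)) auto
      moreover have "0 \<le> (\<integral>x. \<bar>mollify (?e n) g x - g x\<bar> \<partial>lborel)" by simp
      ultimately show ?thesis using \<open>0 < d\<close> by simp
    qed
    then show "\<exists>N. \<forall>n\<ge>N. norm ((\<integral>x. norm (mollify (?e n) g x - g x) \<partial>lborel) - 0) < d" by blast
  qed
  have "integrable lborel (\<lambda>x. mollify (?e n) g x - g x)" for n
    using integrable_mollify[OF g, of "?e n"] g by auto
  from tendsto_L1_AE_subseq[OF this L1] obtain q where q: "strict_mono q"
    "AE x in lborel. (\<lambda>n. mollify (?e (q n)) g x - g x) \<longlonglongrightarrow> 0" by blast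
  define I where "I = (\<integral>x. bump (x::'a) \<partial>lborel)"
  have I: "0 < I" unfolding I_def by (rule integral_bump_pos)
  from q(2) show ?thesis
  proof eventually_elim
    case (elim x)
    show ?case
    proof (intro impI allI)
      fix \<gamma> r1 :: real
      assume x: "x \<notin> A" and \<gamma>: "0 < \<gamma>" and r1: "0 < r1"
      \<comment> \<open>The 6 belongs to the choice r = e / 6, for which 3 r = e / 2.\<close>
      define t where "t = \<gamma> * exp (- 4 / 3) / (I * 6 ^ DIM('a))"
      have t: "0 < t" using \<gamma> I by (simp add: t_def)
      have "(\<lambda>n. mollify (?e (q n)) g x) \<longlonglongrightarrow> 0" using elim x by (simp add: g_def)
      then have ev1: "\<forall>\<^sub>F n in sequentially. mollify (?e (q n)) g x < t" using t by (rule order_tendstoD)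
      obtain N where N: "?e N < r1" using nat_approx_posE[OF r1] by blast
      have ev2: "\<forall>\<^sub>F n in sequentially. N \<le> q n"
        using filterlim_subseq[OF q(1)] by (auto simp: filterlim_at_top)
      from ev1 ev2 have "\<forall>\<^sub>F n in sequentially. mollify (?e (q n)) g x < t \<and> N \<le> q n"
        by eventually_elim simp
      then obtain n where n: "mollify (?e (q n)) g x < t" "N \<le> q n"
        using eventually_happens'[OF sequentially_bot] by blast
      define e where "e = ?e (q n)"
      have e: "0 < e" "e < r1"
      proof -
        show "0 < e" by (simp add: e_def)
        have "e \<le> ?e N" unfolding e_def using n(2) by (intro divide_left_mono) auto
        then show "e < r1" using N by simp
      qed
      let ?c = "exp (- 4 / 3) / (I * e ^ DIM('a))"
      have mb: "A \<inter> ball x (e / 2) \<in> sets borel" by simp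
      have fb: "emeasure lborel (A \<inter> ball x (e / 2)) < \<infinity>"
        by (rule emeasure_bounded_finite) (auto intro: bounded_subset[OF bounded_ball])
      have "?c * measure lborel (A \<inter> ball x (e / 2)) = (\<integral>y. ?c * indicator (A \<inter> ball x (e / 2)) y \<partial>lborel)"
        using mb fb by simp
      also have "\<dots> \<le> mollify e g x" unfolding mollify_def
      proof (rule integral_mono)
        show "integrable lborel (\<lambda>y. ?c * indicator (A \<inter> ball x (e / 2)) y)"
          using mb fb by (intro integrable_mult_right integrable_real_indicator) auto
        show "integrable lborel (\<lambda>y. g y * moll e (x - y))" by (rule integrable_mollify_integrand[OF g e(1)])
        fix y
        show "?c * indicator (A \<inter> ball x (e / 2)) y \<le> g y * moll e (x - y)"
        proof (cases "y \<in> A \<inter> ball x (e / 2)")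
          case True
          then show ?thesis using moll_ge_near[OF e(1), of "x - y"] by (simp add: g_def I_def dist_norm)
        next
          case False
          then show ?thesis using e by (simp add: g_def)
        qed
      qed
      also have "\<dots> \<le> t" using n(1) by (simp add: e_def)
      also have "t = ?c * (\<gamma> * (e / 6) ^ DIM('a))"
        using I e by (simp add: t_def power_divide field_simps)
      finally have "?c * measure lborel (A \<inter> ball x (e / 2)) \<le> ?c * (\<gamma> * (e / 6) ^ DIM('a))" .
      moreover have "0 < ?c" using I e by simp
      ultimately have "measure lborel (A \<inter> ball x (e / 2)) \<le> \<gamma> * (e / 6) ^ DIM('a)"
        by (simp only: mult_le_cancel_left_pos)
      then show "\<exists>r. 0 < r \<and> r \<le> r1 \<and> measure lborel (A \<inter> ball x (3 * r)) \<le> \<gamma> * r ^ DIM('a)"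
        using e by (intro exI[of _ "e / 6"]) auto
    qed
  qed
qed

lemma mollify_cong_AE:
  assumes "AE y in lborel. f y = g y" and [measurable]: "f \<in> borel_measurable borel" "g \<in> borel_measurable borel"
  shows "mollify e f = mollify e g"
  unfolding mollify_def using assms(1) by (intro ext integral_cong_AE) auto

text \<open>The hypotheses restated for a Borel function and \<open>lborel\<close>, so that Fubini
  applies without completions. The weak inequality enters through mollifiers and is stripped of the
  positive constant \<open>frac_const\<close>.\<close>

locale regional_supersolution = frac_order s for s :: real +
  fixes U \<Omega> :: "'a::euclidean_space set" and u0 :: "'a \<Rightarrow> real"
  assumes U[measurable]: "U \<in> sets borel" and u0[measurable]: "u0 \<in> borel_measurable borel"
    and \<Omega>: "open \<Omega>" "\<Omega> \<subseteq> U"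
    and weighted: "integrable lborel (\<lambda>y. indicator U y * (u0 y / (1 + norm y powr (real DIM('a) + 2 * s))))"
    and local_L1: "\<And>x0 R. 0 < R \<Longrightarrow> cball x0 R \<subseteq> \<Omega> \<Longrightarrow> integrable lborel (\<lambda>x. indicator (ball x0 R) x * u0 x)"
    and gagliardo: "\<And>x0 R. 0 < R \<Longrightarrow> cball x0 R \<subseteq> \<Omega> \<Longrightarrow> integrable (lborel \<Otimes>\<^sub>M lborel)
      (\<lambda>(x, y). indicator (ball x0 R) x * indicator (ball x0 R) y * ((u0 x - u0 y)\<^sup>2 * kern s (x - y)))"
    and supersolution: "\<And>x e. 0 < e \<Longrightarrow> cball x e \<subseteq> \<Omega> \<Longrightarrow>
      0 \<le> (\<integral>(y, z). indicator U y * indicator U z *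
        ((u0 y - u0 z) * (moll e (x - y) - moll e (x - z)) * kern s (y - z)) \<partial>(lborel \<Otimes>\<^sub>M lborel))"
begin

lemma obtain_radius:
  assumes "x0 \<in> \<Omega>" "0 < r1"
  obtains R where "0 < R" "R \<le> 1" "4 * R \<le> r1" "cball x0 (4 * R) \<subseteq> \<Omega>"
proof -
  obtain r where r: "0 < r" "cball x0 r \<subseteq> \<Omega>" using \<Omega>(1) assms(1) open_contains_cball by blast
  define R where "R = min 1 (min r r1) / 4"
  have "0 < R" "R \<le> 1" "4 * R \<le> r1" "4 * R \<le> r" using r(1) assms(2) by (auto simp: R_def)
  moreover have "cball x0 (4 * R) \<subseteq> \<Omega>" using r(2) \<open>4 * R \<le> r\<close> by (meson subset_cball subset_trans)
  ultimately show ?thesis using that by blast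
qed

lemma localized:
  assumes "0 < R" "cball x0 (4 * R) \<subseteq> \<Omega>"
  shows "localized s U u0 x0 R"
proof
  show "ball x0 (4 * R) \<subseteq> U" using assms(2) \<Omega>(2) ball_subset_cball by blast
qed (use assms weighted local_L1[of "4 * R" x0] gagliardo[of "4 * R" x0] in auto)

lemma localized_frac_lap_mollify_ge:
  assumes R: "0 < R" "cball x0 (4 * R) \<subseteq> \<Omega>" and e: "0 < e" "e \<le> R" and x: "x \<in> ball x0 R"
    and outer: "\<And>x. x \<in> ball x0 (2 * R) \<Longrightarrow>
      c1 \<le> (\<integral>y. (u0 y - c) * indicator (U - ball x0 (4 * R)) y * kern s (x - y) \<partial>lborel)"
  shows "2 * (c1 - K0 TYPE('a) * R powr - (2 * s) *
      mollify e (\<lambda>y. max 0 (- (indicator (ball x0 (4 * R)) y * (u0 y - c)))) x)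
    \<le> frac_lap (mollify e (\<lambda>y. indicator (ball x0 (4 * R)) y * (u0 y - c))) x"
proof -
  interpret L: localized s U u0 x0 R c by (rule localized[OF R])
  have sub: "cball x e \<subseteq> \<Omega>"
  proof
    fix y assume "y \<in> cball x e"
    then have "dist x0 y \<le> 4 * R" using x e dist_triangle[of x0 y x] by simp
    then show "y \<in> \<Omega>" using R by auto
  qed
  have f: "L.f = (\<lambda>y. indicator (ball x0 (4 * R)) y * (u0 y - c))" by (rule ext) (simp add: L.f_def)
  from L.frac_lap_mollify_ge[OF e x supersolution[OF e(1) sub] outer] show ?thesis unfolding f .
qed

text \<open>Once u0 >= c a.e. on the ball, f and its positive part g have the same convolutions.
  Passing to g gives nonnegativity at every point, as the barrier estimates require, and the zero
  order bound disappears with the negative part.\<close>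

lemma nonneg_truncation:
  fixes x0 :: 'a and R c c1 :: real
  defines "g \<equiv> (\<lambda>y. max 0 (indicator (ball x0 (4 * R)) y * (u0 y - c)))"
  assumes R: "0 < R" "cball x0 (4 * R) \<subseteq> \<Omega>"
    and ge: "AE x in lborel. x \<in> ball x0 (4 * R) \<longrightarrow> c \<le> u0 x"
    and outer: "\<And>x. x \<in> ball x0 (2 * R) \<Longrightarrow>
      c1 \<le> (\<integral>y. (u0 y - c) * indicator (U - ball x0 (4 * R)) y * kern s (x - y) \<partial>lborel)"
  shows "integrable lborel g"
    and "0 < e \<Longrightarrow> e \<le> R \<Longrightarrow> x \<in> ball x0 R \<Longrightarrow> 2 * c1 \<le> frac_lap (mollify e g) x"
proof -
  interpret L: localized s U u0 x0 R c by (rule localized[OF R])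
  have g: "g = (\<lambda>y. max 0 (L.f y))" by (rule ext) (simp add: g_def L.f_def)
  show gi: "integrable lborel g" unfolding g using L.integrable_f by auto
  have f0: "AE x in lborel. 0 \<le> L.f x"
    using ge by eventually_elim (auto simp: L.f_def indicator_def)
  have gf: "mollify e L.f = mollify e g"
    by (rule mollify_cong_AE) (use f0 in \<open>auto simp: g elim!: eventually_mono\<close>)
  have "mollify e (\<lambda>y. max 0 (- L.f y)) = mollify e (\<lambda>y. 0)"
    by (rule mollify_cong_AE) (use f0 in \<open>auto elim!: eventually_mono\<close>)
  then have fn0: "mollify e (\<lambda>y. max 0 (- L.f y)) x = 0" by (simp add: mollify_def)
  show "2 * c1 \<le> frac_lap (mollify e g) x" if "0 < e" "e \<le> R" "x \<in> ball x0 R"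
    using localized_frac_lap_mollify_ge[OF R that outer, folded L.f_def] fn0 gf by simp
qed

lemma locally_bounded_below:
  assumes "x0 \<in> \<Omega>"
  shows "\<exists>M. \<exists>r>0. AE x in lborel. x \<in> ball x0 r \<longrightarrow> - M \<le> u0 x"
proof -
  obtain R where R: "0 < R" "R \<le> 1" "cball x0 (4 * R) \<subseteq> \<Omega>" using obtain_radius[OF assms zero_less_one] by metis
  interpret L: localized s U u0 x0 R 0 by (rule localized[OF R(1,3)])
  have f: "L.f = (\<lambda>y. indicator (ball x0 (4 * R)) y * (u0 y - 0))" by (rule ext) (simp add: L.f_def)
  obtain C where C: "0 \<le> C" and outer: "\<And>x. x \<in> ball x0 (2 * R) \<Longrightarrow>
      - C \<le> (\<integral>y. (u0 y - 0) * indicator (U - ball x0 (4 * R)) y * kern s (x - y) \<partial>lborel)"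
    using L.outer_lower_bound by blast
  have "\<exists>M. AE x in lborel. x \<in> ball x0 (R / 4) \<longrightarrow> - M \<le> L.f x"
  proof (rule supersolution_bounded_below[OF L.integrable_f R(1,2), where C="2 * C" and ?C0.0="2 * (K0 TYPE('a) * R powr - (2 * s))"])
    fix e x assume "0 < e" "e \<le> R" "x \<in> ball x0 R"
    from localized_frac_lap_mollify_ge[OF R(1,3) this outer, folded f]
    show "- (2 * C) - 2 * (K0 TYPE('a) * R powr - (2 * s)) * mollify e (\<lambda>y. max 0 (- L.f y)) x \<le> frac_lap (mollify e L.f) x"
      by (simp add: f algebra_simps)
  qed (use C in auto)
  then obtain M where "AE x in lborel. x \<in> ball x0 (R / 4) \<longrightarrow> - M \<le> L.f x" by blast
  then have "AE x in lborel. x \<in> ball x0 (R / 4) \<longrightarrow> - M \<le> u0 x"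
    by eventually_elim (use R in \<open>auto simp: L.f_def\<close>)
  then show ?thesis using R by (intro exI[of _ M] exI[of _ "R / 4"]) auto
qed

text \<open>The shift c = -T, with -T a local lower bound, makes the truncation g nonnegative, and
  the density estimate applies at almost every point of {k <= u0}. The radius R depends on x1 alone,
  so one null set of exceptional points serves the whole ball.\<close>

lemma supersolution_lower_density:
  assumes x1: "x1 \<in> \<Omega>" and \<delta>: "0 < \<delta>"
  shows "\<exists>R>0. AE x in lborel. x \<in> ball x1 R \<longrightarrow> k \<le> u0 x \<longrightarrow>
     (\<exists>r>0. AE y in lborel. y \<in> ball x r \<longrightarrow> k - 2 * \<delta> \<le> u0 y)"
proof -
  obtain T r1 where T: "0 < r1" "AE x in lborel. x \<in> ball x1 r1 \<longrightarrow> - T \<le> u0 x"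
    using locally_bounded_below[OF x1] by blast
  obtain R where R: "0 < R" "R \<le> 1" "4 * R \<le> r1" "cball x1 (4 * R) \<subseteq> \<Omega>" using obtain_radius[OF x1 T(1)] by auto
  interpret L: localized s U u0 x1 R "- T" by (rule localized[OF R(1,4)])
  obtain C where C: "0 \<le> C" and outer: "\<And>x. x \<in> ball x1 (2 * R) \<Longrightarrow>
      - C \<le> (\<integral>y. (u0 y - - T) * indicator (U - ball x1 (4 * R)) y * kern s (x - y) \<partial>lborel)"
    using L.outer_lower_bound by blast
  have ge: "AE x in lborel. x \<in> ball x1 (4 * R) \<longrightarrow> - T \<le> u0 x"
    using T(2) by eventually_elim (use R(3) in auto)
  define g where "g = (\<lambda>y. max 0 (indicator (ball x1 (4 * R)) y * (u0 y - - T)))"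
  note gi = nonneg_truncation(1)[OF R(1,4) ge outer, folded g_def]
    and super = nonneg_truncation(2)[OF R(1,4) ge outer, folded g_def]
  have g: "integrable lborel g" "\<And>x. 0 \<le> g x" using gi by (auto simp: g_def)
  define k' where "k' = k + T"
  define A where "A = {y \<in> ball x1 (4 * R). g y < k'}"
  have gm[measurable]: "g \<in> borel_measurable borel" using g by auto
  have Am: "A \<in> sets borel" unfolding A_def by measurable
  have Afin: "emeasure lborel A < \<infinity>"
    by (rule emeasure_bounded_finite) (auto simp: A_def intro: bounded_subset[OF bounded_ball])
  have "AE x in lborel. x \<in> ball x1 R \<longrightarrow> k \<le> u0 x \<longrightarrow>
     (\<exists>r>0. AE y in lborel. y \<in> ball x r \<longrightarrow> k - 2 * \<delta> \<le> u0 y)"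
    using AE_density_point[OF Am Afin]
  proof eventually_elim
    case (elim x)
    show ?case
    proof (intro impI)
      assume x: "x \<in> ball x1 R" and kx: "k \<le> u0 x"
      \<comment> \<open>The R'-ball about x stays inside the R-ball about x1, where the inequality
        for g is known.\<close>
      define R' where "R' = R - dist x1 x"
      have R': "0 < R'" "R' \<le> R" "R' \<le> 1" using x R zero_le_dist[of x1 x] unfolding R'_def mem_ball by linarith+
      have sub: "ball x (3 * R') \<subseteq> ball x1 (4 * R)"
      proof
        fix y assume "y \<in> ball x (3 * R')"
        then have "dist x1 y < dist x1 x + 3 * R'" using dist_triangle[of x1 y x] by simp
        also have "\<dots> = R + 2 * R'" by (simp add: R'_def)
        also have "\<dots> \<le> 4 * R" using R(1) R'(2) by linarith
        finally show "y \<in> ball x1 (4 * R)" by simp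
      qed
      have inB: "dist x y < 3 * R' \<Longrightarrow> dist x1 y < 4 * R" for y using sub by auto
      have gu: "y \<in> ball x (3 * R') \<Longrightarrow> g y = max 0 (u0 y + T)" for y using sub by (auto simp: g_def)
      have "g x \<ge> k'" using gu[of x] kx R' by (simp add: k'_def)
      then have xA: "x \<notin> A" by (simp add: A_def)
      show "\<exists>r>0. AE y in lborel. y \<in> ball x r \<longrightarrow> k - 2 * \<delta> \<le> u0 y"
      proof (cases "\<delta> < k'")
        case True
        have "\<exists>r>0. AE y in lborel. y \<in> ball x r \<longrightarrow> k' - 2 * \<delta> \<le> g y"
        proof (rule density_lower_bound[OF g R'(1,3) _ _ \<delta> True, where c="2 * C"])
          fix e y assume "0 < e" "e \<le> R'" and y: "y \<in> ball x R'"
          have "dist x1 y < R" using y dist_triangle[of x1 y x] by (simp add: R'_def)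
          then show "- (2 * C) \<le> frac_lap (mollify e g) y" using super[of e y] \<open>0 < e\<close> \<open>e \<le> R'\<close> R'(2) by auto
        next
          fix \<gamma> r2 :: real assume "0 < \<gamma>" "0 < r2"
          then obtain r where r: "0 < r" "r \<le> min r2 R'" "measure lborel (A \<inter> ball x (3 * r)) \<le> \<gamma> * r ^ DIM('a)"
            using elim xA R'(1) by (metis min_less_iff_conj)
          have "{y \<in> ball x (3 * r). g y < k'} = A \<inter> ball x (3 * r)"
            using sub r(2) by (force simp: A_def)
          then show "\<exists>r. 0 < r \<and> r \<le> r2 \<and> measure lborel {y \<in> ball x (3 * r). g y < k'} \<le> \<gamma> * r ^ DIM('a)"
            using r by (intro exI[of _ r]) auto
        qed (use C in auto)
        then obtain r where r: "r > 0" "AE y in lborel. y \<in> ball x r \<longrightarrow> k' - 2 * \<delta> \<le> g y" by blast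
        from r(2) ge have "AE y in lborel. y \<in> ball x (min r R') \<longrightarrow> k - 2 * \<delta> \<le> u0 y"
        proof eventually_elim
          case (elim y)
          then show ?case using gu[of y] inB[of y] R'(1) by (auto simp: k'_def max_def split: if_splits)
        qed
        then show ?thesis using r(1) R'(1) by (intro exI[of _ "min r R'"]) auto
      next
        \<comment> \<open>Here k + T <= delta, so k - 2 delta already lies below the lower bound
          -T.\<close>
        case False
        from ge have "AE y in lborel. y \<in> ball x R' \<longrightarrow> k - 2 * \<delta> \<le> u0 y"
        proof eventually_elim
          case (elim y)
          then show ?case using inB[of y] R'(1) False \<delta> by (auto simp: k'_def)
        qed
        then show ?thesis using R'(1) by blast
      qed
    qed
  qed
  then show ?thesis using R(1) by blast
qed

text \<open>With c = mu the outer integrand is nonnegative, and its integral is bounded below by one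
  positive constant as soon as u0 is not a.e. equal to mu on U - B. Such a radius exists: otherwise
  u0 = mu a.e. off every small ball about x0, hence a.e. on U.\<close>

lemma strong_minimum_principle:
  assumes ge: "AE x in lborel. x \<in> U \<longrightarrow> \<mu> \<le> u0 x" and nc: "\<not> (AE x in lborel. x \<in> U \<longrightarrow> u0 x = \<mu>)"
    and x0: "x0 \<in> \<Omega>"
  shows "\<exists>\<tau>>0. \<exists>r>0. AE x in lborel. x \<in> ball x0 r \<longrightarrow> \<mu> + \<tau> \<le> u0 x"
proof -
  obtain R0 where R0: "0 < R0" "R0 \<le> 1" "cball x0 (4 * R0) \<subseteq> \<Omega>" using obtain_radius[OF x0 zero_less_one] by metis
  have "\<exists>R. 0 < R \<and> R \<le> R0 \<and> \<not> (AE x in lborel. x \<in> U - ball x0 (4 * R) \<longrightarrow> u0 x = \<mu>)"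
  proof (rule ccontr)
    assume neg: "\<not> ?thesis"
    have "AE x in lborel. x \<in> U - ball x0 (4 * (R0 / real (Suc n))) \<longrightarrow> u0 x = \<mu>" for n
    proof -
      have "0 < R0 / real (Suc n)" "R0 / real (Suc n) \<le> R0" using R0 by (auto simp: field_simps)
      then show ?thesis using neg by blast
    qed
    then have "AE x in lborel. \<forall>n. x \<in> U - ball x0 (4 * (R0 / real (Suc n))) \<longrightarrow> u0 x = \<mu>"
      unfolding AE_all_countable by (rule allI)
    moreover have "AE x in lborel. x \<noteq> x0" by (rule AE_lborel_singleton)
    ultimately have "AE x in lborel. x \<in> U \<longrightarrow> u0 x = \<mu>"
    proof eventually_elim
      case (elim x)
      show ?case
      proof
        assume "x \<in> U"
        have "0 < dist x0 x / (4 * R0)" using elim(2) R0 by simp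
        then obtain n where "1 / real (Suc n) < dist x0 x / (4 * R0)" using nat_approx_posE by blast
        then have "4 * (R0 / real (Suc n)) < dist x0 x" using R0 by (simp add: field_simps)
        then have "x \<in> U - ball x0 (4 * (R0 / real (Suc n)))" using \<open>x \<in> U\<close> by simp
        then show "u0 x = \<mu>" using elim(1) by blast
      qed
    qed
    then show False using nc by simp
  qed
  then obtain R where R: "0 < R" "R \<le> R0" and ncR: "\<not> (AE x in lborel. x \<in> U - ball x0 (4 * R) \<longrightarrow> u0 x = \<mu>)" by blast
  have RO: "cball x0 (4 * R) \<subseteq> \<Omega>" using R0(3) R(2) by (force)
  interpret L: localized s U u0 x0 R \<mu> by (rule localized[OF R(1) RO])
  have geB: "AE x in lborel. x \<in> ball x0 (4 * R) \<longrightarrow> \<mu> \<le> u0 x"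
    using ge by eventually_elim (use L.BU in auto)
  define X where "X = norm x0 + 2 * R"
  have X: "0 < X" using R by (simp add: X_def add_nonneg_pos)
  \<comment> \<open>A minorant of the outer integrand free of x, from |x - y| <= X + |y| for all x
    in the 2R-ball.\<close>
  define h where "h y = (u0 y - \<mu>) * indicator (U - ball x0 (4 * R)) y * (X + norm y) powr - (real DIM('a) + 2 * s)" for y
  have hle: "AE y in lborel. \<forall>x\<in>ball x0 (2 * R). 0 \<le> h y \<and> h y \<le> (u0 y - \<mu>) * indicator (U - ball x0 (4 * R)) y * kern s (x - y)"
    using ge
  proof eventually_elim
    case (elim y)
    show ?case
    proof
      fix x assume x: "x \<in> ball x0 (2 * R)"
      have nn: "0 \<le> (u0 y - \<mu>) * indicator (U - ball x0 (4 * R)) y" using elim by (simp add: indicator_def)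
      show "0 \<le> h y \<and> h y \<le> (u0 y - \<mu>) * indicator (U - ball x0 (4 * R)) y * kern s (x - y)"
      proof (cases "y \<in> ball x0 (4 * R)")
        case True then show ?thesis by (simp add: h_def)
      next
        case False
        have "norm x \<le> X" using x norm_triangle_ineq[of x0 "x - x0"] by (simp add: X_def dist_norm norm_minus_commute)
        then have "norm (x - y) \<le> X + norm y" using norm_triangle_ineq4[of x y] by linarith
        moreover have "x \<noteq> y" using False x R by auto
        ultimately have "(X + norm y) powr - (real DIM('a) + 2 * s) \<le> kern s (x - y)" by (intro kern_ge) auto
        then show ?thesis unfolding h_def using nn by (auto intro!: mult_left_mono mult_nonneg_nonneg)
      qed
    qed
  qed
  have hm: "h \<in> borel_measurable borel" unfolding h_def by measurable
  have ih: "integrable lborel h"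
  proof (rule Bochner_Integration.integrable_bound[OF L.integrable_outer[of x0]])
    show "x0 \<in> ball x0 (2 * R)" using R by simp
    show "AE y in lborel. norm (h y) \<le> norm ((u0 y - \<mu>) * indicator (U - ball x0 (4 * R)) y * kern s (x0 - y))"
      using hle
    proof eventually_elim
      case (elim y)
      then have "0 \<le> h y \<and> h y \<le> (u0 y - \<mu>) * indicator (U - ball x0 (4 * R)) y * kern s (x0 - y)"
        by (rule bspec) (use R in simp)
      then show ?case by (simp only: real_norm_def) linarith
    qed
  qed (use hm in simp)
  define \<gamma> where "\<gamma> = (\<integral>y. h y \<partial>lborel)"
  have h0: "AE y in lborel. 0 \<le> h y"
    using hle
  proof eventually_elim
    case (elim y)
    then show ?case using R by (auto dest: bspec[of _ _ x0])
  qed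
  have \<gamma>: "0 < \<gamma>"
  proof -
    have "0 \<le> \<gamma>" unfolding \<gamma>_def using h0 by (rule integral_nonneg_AE)
    moreover have "\<gamma> \<noteq> 0"
    proof
      assume "\<gamma> = 0"
      then have "AE y in lborel. h y = 0" unfolding \<gamma>_def using integral_nonneg_eq_0_iff_AE[OF ih h0] by simp
      then have "AE x in lborel. x \<in> U - ball x0 (4 * R) \<longrightarrow> u0 x = \<mu>"
      proof eventually_elim
        case (elim y)
        have "X + norm y \<noteq> 0" using X norm_ge_zero[of y] by linarith
        then show ?case using elim by (auto simp: h_def)
      qed
      then show False using ncR by simp
    qed
    ultimately show ?thesis by simp
  qed
  have outer: "\<gamma> \<le> (\<integral>y. (u0 y - \<mu>) * indicator (U - ball x0 (4 * R)) y * kern s (x - y) \<partial>lborel)"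
    if x: "x \<in> ball x0 (2 * R)" for x
    unfolding \<gamma>_def
  proof (rule integral_mono_AE[OF ih L.integrable_outer[OF x]])
    show "AE y in lborel. h y \<le> (u0 y - \<mu>) * indicator (U - ball x0 (4 * R)) y * kern s (x - y)"
      using hle by eventually_elim (use x in blast)
  qed
  define g where "g = (\<lambda>y. max 0 (indicator (ball x0 (4 * R)) y * (u0 y - \<mu>)))"
  note gi = nonneg_truncation(1)[OF R(1) RO geB outer, folded g_def]
    and super = nonneg_truncation(2)[OF R(1) RO geB outer, folded g_def]
  have "\<exists>\<tau>>0. \<exists>r>0. AE x in lborel. x \<in> ball x0 r \<longrightarrow> \<tau> \<le> g x"
    by (rule positive_lower_bound[OF gi _ R(1), of "2 * \<gamma>"]) (use \<gamma> super in \<open>auto simp: g_def\<close>)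
  then obtain \<tau> r where \<tau>: "\<tau> > 0" "r > 0" "AE x in lborel. x \<in> ball x0 r \<longrightarrow> \<tau> \<le> g x" by blast
  from \<tau>(3) have "AE x in lborel. x \<in> ball x0 (min r (4 * R)) \<longrightarrow> \<mu> + \<tau> \<le> u0 x"
    by eventually_elim (use \<tau>(1) in \<open>auto simp: g_def\<close>)
  then show ?thesis using \<tau> R by (intro exI[of _ \<tau>] conjI exI[of _ "min r (4 * R)"]) auto
qed

end

section \<open>Completed product measures and lower representatives\<close>

lemma sigma_finite_lebesgue: "sigma_finite_measure (lebesgue :: 'a::euclidean_space measure)"
proof
  obtain A :: "'a set set" where A: "countable A" "A \<subseteq> sets lborel" "\<Union>A = space lborel" "\<forall>a\<in>A. emeasure lborel a \<noteq> \<infinity>"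
    using lborel.sigma_finite_countable by blast
  then show "\<exists>A::'a set set. countable A \<and> A \<subseteq> sets lebesgue \<and> \<Union>A = space lebesgue \<and> (\<forall>a\<in>A. emeasure lebesgue a \<noteq> \<infinity>)"
    by (intro exI[of _ A]) (auto simp: subset_eq)
qed

lemma measurable_lebesgue_pair_id:
  "(\<lambda>z. z) \<in> lebesgue \<Otimes>\<^sub>M lebesgue \<rightarrow>\<^sub>M (lborel \<Otimes>\<^sub>M lborel :: ('a::euclidean_space \<times> 'b::euclidean_space) measure)"
proof (rule measurable_pair)
  show "fst \<circ> (\<lambda>z. z) \<in> lebesgue \<Otimes>\<^sub>M lebesgue \<rightarrow>\<^sub>M (lborel :: 'a measure)"
    unfolding comp_def by (rule measurable_compose[OF measurable_fst measurable_completion[OF measurable_ident_sets]]) simp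
  show "snd \<circ> (\<lambda>z. z) \<in> lebesgue \<Otimes>\<^sub>M lebesgue \<rightarrow>\<^sub>M (lborel :: 'b measure)"
    unfolding comp_def by (rule measurable_compose[OF measurable_snd measurable_completion[OF measurable_ident_sets]]) simp
qed

text \<open>The two products agree on Borel rectangles. Pushing forward along the identity then
  transfers integrals of Borel functions from the product of the completions to the Borel
  product.\<close>

lemma distr_lebesgue_pair:
  "distr (lebesgue \<Otimes>\<^sub>M lebesgue) (lborel \<Otimes>\<^sub>M lborel) (\<lambda>z. z)
    = (lborel \<Otimes>\<^sub>M lborel :: ('a::euclidean_space \<times> 'b::euclidean_space) measure)"
proof -
  interpret L: sigma_finite_measure "lebesgue :: 'b measure" by (rule sigma_finite_lebesgue)
  note id = measurable_lebesgue_pair_id[where 'a='a and 'b='b]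
  have "lborel \<Otimes>\<^sub>M lborel = distr (lebesgue \<Otimes>\<^sub>M lebesgue) (lborel \<Otimes>\<^sub>M lborel :: ('a \<times> 'b) measure) (\<lambda>z. z)"
  proof (rule pair_measure_eqI)
    fix A :: "'a set" and B :: "'b set" assume AB: "A \<in> sets lborel" "B \<in> sets lborel"
    then have "emeasure (distr (lebesgue \<Otimes>\<^sub>M lebesgue) (lborel \<Otimes>\<^sub>M lborel) (\<lambda>z. z)) (A \<times> B)
      = emeasure (lebesgue \<Otimes>\<^sub>M lebesgue) (A \<times> B)"
      by (subst emeasure_distr[OF id]) (auto simp: space_pair_measure intro!: arg_cong[where f="emeasure _"])
    also have "\<dots> = emeasure lborel A * emeasure lborel B"
      using AB by (subst L.emeasure_pair_measure_Times) auto
    finally show "emeasure lborel A * emeasure lborel B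
      = emeasure (distr (lebesgue \<Otimes>\<^sub>M lebesgue) (lborel \<Otimes>\<^sub>M lborel) (\<lambda>z. z)) (A \<times> B)" by simp
  qed (auto intro: lborel.sigma_finite_measure_axioms)
  then show ?thesis by simp
qed

lemma measurable_lebesgue_pair:
  fixes f :: "'a::euclidean_space \<times> 'b::euclidean_space \<Rightarrow> 'c::topological_space"
  assumes "f \<in> borel_measurable (lborel \<Otimes>\<^sub>M lborel)"
  shows "f \<in> borel_measurable (lebesgue \<Otimes>\<^sub>M lebesgue)"
  using measurable_compose[OF measurable_lebesgue_pair_id assms] .

lemma nn_integral_lebesgue_pair:
  fixes f :: "'a::euclidean_space \<times> 'b::euclidean_space \<Rightarrow> ennreal"
  assumes "f \<in> borel_measurable (lborel \<Otimes>\<^sub>M lborel)"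
  shows "(\<integral>\<^sup>+z. f z \<partial>(lebesgue \<Otimes>\<^sub>M lebesgue)) = (\<integral>\<^sup>+z. f z \<partial>(lborel \<Otimes>\<^sub>M lborel))"
  using nn_integral_distr[OF measurable_lebesgue_pair_id, of f] assms by (simp add: distr_lebesgue_pair)

lemma integral_lebesgue_pair:
  fixes f :: "'a::euclidean_space \<times> 'b::euclidean_space \<Rightarrow> real"
  assumes "f \<in> borel_measurable (lborel \<Otimes>\<^sub>M lborel)"
  shows "(\<integral>z. f z \<partial>(lebesgue \<Otimes>\<^sub>M lebesgue)) = (\<integral>z. f z \<partial>(lborel \<Otimes>\<^sub>M lborel))"
  using integral_distr[OF measurable_lebesgue_pair_id assms] by (simp add: distr_lebesgue_pair)

lemma AE_lebesgue_pair:
  fixes P :: "'a::euclidean_space \<Rightarrow> bool"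
  assumes "AE x in lborel. P x"
  shows "AE z in lebesgue \<Otimes>\<^sub>M lebesgue. P (fst z) \<and> P (snd z)"
proof -
  interpret L: sigma_finite_measure "lebesgue :: 'a measure" by (rule sigma_finite_lebesgue)
  interpret LP: pair_sigma_finite "lebesgue :: 'a measure" "lebesgue :: 'a measure" ..
  have "AE x in lebesgue. P x" using assms by (rule AE_completion)
  then obtain N where N: "N \<in> null_sets lebesgue" "{x \<in> space lebesgue. \<not> P x} \<subseteq> N"
    unfolding eventually_ae_filter by blast
  have "N \<times> space lebesgue \<union> space lebesgue \<times> N \<in> null_sets (lebesgue \<Otimes>\<^sub>M lebesgue)"
    using N(1) by (intro null_sets.Un L.times_in_null_sets1 L.times_in_null_sets2) auto
  then show ?thesis by (rule AE_I') (use N(2) in \<open>auto simp: space_pair_measure\<close>)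
qed

text \<open>The essential lower limit of u at x. Null sets are invisible to it, and lower
  semicontinuity is built in: a bound on a ball about x is also one on smaller balls about nearby
  points.\<close>

definition ess_lower :: "('a::euclidean_space \<Rightarrow> real) \<Rightarrow> 'a \<Rightarrow> ereal" where
  "ess_lower u x = Sup {ereal c | c. \<exists>r>0. AE y in lborel. y \<in> ball x r \<longrightarrow> c \<le> u y}"

lemma ess_lower_ge:
  "0 < r \<Longrightarrow> AE y in lborel. y \<in> ball x r \<longrightarrow> c \<le> u y \<Longrightarrow> ereal c \<le> ess_lower u x"
  unfolding ess_lower_def by (intro Sup_upper) blast

lemma ess_lower_gtD:
  assumes "t < ess_lower u x"
  obtains c r where "t < ereal c" "0 < r" "AE y in lborel. y \<in> ball x r \<longrightarrow> c \<le> u y"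
  using assms unfolding ess_lower_def less_Sup_iff by blast

lemma ess_lower_ge_nearby:
  assumes r: "0 < r" and ae: "AE y in lborel. y \<in> ball x r \<longrightarrow> c \<le> u y" and y: "y \<in> ball x r"
  shows "ereal c \<le> ess_lower u y"
proof (rule ess_lower_ge)
  show "0 < r - dist x y" using y by simp
  show "AE z in lborel. z \<in> ball y (r - dist x y) \<longrightarrow> c \<le> u z"
    using ae
  proof eventually_elim
    case (elim z)
    then show ?case using dist_triangle[of x z y] by auto
  qed
qed

text \<open>A null neighbourhood at each point of S gives S zero outer density at its own points,
  hence negligibility. S is not assumed measurable, which suits the exceptional sets below, defined
  by existential conditions on balls.\<close>

lemma AE_locally:
  fixes S :: "'a::euclidean_space set"
  assumes "\<And>x. x \<in> S \<Longrightarrow> \<exists>r>0. AE y in lborel. y \<in> ball x r \<longrightarrow> y \<notin> S"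
  shows "AE y in lborel. y \<notin> S"
proof -
  have "negligible S"
    unfolding negligible_eq_zero_density
  proof (intro ballI allI impI)
    fix x and r e :: real assume "x \<in> S" "0 < r" "0 < e"
    from assms[OF \<open>x \<in> S\<close>] obtain r' where r': "r' > 0" "AE y in lborel. y \<in> ball x r' \<longrightarrow> y \<notin> S" by blast
    from r'(2) obtain N where N: "N \<in> null_sets lborel" "{y \<in> space lborel. \<not> (y \<in> ball x r' \<longrightarrow> y \<notin> S)} \<subseteq> N"
      unfolding eventually_ae_filter by blast
    have N': "N \<in> null_sets lebesgue" using N(1) by (rule null_sets_completionI)
    show "\<exists>d. 0 < d \<and> d \<le> r \<and> (\<exists>U. S \<inter> ball x d \<subseteq> U \<and> U \<in> lmeasurable \<and>
        measure lebesgue U < e * measure lebesgue (ball x d))"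
    proof (intro exI conjI)
      show "0 < min r r'" "min r r' \<le> r" using r' \<open>0 < r\<close> by auto
      show "S \<inter> ball x (min r r') \<subseteq> N" using N(2) by auto
      show "N \<in> lmeasurable" using N' by (auto simp: fmeasurable_def null_sets_def)
      have "measure lebesgue N = 0" using N' by (simp add: measure_eq_0_null_sets)
      moreover have "0 < measure lebesgue (ball x (min r r'))"
        using r'(1) \<open>0 < r\<close> by (simp add: content_ball_pos)
      ultimately show "measure lebesgue N < e * measure lebesgue (ball x (min r r'))"
        using \<open>0 < e\<close> by simp
    qed
  qed
  then have "S \<in> null_sets lebesgue" by (simp add: negligible_iff_null_sets)
  from AE_not_in[OF this] show ?thesis by (simp add: AE_completion_iff)
qed

text \<open>Rational levels make the exceptional set a countable union. For one level q, the points
  with u < q near which u >= q a.e. form a set that is locally null by its very definition.\<close>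

lemma ess_lower_le_AE:
  fixes u :: "'a::euclidean_space \<Rightarrow> real"
  shows "AE x in lborel. ess_lower u x \<le> ereal (u x)"
proof -
  let ?S = "\<lambda>q::rat. {x. u x < of_rat q \<and> (\<exists>r>0. AE y in lborel. y \<in> ball x r \<longrightarrow> of_rat q \<le> u y)}"
  have "AE x in lborel. x \<notin> ?S q" for q
  proof (rule AE_locally)
    fix x assume "x \<in> ?S q"
    then obtain r where "r > 0" "AE y in lborel. y \<in> ball x r \<longrightarrow> of_rat q \<le> u y" by blast
    then show "\<exists>r>0. AE y in lborel. y \<in> ball x r \<longrightarrow> y \<notin> ?S q"
      by (intro exI[of _ r]) (auto elim!: eventually_mono)
  qed
  then have "AE x in lborel. \<forall>q. x \<notin> ?S q" unfolding AE_all_countable by (rule allI)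
  then show ?thesis
  proof eventually_elim
    case (elim x)
    show ?case
    proof (rule ccontr)
      assume "\<not> ?thesis"
      then have "ereal (u x) < ess_lower u x" by simp
      then obtain c r where c: "ereal (u x) < ereal c" "0 < r" "AE y in lborel. y \<in> ball x r \<longrightarrow> c \<le> u y"
        by (rule ess_lower_gtD)
      then obtain q where q: "u x < of_rat q" "of_rat q < c" using of_rat_dense[of "u x" c] by auto
      from c(3) have "AE y in lborel. y \<in> ball x r \<longrightarrow> of_rat q \<le> u y"
        by eventually_elim (use q in auto)
      then have "x \<in> ?S q" using q c(2) by blast
      then show False using elim by blast
    qed
  qed
qed

context regional_supersolution
begin

text \<open>This half uses the supersolution property: for rational q and each n, the points of {q
  <= u0} at which q - 2/(n+1) is not a local lower bound are locally null by
  \<open>supersolution_lower_density\<close>.\<close>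

lemma ess_lower_ge_AE: "AE x in lborel. x \<in> \<Omega> \<longrightarrow> ereal (u0 x) \<le> ess_lower u0 x"
proof -
  let ?d = "\<lambda>n. 1 / real (Suc n)"
  let ?S = "\<lambda>q n. {x \<in> \<Omega>. of_rat q \<le> u0 x \<and>
     \<not> (\<exists>r>0. AE y in lborel. y \<in> ball x r \<longrightarrow> of_rat q - 2 * ?d n \<le> u0 y)}"
  have "AE x in lborel. x \<notin> ?S q n" for q n
  proof (rule AE_locally)
    fix x assume "x \<in> ?S q n"
    then have "x \<in> \<Omega>" by blast
    from supersolution_lower_density[OF this, of "?d n" "of_rat q"] obtain R where
      "R > 0" and R: "AE y in lborel. y \<in> ball x R \<longrightarrow> of_rat q \<le> u0 y \<longrightarrow>
         (\<exists>r>0. AE z in lborel. z \<in> ball y r \<longrightarrow> of_rat q - 2 * ?d n \<le> u0 z)" by auto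
    from R have "AE y in lborel. y \<in> ball x R \<longrightarrow> y \<notin> ?S q n"
      by eventually_elim blast
    then show "\<exists>r>0. AE y in lborel. y \<in> ball x r \<longrightarrow> y \<notin> ?S q n" using \<open>R > 0\<close> by blast
  qed
  then have "AE x in lborel. \<forall>q n. x \<notin> ?S q n" unfolding AE_all_countable by (intro allI)
  then show ?thesis
  proof eventually_elim
    case (elim x)
    show ?case
    proof
      assume x: "x \<in> \<Omega>"
      show "ereal (u0 x) \<le> ess_lower u0 x"
      proof (rule dense_le)
        fix t assume t: "t < ereal (u0 x)"
        show "t \<le> ess_lower u0 x"
        proof (cases t)
          case (real t')
          obtain q where q: "t' < of_rat q" "of_rat q < u0 x" using of_rat_dense[of t' "u0 x"] t real by auto
          then have "0 < (of_rat q - t') / 2" by simp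
          then obtain n where n: "?d n < (of_rat q - t') / 2" using nat_approx_posE by blast
          from elim[rule_format, of q n] x q obtain r where
            "r > 0" "AE y in lborel. y \<in> ball x r \<longrightarrow> of_rat q - 2 * ?d n \<le> u0 y" by auto
          then have "ereal (of_rat q - 2 * ?d n) \<le> ess_lower u0 x" by (rule ess_lower_ge)
          moreover obtain d where d: "d = ?d n" by blast
          have "t' \<le> of_rat q - 2 * d" using n unfolding d[symmetric] by (simp add: field_simps)
          then have "t' \<le> of_rat q - 2 * ?d n" unfolding d .
          ultimately show ?thesis using real by (metis ereal_less_eq(3) order_trans)
        qed (use t in auto)
      qed
    qed
  qed
qed

end

section \<open>The strong minimum principle\<close>

lemma frac_const_pos: "0 < s \<Longrightarrow> s < 1 \<Longrightarrow> 0 < frac_const TYPE('n::finite) s"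
  unfolding frac_const_def
  by (intro divide_pos_pos mult_pos_pos) (auto intro!: Gamma_real_pos add_nonneg_pos)

lemma kern_vec: "kern s (x :: real ^ 'n) = 1 / norm x powr (real CARD('n) + 2 * s)"
  by (simp add: kern_def)

lemma Hs_loc_local_integrability:
  fixes u u0 :: "real ^ 'n \<Rightarrow> real"
  assumes u: "u \<in> Hs_loc s \<Omega>" and [measurable]: "u0 \<in> borel_measurable borel"
    and ae: "AE x in lborel. x \<in> \<Omega> \<longrightarrow> u x = u0 x" and R: "0 < R" "cball x0 R \<subseteq> \<Omega>"
  shows "integrable lborel (\<lambda>x. indicator (ball x0 R) x * u0 x)"
    and "integrable (lborel \<Otimes>\<^sub>M lborel)
      (\<lambda>(x, y). indicator (ball x0 R) x * indicator (ball x0 R) y * ((u0 x - u0 y)\<^sup>2 * kern s (x - y)))"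
proof -
  let ?B = "ball x0 R"
  have "?B \<Subset> \<Omega>" using R by (simp add: compactly_contained_def)
  then obtain v where v: "v \<in> Hs s" "AE x in lebesgue. x \<in> ?B \<longrightarrow> u x = v x"
    using u unfolding Hs_loc_def by blast
  have vae: "AE x in lborel. x \<in> ?B \<longrightarrow> u0 x = v x"
    using v(2) ae unfolding AE_completion_iff
    by eventually_elim (use subset_trans[OF ball_subset_cball R(2)] in auto)
  have Bm[measurable]: "?B \<in> sets borel" by simp
  have v2: "integrable lebesgue (\<lambda>x. (v x)\<^sup>2)" using v(1) by (simp add: Hs_def)
  have iB: "integrable lebesgue (indicator ?B :: real ^ 'n \<Rightarrow> real)"
    by (subst integrable_completion) (auto intro: integrable_indicator_ball)
  have m1: "(\<lambda>x. indicator ?B x * u0 x) \<in> borel_measurable lborel" by measurable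
  have "integrable lebesgue (\<lambda>x. indicator ?B x * u0 x)"
  proof (rule Bochner_Integration.integrable_bound)
    show "integrable lebesgue (\<lambda>x. indicator ?B x + (v x)\<^sup>2)" using iB v2 by auto
    show "(\<lambda>x. indicator ?B x * u0 x) \<in> borel_measurable lebesgue" using m1 by (rule measurable_completion)
    show "AE x in lebesgue. norm (indicator ?B x * u0 x) \<le> norm (indicator ?B x + (v x)\<^sup>2)"
      using AE_completion[OF vae]
    proof eventually_elim
      case (elim x)
      \<comment> \<open>On a ball L^2 embeds into L^1; this crude bound stands in for
        Cauchy-Schwarz.\<close>
      have "\<bar>v x\<bar> \<le> 1 + (v x)\<^sup>2"
        using sum_squares_bound[of "\<bar>v x\<bar>" 1] by (simp add: power2_eq_square)
      then show ?case using elim by (cases "x \<in> ?B") auto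
    qed
  qed
  then show "integrable lborel (\<lambda>x. indicator ?B x * u0 x)" using integrable_completion[OF m1] by simp
  let ?g = "\<lambda>(x, y). indicator ?B x * indicator ?B y * ((u0 x - u0 y)\<^sup>2 * kern s (x - y)) :: real"
  have m2: "?g \<in> borel_measurable (lborel \<Otimes>\<^sub>M lborel)" unfolding case_prod_beta' by measurable
  show "integrable (lborel \<Otimes>\<^sub>M lborel) ?g"
  proof (rule integrableI_bounded[OF m2])
    have "(\<integral>\<^sup>+z. ennreal (norm (?g z)) \<partial>(lborel \<Otimes>\<^sub>M lborel)) = (\<integral>\<^sup>+z. ennreal (norm (?g z)) \<partial>(lebesgue \<Otimes>\<^sub>M lebesgue))"
      using m2 by (intro nn_integral_lebesgue_pair[symmetric]) simp
    also have "\<dots> \<le> (\<integral>\<^sup>+(x, y). ennreal ((v x - v y)\<^sup>2 / norm (x - y) powr (real CARD('n) + 2 * s)) \<partial>(lebesgue \<Otimes>\<^sub>M lebesgue))"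
    proof (rule nn_integral_mono_AE)
      show "AE z in lebesgue \<Otimes>\<^sub>M lebesgue. ennreal (norm (?g z)) \<le>
         (case z of (x, y) \<Rightarrow> ennreal ((v x - v y)\<^sup>2 / norm (x - y) powr (real CARD('n) + 2 * s)))"
        using AE_lebesgue_pair[OF vae]
      proof eventually_elim
        case (elim z)
        obtain x y where z: "z = (x, y)" by (cases z)
        show ?case
        proof (cases "x \<in> ?B \<and> y \<in> ?B")
          case True
          then have "norm (?g z) = (v x - v y)\<^sup>2 / norm (x - y) powr (real CARD('n) + 2 * s)"
            using elim by (simp add: z kern_vec)
          then show ?thesis by (simp add: z)
        qed (auto simp: z)
      qed
    qed
    also have "\<dots> < \<infinity>" using v(1) by (simp add: Hs_def)
    finally show "(\<integral>\<^sup>+z. ennreal (norm (?g z)) \<partial>(lborel \<Otimes>\<^sub>M lborel)) < \<infinity>" .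
  qed
qed

text \<open>Pairs in \<open>(U1 \<union> U2)\<^sup>2\<close> outside \<open>Zset U1 U2\<close> do not contribute, since test functions vanish off \<open>U1 \<inter> U2\<close>.\<close>

lemma frac_pairing_eq_regional_form:
  fixes u u0 \<phi> :: "real ^ 'n \<Rightarrow> real"
  assumes open_sets: "open U1" "open U2" and um: "u \<in> borel_measurable (lebesgue_on (U1 \<union> U2))"
    and [measurable]: "u0 \<in> borel_measurable borel" "\<phi> \<in> borel_measurable borel"
    and ae: "AE x in lborel. x \<in> U1 \<union> U2 \<longrightarrow> u x = u0 x"
    and \<phi>: "\<And>x. x \<notin> U1 \<inter> U2 \<Longrightarrow> \<phi> x = 0"
  shows "frac_pairing s (Zset U1 U2) u \<phi> = frac_const TYPE('n) s / 2 *
     (\<integral>(x, y). indicator (U1 \<union> U2) x * indicator (U1 \<union> U2) y * ((u0 x - u0 y) * (\<phi> x - \<phi> y) * kern s (x - y))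
        \<partial>(lborel \<Otimes>\<^sub>M lborel))"
proof -
  let ?U = "U1 \<union> U2" and ?M = "lebesgue \<Otimes>\<^sub>M lebesgue :: ((real ^ 'n) \<times> (real ^ 'n)) measure"
  have [measurable]: "?U \<in> sets borel" using open_sets by auto
  \<comment> \<open>u is measurable on U only. Its extension by zero is measurable everywhere, and
    the integrand sees u only at points of U.\<close>
  define u' where "u' x = indicator ?U x *\<^sub>R u x" for x
  have u'm: "u' \<in> borel_measurable lebesgue"
    using um unfolding u'_def by (subst (asm) borel_measurable_restrict_space_iff) auto
  let ?k = "\<lambda>z. indicator ?U (fst z) * indicator ?U (snd z) * (\<phi> (fst z) - \<phi> (snd z)) * kern s (fst z - snd z) :: real"
  let ?g0 = "\<lambda>z. (u0 (fst z) - u0 (snd z)) * ?k z"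
  have km: "?k \<in> borel_measurable (lborel \<Otimes>\<^sub>M lborel)" by measurable
  have g0m: "?g0 \<in> borel_measurable (lborel \<Otimes>\<^sub>M lborel)" by measurable
  have "(\<integral>z. indicator (Zset U1 U2) z *\<^sub>R
      (case z of (x, y) \<Rightarrow> (u x - u y) * (\<phi> x - \<phi> y) / norm (x - y) powr (real CARD('n) + 2 * s)) \<partial>?M)
    = (\<integral>z. (u' (fst z) - u' (snd z)) * ?k z \<partial>?M)"
  proof (rule Bochner_Integration.integral_cong[OF refl])
    fix z :: "(real ^ 'n) \<times> (real ^ 'n)"
    obtain x y where z: "z = (x, y)" by (cases z)
    consider "z \<in> Zset U1 U2" | "x \<in> ?U" "y \<in> ?U" "z \<notin> Zset U1 U2" | "x \<notin> ?U \<or> y \<notin> ?U" by blast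
    then show "indicator (Zset U1 U2) z *\<^sub>R
      (case z of (x, y) \<Rightarrow> (u x - u y) * (\<phi> x - \<phi> y) / norm (x - y) powr (real CARD('n) + 2 * s))
      = (u' (fst z) - u' (snd z)) * ?k z"
    proof cases
      case 1
      then have "x \<in> ?U" "y \<in> ?U" by (auto simp: z Zset_def)
      with 1 show ?thesis by (simp add: z u'_def kern_vec)
    next
      case 2
      then have "x \<notin> U1 \<inter> U2" "y \<notin> U1 \<inter> U2" by (auto simp: z Zset_def)
      with 2 show ?thesis by (simp add: z \<phi>)
    next
      case 3
      then have "z \<notin> Zset U1 U2" by (auto simp: z Zset_def)
      with 3 show ?thesis by (auto simp: z)
    qed
  qed
  also have "\<dots> = (\<integral>z. ?g0 z \<partial>?M)"
  proof (rule integral_cong_AE)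
    show "(\<lambda>z. (u' (fst z) - u' (snd z)) * ?k z) \<in> borel_measurable ?M"
      by (intro borel_measurable_times borel_measurable_diff measurable_compose[OF measurable_fst u'm]
          measurable_compose[OF measurable_snd u'm] measurable_lebesgue_pair[OF km, unfolded])
    show "?g0 \<in> borel_measurable ?M" by (rule measurable_lebesgue_pair[OF g0m])
    show "AE z in ?M. (u' (fst z) - u' (snd z)) * ?k z = ?g0 z"
      using AE_lebesgue_pair[OF ae]
    proof eventually_elim
      case (elim z)
      then show ?case by (cases "fst z \<in> ?U"; cases "snd z \<in> ?U") (auto simp: u'_def)
    qed
  qed
  also have "\<dots> = (\<integral>z. ?g0 z \<partial>(lborel \<Otimes>\<^sub>M lborel))" by (rule integral_lebesgue_pair[OF g0m])
  also have "?g0 = (\<lambda>(x, y). indicator ?U x * indicator ?U y * ((u0 x - u0 y) * (\<phi> x - \<phi> y) * kern s (x - y)))"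
    by (simp add: fun_eq_iff)
  finally show ?thesis by (simp add: frac_pairing_def set_lebesgue_integral_def)
qed

lemma weighted_integrable_borel:
  fixes u u0 w :: "'a::euclidean_space \<Rightarrow> real"
  assumes [measurable]: "U \<in> sets borel" "u0 \<in> borel_measurable borel" "w \<in> borel_measurable borel"
    and ae: "AE x in lborel. x \<in> U \<longrightarrow> u x = u0 x" and w: "\<And>x. 0 \<le> w x"
    and i: "set_integrable lebesgue U (\<lambda>x. \<bar>u x\<bar> / w x)"
  shows "integrable lborel (\<lambda>x. indicator U x * (u0 x / w x))"
proof -
  let ?f = "\<lambda>x. indicator U x * (u0 x / w x)"
  have m: "?f \<in> borel_measurable lborel" by measurable
  have "integrable lebesgue ?f"
  proof (rule Bochner_Integration.integrable_bound)
    show "integrable lebesgue (\<lambda>x. indicator U x *\<^sub>R (\<bar>u x\<bar> / w x))" using i by (simp add: set_integrable_def)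
    show "?f \<in> borel_measurable lebesgue" using m by (rule measurable_completion)
    show "AE x in lebesgue. norm (?f x) \<le> norm (indicator U x *\<^sub>R (\<bar>u x\<bar> / w x))"
      using AE_completion[OF ae] by eventually_elim (auto simp: indicator_def)
  qed
  then show ?thesis using integrable_completion[OF m] by simp
qed

theorem theorem4p1:
  fixes s :: real
    and \<Omega> U1 U2 :: "(real ^ 'n) set"
    and u :: "real ^ 'n \<Rightarrow> real"
  assumes "0 < s" and "s < 1"
    and "open \<Omega>" and "connected \<Omega>" and "\<Omega> \<noteq> {}"
    and "open U1" and "open U2" and "\<Omega> \<subseteq> U1 \<inter> U2"
    and "u \<in> borel_measurable (lebesgue_on (U1 \<union> U2))"
    and nonconstant: "\<not> (\<exists>c. AE x in lebesgue_on (U1 \<union> U2). u x = c)"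
    and "u \<in> Hs_loc s \<Omega>"
    and "set_integrable lebesgue (U1 \<union> U2)
           (\<lambda>x. \<bar>u x\<bar> / (1 + norm x powr (real CARD('n) + 2 * s)))"
    and "frac_nonneg s (Zset U1 U2) \<Omega> u"
  shows "\<exists>w :: real ^ 'n \<Rightarrow> ereal.
           (\<forall>x \<in> (U1 \<union> U2) - \<Omega>. w x = ereal (u x)) \<and>
           (AE x in lebesgue_on \<Omega>. w x = ereal (u x)) \<and>
           (\<forall>x\<in>\<Omega>. w x \<noteq> -\<infinity>) \<and>
           lsc_on \<Omega> w \<and>
           locally_bounded_below_on \<Omega> w \<and>
           (\<forall>x\<in>\<Omega>. w x > ess_inf (U1 \<union> U2) w)"
proof -
  define U where "U = U1 \<union> U2"
  have UO: "open U" "\<Omega> \<subseteq> U" "U \<in> sets lebesgue" "\<Omega> \<in> sets lebesgue"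
    using assms(3,6-8) by (auto simp: U_def)
  have AE_on: "(AE x in lebesgue_on A. P x) \<longleftrightarrow> (AE x in lborel. x \<in> A \<longrightarrow> P x)"
    if "A \<in> sets lebesgue" for A and P :: "real ^ 'n \<Rightarrow> bool"
    using that by (subst AE_restrict_space_iff) (auto simp: AE_completion_iff)
  have "(\<lambda>x. indicator U x *\<^sub>R u x) \<in> borel_measurable lebesgue"
    using assms(9) UO(3) unfolding U_def[symmetric] by (subst (asm) borel_measurable_restrict_space_iff) auto
  from completion_ex_borel_measurable_real[OF this] obtain u0 where
    u0: "u0 \<in> borel_measurable lborel" "AE x in lborel. indicator U x *\<^sub>R u x = u0 x" by blast
  have u0m[measurable]: "u0 \<in> borel_measurable borel" using u0(1) by simp
  have ae: "AE x in lborel. x \<in> U \<longrightarrow> u x = u0 x"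
    using u0(2) by eventually_elim auto
  have ae\<Omega>: "AE x in lborel. x \<in> \<Omega> \<longrightarrow> u x = u0 x"
    using ae by eventually_elim (use UO(2) in auto)
  interpret regional_supersolution s U \<Omega> u0
  proof
    show "U \<in> sets borel" using UO by simp
    show "integrable lborel (\<lambda>y. indicator U y * (u0 y / (1 + norm y powr (real DIM(real ^ 'n) + 2 * s))))"
      using assms(12) ae UO unfolding U_def[symmetric]
      by (intro weighted_integrable_borel[where u=u]) (auto intro: add_nonneg_nonneg)
    show "integrable lborel (\<lambda>x. indicator (ball x0 R) x * u0 x)" if "0 < R" "cball x0 R \<subseteq> \<Omega>" for x0 R
      by (rule Hs_loc_local_integrability(1)[OF assms(11) u0m ae\<Omega> that])
    show "integrable (lborel \<Otimes>\<^sub>M lborel)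
      (\<lambda>(x, y). indicator (ball x0 R) x * indicator (ball x0 R) y * ((u0 x - u0 y)\<^sup>2 * kern s (x - y)))"
      if "0 < R" "cball x0 R \<subseteq> \<Omega>" for x0 R
      by (rule Hs_loc_local_integrability(2)[OF assms(11) u0m ae\<Omega> that])
    show "0 \<le> (\<integral>(y, z). indicator U y * indicator U z *
        ((u0 y - u0 z) * (moll e (x - y) - moll e (x - z)) * kern s (y - z)) \<partial>(lborel \<Otimes>\<^sub>M lborel))"
      if e: "0 < e" "cball x e \<subseteq> \<Omega>" for x e
    proof -
      have "frac_pairing s (Zset U1 U2) u (\<lambda>y. moll e (x - y)) \<ge> 0"
        using assms(13) moll_test_function[OF e] e(1) by (auto simp: frac_nonneg_def)
      also have "frac_pairing s (Zset U1 U2) u (\<lambda>y. moll e (x - y)) = frac_const TYPE('n) s / 2 *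
        (\<integral>(y, z). indicator U y * indicator U z *
        ((u0 y - u0 z) * (moll e (x - y) - moll e (x - z)) * kern s (y - z)) \<partial>(lborel \<Otimes>\<^sub>M lborel))"
        unfolding U_def
      proof (rule frac_pairing_eq_regional_form[OF assms(6,7,9) u0m _ ae[unfolded U_def]])
        show "moll e (x - y) = 0" if "y \<notin> U1 \<inter> U2" for y
        proof (rule moll_eq_0[OF e(1)])
          have "y \<notin> cball x e" using that e(2) assms(8) by blast
          then show "e \<le> norm (x - y)" by (simp add: dist_norm)
        qed
      qed simp
      finally show ?thesis
        using frac_const_pos[OF assms(1,2), where 'n='n] by (simp add: zero_le_mult_iff)
    qed
  qed (use assms(1-3) UO(2) in auto)
  \<comment> \<open>The essential lower limit provides a value at every point of Omega, where the
    conclusion is pointwise, and does not depend on the choice of u0 within its a.e. class.\<close>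
  define w where "w x = (if x \<in> \<Omega> then ess_lower u0 x else ereal (u x))" for x
  have w\<Omega>: "AE x in lborel. x \<in> \<Omega> \<longrightarrow> w x = ereal (u x)"
    using ess_lower_le_AE[of u0] ess_lower_ge_AE ae\<Omega>
    by eventually_elim (auto simp: w_def intro: antisym)
  have wU: "AE x in lborel. x \<in> U \<longrightarrow> w x = ereal (u0 x)"
    using w\<Omega> ae by eventually_elim (auto simp: w_def)
  \<comment> \<open>One local bound serves twice: for w > -infinity and, through a finite subcover,
    for the bound on compact sets.\<close>
  have below: "\<exists>M r. 0 < r \<and> (\<forall>y\<in>ball x r. y \<in> \<Omega> \<longrightarrow> ereal (- M) \<le> w y)" if x: "x \<in> \<Omega>" for x
  proof -
    obtain M r where r: "r > 0" "AE y in lborel. y \<in> ball x r \<longrightarrow> - M \<le> u0 y"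
      using locally_bounded_below[OF x] by blast
    then have "\<forall>y\<in>ball x r. y \<in> \<Omega> \<longrightarrow> ereal (- M) \<le> w y"
      using ess_lower_ge_nearby[OF r] by (simp add: w_def)
    then show ?thesis using r(1) by blast
  qed
  have "w x \<noteq> -\<infinity>" if x: "x \<in> \<Omega>" for x
    using below[OF x] x by (metis MInfty_neq_ereal(1) centre_in_ball ereal_infty_less_eq(2))
  moreover have "lsc_on \<Omega> w"
    unfolding lsc_on_def
  proof
    fix x assume x: "x \<in> \<Omega>"
    show "w x \<le> Liminf (at x within \<Omega>) w"
      unfolding le_Liminf_iff
    proof (intro allI impI)
      fix t assume "t < w x"
      then obtain c r where c: "t < ereal c" "0 < r" "AE y in lborel. y \<in> ball x r \<longrightarrow> c \<le> u0 y"
        using x by (auto simp: w_def elim: ess_lower_gtD)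
      have "t < w y" if "y \<in> \<Omega>" "y \<in> ball x r" for y
        using less_le_trans[OF c(1) ess_lower_ge_nearby[OF c(2,3) that(2)]] that(1) by (simp add: w_def)
      then show "\<forall>\<^sub>F y in at x within \<Omega>. t < w y"
        unfolding eventually_at using c(2) by (intro exI[of _ r]) (auto simp: dist_commute)
    qed
  qed
  moreover have "locally_bounded_below_on \<Omega> w"
    unfolding locally_bounded_below_on_def
  proof (intro allI impI)
    fix K assume K: "compact K \<and> K \<subseteq> \<Omega>"
    obtain M r where r: "\<And>x. x \<in> \<Omega> \<Longrightarrow> 0 < r x \<and> (\<forall>y\<in>ball x (r x). y \<in> \<Omega> \<longrightarrow> ereal (- M x) \<le> w y)"
      using below by metis
    have "K \<subseteq> (\<Union>x\<in>K. ball x (r x))" using r K by force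
    then obtain C where C: "C \<subseteq> K" "finite C" "K \<subseteq> (\<Union>x\<in>C. ball x (r x))"
      using compactE_image[of K K "\<lambda>x. ball x (r x)"] K by auto
    show "\<exists>m::real. \<forall>x\<in>K. ereal m \<le> w x"
    proof (intro exI ballI)
      fix y assume y: "y \<in> K"
      then obtain x where x: "x \<in> C" "y \<in> ball x (r x)" using C(3) by blast
      \<comment> \<open>A sum of absolute values instead of a maximum, so that an empty subcover
        needs no separate case.\<close>
      have "M x \<le> (\<Sum>x\<in>C. \<bar>M x\<bar>)" using member_le_sum[of x C "\<lambda>x. \<bar>M x\<bar>"] x C(2) by auto
      then have "ereal (- (\<Sum>x\<in>C. \<bar>M x\<bar>)) \<le> ereal (- M x)" by simp
      also have "\<dots> \<le> w y" using r[of x] x y C(1) K by blast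
      finally show "ereal (- (\<Sum>x\<in>C. \<bar>M x\<bar>)) \<le> w y" .
    qed
  qed
  moreover have "w x > ess_inf (U1 \<union> U2) w" if x: "x \<in> \<Omega>" for x
  proof -
    define I where "I = ess_inf U w"
    \<comment> \<open>Every level strictly below I is exceeded a.e.; the level I itself is reached
      below by intersecting countably many such statements.\<close>
    have I_less: "AE y in lborel. y \<in> U \<longrightarrow> t < w y" if "t < I" for t
      using that unfolding I_def ess_inf_def AE_on[OF UO(3), symmetric] by (auto simp: less_LiminfD)
    have nc: "\<not> (AE y in lborel. y \<in> U \<longrightarrow> u0 y = c)" for c
    proof
      assume "AE y in lborel. y \<in> U \<longrightarrow> u0 y = c"
      with ae have "AE y in lborel. y \<in> U \<longrightarrow> u y = c" by eventually_elim auto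
      then show False using nonconstant AE_on[OF UO(3), of "\<lambda>y. u y = c"] unfolding U_def by blast
    qed
    have "I < w x"
    proof (cases I)
      case MInf
      then show ?thesis using \<open>x \<in> \<Omega> \<Longrightarrow> w x \<noteq> -\<infinity>\<close> x by simp
    next
      \<comment> \<open>Then u0 would exceed every natural number a.e. on U, so U would be null and
        u0 vacuously constant a.e. on U, which \<open>nc\<close> excludes.\<close>
      case PInf
      have "AE y in lborel. \<forall>n. y \<in> U \<longrightarrow> ereal (real n) < w y"
        unfolding AE_all_countable by (intro allI I_less) (simp add: PInf)
      with wU have "AE y in lborel. y \<in> U \<longrightarrow> u0 y = 0"
      proof eventually_elim
        case (elim y)
        show ?case
        proof
          assume "y \<in> U"
          then have "\<forall>n. real n < u0 y" using elim by simp
          then show "u0 y = 0" using reals_Archimedean2[of "u0 y"] less_asym by blast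
        qed
      qed
      then show ?thesis using nc by blast
    next
      case (real \<mu>)
      have "AE y in lborel. \<forall>n. y \<in> U \<longrightarrow> ereal (\<mu> - 1 / real (Suc n)) < w y"
        unfolding AE_all_countable by (intro allI I_less) (simp add: real)
      with wU have "AE y in lborel. y \<in> U \<longrightarrow> \<mu> \<le> u0 y"
      proof eventually_elim
        case (elim y)
        show ?case
        proof
          assume "y \<in> U"
          then have *: "\<mu> - 1 / real (Suc n) < u0 y" for n using elim by simp
          show "\<mu> \<le> u0 y"
          proof (rule ccontr)
            assume "\<not> \<mu> \<le> u0 y"
            then obtain n where "1 / real (Suc n) < \<mu> - u0 y" using nat_approx_posE[of "\<mu> - u0 y"] by auto
            then show False using *[of n] by linarith
          qed
        qed
      qed
      from strong_minimum_principle[OF this nc x] obtain \<tau> r where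
        \<tau>: "\<tau> > 0" "r > 0" "AE y in lborel. y \<in> ball x r \<longrightarrow> \<mu> + \<tau> \<le> u0 y" by blast
      have "I < ereal (\<mu> + \<tau>)" using \<tau>(1) by (simp add: real)
      also have "\<dots> \<le> w x" using ess_lower_ge[OF \<tau>(2,3)] x by (simp add: w_def)
      finally show ?thesis .
    qed
    then show ?thesis by (simp add: I_def U_def)
  qed
  moreover have "AE x in lebesgue_on \<Omega>. w x = ereal (u x)" using w\<Omega> by (simp add: AE_on[OF UO(4)])
  moreover have "\<forall>x \<in> (U1 \<union> U2) - \<Omega>. w x = ereal (u x)" by (simp add: w_def)
  ultimately show ?thesis by blast
qed

end
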